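(* Let $f:2^{\omega}\to\mathcal{M}$ be a computable function and let $\mathcal{D}\subseteq 2^{\omega}$ be an effectively closed set such that for any $X\neq Y$ in $\mathcal{D}$ the measures $f(X),f(Y)$ are effectively orthogonal. Let $\mathcal{D}^{*}\subseteq\mathcal{D}$ be a class of computable reals. Then $\mathcal{D}^{*}$ is EX-learnable (as a class of computable reals) if and only if $f(\mathcal{D}^{*})$ is EX-learnable (as a class of computable measures). Likewise, $\mathcal{D}^{*}$ is BC-learnable if and only if $f(\mathcal{D}^{*})$ is BC-learnable.
   Context: Reals are elements of $2^{\omega}$; $2^{<\omega}$ is the set of finite binary strings, $[\sigma]$ the set of reals extending $\sigma$, $X\upharpoonright n$ the first $n$ bits of $X$. $\mathcal{M}$ denotes the space of Borel probability measures on $2^\omega$, a measure being identified with $\sigma\mapsto\mu([\sigma])$, with metric $d(\mu,\nu)=\sum_n2^{-n}\max_{\sigma\in 2^n}|\mu(\sigma)-\nu(\sigma)|$; basic open sets of $\mathcal{M}$ are sets $\{\mu:\mu(\sigma_i)\in I_i\ \forall i\le n\}$ with $I_i$ rational (dyadic) open intervals. A function $f:2^\omega\to\mathcal{M}$ is computable if there is a computable map $f^*$ from strings to basic open sets of $\mathcal{M}$, monotone ($\sigma\preceq\tau\Rightarrow f^*(\tau)\subseteq f^*(\sigma)$), with $f(Z)\in f^*(Z\upharpoonright n)$ for all $n$ and the diameter of $f^*(Z\upharpoonright n)$ tending to $0$ for every $Z$. A set $\mathcal{D}\subseteq2^\omega$ is effectively closed if its complement is a union of a c.e. set of basic open sets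 $[\sigma]$. For an arbitrary measure $\mu\in\mathcal{M}$, $X$ is $\mu$-random if it has finite uniform (Levin–Gács) randomness deficiency with respect to $\mu$; for computable $\mu$ this coincides with Martin-Löf randomness with respect to $\mu$ (there is no uniformly c.e. sequence $(U_i)$ of sets of strings with $\mu(\bigcup_{\sigma\in U_i}[\sigma])<2^{-i}$ and $X\in\bigcap_i\bigcup_{\sigma\in U_i}[\sigma]$). Two measures are effectively orthogonal if no real is random with respect to both. Fix a uniform enumeration $(\mu_e)$ of partial computable measures ($e$ is an index of computable $\mu$ if $\mu_e$ is total and equal to $\mu$) and an acceptable numbering $(\varphi_e)$ of partial computable $\{0,1\}$-valued functions ($e$ is an index of a computable real $Z$ if $\varphi_e=Z$). A learner is a function $\mathcal{L}:2^{<\omega}\to\mathbb{N}$. A class $\mathcal{C}$ of computable reals is EX-learnable if some computable learner $\mathcal{L}$ satisfies: for every $Z\in\mathcal{C}$, $\lim_n\mathcal{L}(Z\upharpoonright n)$ exists and is an index of $Z$; it is BC-learnable if some computable learner satisfies: for every $Z\in\mathcal{C}$, $\mathcal{L}(Z\upharpoonright n)$ is an index of $Z$ for all sufficiently large $n$. A class $\mathcal{C}$ of computable measures is EX-learnable if some computable learner $\mathcal{L}$ satisfies: for every $\mu\in\mathcal{C}$ and every $\mu$-random $X$, $\lim_n\mathcal{L}(X\upharpoonright n)$ exists and is an index of some $\mu'\in\mathcal{C}$ with $X$ $\mu'$-random; it is BC-learnable if some computable learner satisfies: for every $\mu\in\mathcal{C}$ and $\mu$-random $X$ there are $n_0$ and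 $\mu'\in\mathcal{C}$ with $X$ $\mu'$-random and $\mathcal{L}(X\upharpoonright n)$ an index of $\mu'$ for all $n>n_0$. *)

theory Defs
  imports
    "HOL-Probability.Probability"
    "HOL-Library.Nat_Bijection"
    "HOL-Library.Sublist"
begin

section \<open>Computability\<close>

text \<open>
  Kleene's partial recursive functions. The zero function is available in every arity, so that
  composition with an empty argument list yields constants. Composition is strict.
\<close>

datatype recf =
    Zero
  | Succ
  | Proj nat
  | Comp recf "recf list"
  | PrimRec recf recf
  | Mu recf

fun eval :: "recf \<Rightarrow> nat list \<Rightarrow> nat option" where
  "eval Zero xs = Some 0"
| "eval Succ xs = (case xs of [] \<Rightarrow> None | x # _ \<Rightarrow> Some (Suc x))"
| "eval (Proj i) xs = (if i < length xs then Some (xs ! i) else None)"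
| "eval (Comp r rs) xs =
    (let ys = map (\<lambda>s. eval s xs) rs
     in if None \<in> set ys then None else eval r (map the ys))"
| "eval (PrimRec r s) xs =
    (case xs of
       [] \<Rightarrow> None
     | n # ys \<Rightarrow>
         rec_nat (eval r ys) (\<lambda>m v. Option.bind v (\<lambda>w. eval s (m # w # ys))) n)"
| "eval (Mu r) xs =
    (if \<exists>n. eval r (n # xs) = Some 0 \<and> (\<forall>m<n. \<exists>y. eval r (m # xs) = Some (Suc y))
     then Some (LEAST n. eval r (n # xs) = Some 0)
     else None)"

definition partial_computable :: "(nat \<Rightarrow> nat option) \<Rightarrow> bool" where
  "partial_computable p \<longleftrightarrow> (\<exists>r. \<forall>x. eval r [x] = p x)"

definition partial_computable2 :: "(nat \<Rightarrow> nat \<Rightarrow> nat option) \<Rightarrow> bool" where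
  "partial_computable2 p \<longleftrightarrow> (\<exists>r. \<forall>x y. eval r [x, y] = p x y)"

definition computable :: "(nat \<Rightarrow> nat) \<Rightarrow> bool" where
  "computable g \<longleftrightarrow> partial_computable (\<lambda>x. Some (g x))"

definition ce :: "nat set \<Rightarrow> bool" where
  "ce A \<longleftrightarrow> (\<exists>p. partial_computable p \<and> A = {x. p x \<noteq> None})"

definition uniformly_ce :: "(nat \<Rightarrow> nat set) \<Rightarrow> bool" where
  "uniformly_ce A \<longleftrightarrow> (\<exists>p. partial_computable2 p \<and> (\<forall>k. A k = {x. p k x \<noteq> None}))"

text \<open>
  Computability of a map between types equipped with injective codes into the naturals.
\<close>

definition computable_wrt :: "('a \<Rightarrow> nat) \<Rightarrow> ('b \<Rightarrow> nat) \<Rightarrow> ('a \<Rightarrow> 'b) \<Rightarrow> bool" where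
  "computable_wrt c c' h \<longleftrightarrow> (\<exists>g. computable g \<and> (\<forall>x. c' (h x) = g (c x)))"

text \<open>
  Acceptable numberings of the partial computable functions with values in \<open>V\<close>: a uniformly
  partial computable family of such functions into which every other such family translates
  computably.
\<close>

definition acceptable_numbering :: "nat set \<Rightarrow> (nat \<Rightarrow> nat \<Rightarrow> nat option) \<Rightarrow> bool" where
  "acceptable_numbering V \<phi> \<longleftrightarrow>
     partial_computable2 \<phi> \<and> (\<forall>e. ran (\<phi> e) \<subseteq> V) \<and>
     (\<forall>\<psi>. partial_computable2 \<psi> \<and> (\<forall>e. ran (\<psi> e) \<subseteq> V) \<longrightarrow>
        (\<exists>g. computable g \<and> (\<forall>e. \<psi> e = \<phi> (g e))))"


section \<open>Strings and reals\<close>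

type_synonym bitstring = "bool list"
type_synonym cantor = "nat \<Rightarrow> bool"

definition string_code :: "bitstring \<Rightarrow> nat" where
  "string_code \<sigma> = list_encode (map of_bool \<sigma>)"

definition initial :: "cantor \<Rightarrow> nat \<Rightarrow> bitstring"  (infixl "\<restriction>" 90) where
  "X \<restriction> n = map X [0..<n]"

definition cylinder :: "bitstring \<Rightarrow> cantor set" where
  "cylinder \<sigma> = {X. X \<restriction> length \<sigma> = \<sigma>}"

definition computable_real :: "cantor \<Rightarrow> bool" where
  "computable_real Z \<longleftrightarrow> computable (\<lambda>n. of_bool (Z n))"

definition effectively_closed :: "cantor set \<Rightarrow> bool" where
  "effectively_closed D \<longleftrightarrow> (\<exists>W. ce (string_code ` W) \<and> - D = (\<Union>\<sigma>\<in>W. cylinder \<sigma>))"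


section \<open>The space of measures\<close>

text \<open>The Borel structure is that of the product topology on \<^typ>\<open>nat \<Rightarrow> bool\<close>.\<close>

definition prob_measures :: "cantor measure set"  ("\<M>") where
  "\<M> = space (prob_algebra borel)"

definition mdistance :: "cantor measure \<Rightarrow> cantor measure \<Rightarrow> real" where
  "mdistance \<mu> \<nu> =
     (\<Sum>n. (1/2) ^ n *
        Max ((\<lambda>\<sigma>. \<bar>measure \<mu> (cylinder \<sigma>) - measure \<nu> (cylinder \<sigma>)\<bar>) ` {\<sigma>. length \<sigma> = n}))"

text \<open>
  This is a supremum of real numbers; \<^const>\<open>mdistance\<close> is bounded by \<open>2\<close> on \<open>\<M>\<close>, so
  it is meaningful for every nonempty subset of \<open>\<M>\<close>.
\<close>

definition mdiameter :: "cantor measure set \<Rightarrow> real" where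
  "mdiameter S = (SUP (\<mu>, \<nu>)\<in>S \<times> S. mdistance \<mu> \<nu>)"

text \<open>The pair \<open>(a, b)\<close> stands for the dyadic rational \<open>a / 2\<^sup>b\<close>.\<close>

type_synonym dyadic = "int \<times> nat"

definition dyadic_val :: "dyadic \<Rightarrow> real" where
  "dyadic_val q = (case q of (a, b) \<Rightarrow> of_int a / 2 ^ b)"

definition dyadic_code :: "dyadic \<Rightarrow> nat" where
  "dyadic_code q = (case q of (a, b) \<Rightarrow> prod_encode (int_encode a, b))"

text \<open>
  A basic open set is given by a finite list of conditions \<open>(\<sigma>, l, u)\<close>, each
  requiring the measure of \<open>[\<sigma>]\<close> to lie in the open interval from \<open>l\<close> to \<open>u\<close>.
\<close>

type_synonym basic = "(bitstring \<times> dyadic \<times> dyadic) list"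

definition basic_open :: "basic \<Rightarrow> cantor measure set" where
  "basic_open B =
     {\<mu> \<in> \<M>. \<forall>(\<sigma>, l, u) \<in> set B.
        measure \<mu> (cylinder \<sigma>) \<in> {dyadic_val l <..< dyadic_val u}}"

definition basic_code :: "basic \<Rightarrow> nat" where
  "basic_code B =
     list_encode (map (\<lambda>(\<sigma>, l, u).
       prod_encode (string_code \<sigma>, prod_encode (dyadic_code l, dyadic_code u))) B)"

definition computable_measure_map :: "(cantor \<Rightarrow> cantor measure) \<Rightarrow> bool" where
  "computable_measure_map f \<longleftrightarrow>
     (\<exists>fs. computable_wrt string_code basic_code fs \<and>
        (\<forall>\<sigma> \<tau>. prefix \<sigma> \<tau> \<longrightarrow> basic_open (fs \<tau>) \<subseteq> basic_open (fs \<sigma>)) \<and>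
        (\<forall>Z n. f Z \<in> basic_open (fs (Z \<restriction> n))) \<and>
        (\<forall>Z. (\<lambda>n. mdiameter (basic_open (fs (Z \<restriction> n)))) \<longlonglongrightarrow> 0))"


section \<open>Randomness with respect to arbitrary measures\<close>

text \<open>
  A uniform test is a function \<open>d\<close> on \<open>\<M> \<times> 2\<^sup>\<omega>\<close> whose superlevel sets
  \<open>d > k\<close> are effectively open in the product, uniformly in \<open>k\<close>, and have
  \<open>\<mu>\<close>-measure less than \<open>2\<^sup>-\<^sup>k\<close> in the section at each \<open>\<mu>\<close>. The uniform
  (Levin-Gacs) deficiency is a largest such \<open>d\<close> up to an additive constant. It is thus unique up
  to an additive constant, and its finiteness does not depend on the choice.
\<close>

definition uniform_test :: "(cantor measure \<Rightarrow> cantor \<Rightarrow> enat) \<Rightarrow> bool" where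
  "uniform_test d \<longleftrightarrow>
     (\<exists>W. uniformly_ce (\<lambda>k. (\<lambda>(B, \<sigma>). prod_encode (basic_code B, string_code \<sigma>)) ` W k) \<and>
        (\<forall>k. {(\<mu>, X). \<mu> \<in> \<M> \<and> d \<mu> X > enat k} =
             (\<Union>(B, \<sigma>)\<in>W k. basic_open B \<times> cylinder \<sigma>))) \<and>
     (\<forall>\<mu>\<in>\<M>. \<forall>k. measure \<mu> {X. d \<mu> X > enat k} < (1/2) ^ k)"

definition uniform_deficiency :: "(cantor measure \<Rightarrow> cantor \<Rightarrow> enat) \<Rightarrow> bool" where
  "uniform_deficiency d \<longleftrightarrow>
     uniform_test d \<and>
     (\<forall>d'. uniform_test d' \<longrightarrow> (\<exists>c. \<forall>\<mu>\<in>\<M>. \<forall>X. d' \<mu> X \<le> d \<mu> X + enat c))"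

definition random_wrt :: "cantor measure \<Rightarrow> cantor \<Rightarrow> bool" where
  "random_wrt \<mu> X \<longleftrightarrow> (\<exists>d. uniform_deficiency d \<and> d \<mu> X < \<infinity>)"

definition effectively_orthogonal :: "cantor measure \<Rightarrow> cantor measure \<Rightarrow> bool" where
  "effectively_orthogonal \<mu> \<nu> \<longleftrightarrow> \<not> (\<exists>X. random_wrt \<mu> X \<and> random_wrt \<nu> X)"


section \<open>Indices\<close>

definition real_index :: "(nat \<Rightarrow> nat \<Rightarrow> nat option) \<Rightarrow> nat \<Rightarrow> cantor \<Rightarrow> bool" where
  "real_index \<phi> e Z \<longleftrightarrow> (\<forall>n. \<phi> e n = Some (of_bool (Z n)))"

text \<open>
  A partial computable measure is presented by a partial computable function which on
  \<open>(\<sigma>, n)\<close> returns a dyadic approximation of the value at \<open>\<sigma>\<close> with error less than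
  \<open>2\<^sup>-\<^sup>n\<close>. The value at \<open>\<sigma>\<close> is defined when all these approximations are and
  they belong to one (necessarily unique) real number. A uniform enumeration of the partial
  computable measures is therefore given by an acceptable numbering \<open>m\<close> of the partial computable
  functions.
\<close>

definition partial_measure :: "(nat \<Rightarrow> nat \<Rightarrow> nat option) \<Rightarrow> nat \<Rightarrow> bitstring \<Rightarrow> real option" where
  "partial_measure m e \<sigma> =
     (let approx = (\<lambda>r. \<forall>n. \<exists>q. m e (prod_encode (string_code \<sigma>, n)) = Some (dyadic_code q) \<and>
                                \<bar>dyadic_val q - r\<bar> < (1/2) ^ n)
      in if \<exists>r. approx r then Some (THE r. approx r) else None)"

definition measure_index :: "(nat \<Rightarrow> nat \<Rightarrow> nat option) \<Rightarrow> nat \<Rightarrow> cantor measure \<Rightarrow> bool" where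
  "measure_index m e \<mu> \<longleftrightarrow> (\<forall>\<sigma>. partial_measure m e \<sigma> = Some (measure \<mu> (cylinder \<sigma>)))"


section \<open>Learning\<close>

definition computable_learner :: "(bitstring \<Rightarrow> nat) \<Rightarrow> bool" where
  "computable_learner L \<longleftrightarrow> computable_wrt string_code id L"

definition EX_learnable_reals :: "(nat \<Rightarrow> nat \<Rightarrow> nat option) \<Rightarrow> cantor set \<Rightarrow> bool" where
  "EX_learnable_reals \<phi> C \<longleftrightarrow>
     (\<exists>L. computable_learner L \<and>
        (\<forall>Z\<in>C. \<exists>e. (\<lambda>n. L (Z \<restriction> n)) \<longlonglongrightarrow> e \<and> real_index \<phi> e Z))"

definition BC_learnable_reals :: "(nat \<Rightarrow> nat \<Rightarrow> nat option) \<Rightarrow> cantor set \<Rightarrow> bool" where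
  "BC_learnable_reals \<phi> C \<longleftrightarrow>
     (\<exists>L. computable_learner L \<and>
        (\<forall>Z\<in>C. \<forall>\<^sub>F n in sequentially. real_index \<phi> (L (Z \<restriction> n)) Z))"

definition EX_learnable_measures ::
  "(nat \<Rightarrow> nat \<Rightarrow> nat option) \<Rightarrow> cantor measure set \<Rightarrow> bool" where
  "EX_learnable_measures m C \<longleftrightarrow>
     (\<exists>L. computable_learner L \<and>
        (\<forall>\<mu>\<in>C. \<forall>X. random_wrt \<mu> X \<longrightarrow>
           (\<exists>e. (\<lambda>n. L (X \<restriction> n)) \<longlonglongrightarrow> e \<and>
              (\<exists>\<mu>'\<in>C. measure_index m e \<mu>' \<and> random_wrt \<mu>' X))))"

definition BC_learnable_measures ::
  "(nat \<Rightarrow> nat \<Rightarrow> nat option) \<Rightarrow> cantor measure set \<Rightarrow> bool" where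
  "BC_learnable_measures m C \<longleftrightarrow>
     (\<exists>L. computable_learner L \<and>
        (\<forall>\<mu>\<in>C. \<forall>X. random_wrt \<mu> X \<longrightarrow>
           (\<exists>n0. \<exists>\<mu>'\<in>C. random_wrt \<mu>' X \<and> (\<forall>n>n0. measure_index m (L (X \<restriction> n)) \<mu>'))))"

end

theory Submission
  imports Defs
begin

text \<open>
  Orthogonality and compactness recover \<open>Z \<in> D\<close> from any \<open>X\<close> that is random with respect to \<open>f Z\<close>:
  \<open>Z\<close> is the only member of the set of all \<open>Y \<in> D\<close> such that \<open>X\<close> has deficiency at most \<open>c\<close> with
  respect to \<open>f Y\<close>, where \<open>c\<close> is least with this set nonempty; these sets are effectively closed
  in \<open>X\<close>, so \<open>c\<close> and \<open>Z\<close> are found in the limit. A learner for reals can therefore be run on the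
  approximations to \<open>Z\<close>. Likewise an index of \<open>f Z\<close> computes \<open>Z\<close>, the only
  member of \<open>{Y \<in> D. f Y = f Z}\<close>. Conversely, a learner for measures succeeds with \<open>f Z\<close>-probability
  one, and from \<open>Z\<close> one can approximate the probabilities of its various outputs. For EX one follows
  the first hypothesis "with probability at least \<open>2\<^sup>-\<^sup>t\<close> the output is \<open>e\<close> from stage \<open>t\<close> on" that has
  not been refuted; for BC one takes a majority vote among the outputs.

  Randomness is only meaningful if a uniform deficiency exists. It is built by trimming all candidate
  tests, for which an acceptable numbering of the partial computable functions provides a universal
  function.
\<close>

section \<open>Computability: a calculus of total functions, unbounded search, and finite stages of
  partial functions\<close>

section \<open>Recursive functions of natural numbers\<close>

text \<open>The map f is given by basic open sets whose diameters shrink at no known rate, and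
  neither emptiness nor diameter of such a set is read off directly. Empirical measures replace both
  by finite checks, because basic open sets are convex: a grid measure that violates the conditions
  slightly can be moved into a nonempty set by mixing in one of its points. Compactness of Cantor
  space then yields a computable modulus valid for all reals at once, so that values of f Z on
  strings become available with known accuracy. In the recovery of Z, orthogonality makes Z unique
  for every c with a nonempty set. The least such c is singled out because it can be found in the
  limit: emptiness of an effectively closed set shows up at a finite stage by compactness, whereas
  nonemptiness in general does not. Trimming has to act at all measures simultaneously, so the
  statement that a finite stage of a test has small measure must be an open condition on the
  measure. Closed inequalities with a margin that tends to 0 achieve this.\<close>

definition rfun :: "nat \<Rightarrow> (nat list \<Rightarrow> nat) \<Rightarrow> bool" where
  "rfun k F \<longleftrightarrow> (\<exists>r. \<forall>xs. length xs = k \<longrightarrow> eval r xs = Some (F xs))"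

lemma rfun_nth: "i < k \<Longrightarrow> rfun k (\<lambda>xs. xs ! i)"
  unfolding rfun_def by (intro exI[of _ "Proj i"]) auto

lemma rfun_Suc:
  assumes "rfun k F"
  shows "rfun k (\<lambda>xs. Suc (F xs))"
proof -
  obtain r where "\<forall>xs. length xs = k \<longrightarrow> eval r xs = Some (F xs)"
    using assms unfolding rfun_def by blast
  then show ?thesis unfolding rfun_def by (intro exI[of _ "Comp Succ [r]"]) auto
qed

lemma rfun_const: "rfun k (\<lambda>_. c)"
proof (induction c)
  case 0
  show ?case unfolding rfun_def by (intro exI[of _ Zero]) auto
qed (rule rfun_Suc)

lemma computable_iff_rfun: "computable f \<longleftrightarrow> rfun 1 (\<lambda>xs. f (xs ! 0))"
proof
  show "computable f \<Longrightarrow> rfun 1 (\<lambda>xs. f (xs ! 0))"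
    unfolding computable_def partial_computable_def rfun_def
    by (metis One_nat_def length_0_conv length_Suc_conv nth_Cons_0)
  show "rfun 1 (\<lambda>xs. f (xs ! 0)) \<Longrightarrow> computable f"
    unfolding computable_def partial_computable_def rfun_def
    by (metis One_nat_def length_Cons list.size(3) nth_Cons_0)
qed

lemma rfun_comp1:
  assumes "rfun 1 (\<lambda>xs. h (xs ! 0))" "rfun k F"
  shows "rfun k (\<lambda>xs. h (F xs))"
proof -
  obtain r s where "\<And>xs. length xs = 1 \<Longrightarrow> eval r xs = Some (h (xs ! 0))"
    "\<And>xs. length xs = k \<Longrightarrow> eval s xs = Some (F xs)"
    using assms unfolding rfun_def by blast
  then show ?thesis unfolding rfun_def by (intro exI[of _ "Comp r [s]"]) auto
qed

lemma rfun_comp2: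
  assumes "rfun 2 (\<lambda>xs. h (xs ! 0) (xs ! 1))" "rfun k F" "rfun k G"
  shows "rfun k (\<lambda>xs. h (F xs) (G xs))"
proof -
  obtain r s t where "\<And>xs. length xs = 2 \<Longrightarrow> eval r xs = Some (h (xs ! 0) (xs ! 1))"
    "\<And>xs. length xs = k \<Longrightarrow> eval s xs = Some (F xs)"
    "\<And>xs. length xs = k \<Longrightarrow> eval t xs = Some (G xs)"
    using assms unfolding rfun_def by blast
  then show ?thesis unfolding rfun_def by (intro exI[of _ "Comp r [s, t]"]) auto
qed

lemma rfun_rec:
  assumes "rfun 1 (\<lambda>xs. a (xs ! 0))" "rfun 3 (\<lambda>xs. s (xs ! 0) (xs ! 1) (xs ! 2))"
  shows "rfun 2 (\<lambda>xs. rec_nat (a (xs ! 1)) (s (xs ! 1)) (xs ! 0))"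
proof -
  obtain r t where r: "\<And>xs. length xs = 1 \<Longrightarrow> eval r xs = Some (a (xs ! 0))"
    and t: "\<And>xs. length xs = 3 \<Longrightarrow> eval t xs = Some (s (xs ! 0) (xs ! 1) (xs ! 2))"
    using assms unfolding rfun_def by blast
  \<comment> \<open>\<open>PrimRec\<close> hands its step function the counter, the previous value
    and the parameter in this order; the projections move the parameter to the front, where
    \<open>s\<close> expects it.\<close>
  have "eval (PrimRec r (Comp t [Proj 2, Proj 0, Proj 1])) [n, x] = Some (rec_nat (a x) (s x) n)" for n x
    by (induction n) (simp_all add: r t)
  then have "eval (PrimRec r (Comp t [Proj 2, Proj 0, Proj 1])) xs =
      Some (rec_nat (a (xs ! 1)) (s (xs ! 1)) (xs ! 0))" if "length xs = 2" for xs
  proof -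
    from that obtain n x where "xs = [n, x]"
      by (metis One_nat_def Suc_1 length_0_conv length_Suc_conv)
    then show ?thesis
      using \<open>\<And>x n. eval (PrimRec r (Comp t [Proj 2, Proj 0, Proj 1])) [n, x] = Some (rec_nat (a x) (s x) n)\<close>
      by (simp del: eval.simps)
  qed
  then show ?thesis unfolding rfun_def by blast
qed

lemma rfun_Least:
  assumes "rfun 2 (\<lambda>xs. p (xs ! 0) (xs ! 1))" "\<And>x. \<exists>n. p x n = 0"
  shows "rfun 1 (\<lambda>xs. LEAST n. p (xs ! 0) n = 0)"
proof -
  obtain r where r: "\<And>xs. length xs = 2 \<Longrightarrow> eval r xs = Some (p (xs ! 0) (xs ! 1))"
    using assms unfolding rfun_def by blast
  let ?r = "Comp r [Proj 1, Proj 0]"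
  have e: "eval ?r [n, x] = Some (p x n)" for n x by (simp add: r)
  have "eval (Mu ?r) [x] = Some (LEAST n. p x n = 0)" for x
  proof -
    have "p x (LEAST n. p x n = 0) = 0" using assms(2)[of x] by (rule LeastI_ex)
    moreover have "\<exists>y. p x m = Suc y" if "m < (LEAST n. p x n = 0)" for m
      using not_less_Least[OF that] not0_implies_Suc by blast
    ultimately have "\<exists>n. eval ?r (n # [x]) = Some 0 \<and> (\<forall>m<n. \<exists>y. eval ?r (m # [x]) = Some (Suc y))"
      unfolding e by auto
    then show ?thesis unfolding eval.simps(6) e by simp
  qed
  then have "eval (Mu ?r) xs = Some (LEAST n. p (xs ! 0) n = 0)" if "length xs = 1" for xs
    using that by (metis One_nat_def length_0_conv length_Suc_conv nth_Cons_0)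
  then show ?thesis unfolding rfun_def by blast
qed

lemma rfun_plus: "rfun 2 (\<lambda>xs. xs ! 0 + xs ! 1)"
proof -
  have eq: "rec_nat y (\<lambda>m w. Suc w) x = x + y" for x y :: nat by (induction x) auto
  have "rfun 2 (\<lambda>xs. rec_nat (xs ! 1) (\<lambda>m w. Suc w) (xs ! 0))"
    by (rule rfun_rec[of "\<lambda>x. x" "\<lambda>x m w. Suc w"]) (intro rfun_Suc rfun_nth; simp)+
  then show ?thesis unfolding eq .
qed

lemma rfun_times: "rfun 2 (\<lambda>xs. xs ! 0 * xs ! 1)"
proof -
  have eq: "rec_nat 0 (\<lambda>m w. w + y) x = x * y" for x y :: nat by (induction x) auto
  have "rfun 2 (\<lambda>xs. rec_nat 0 (\<lambda>m w. w + xs ! 1) (xs ! 0))"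
    by (rule rfun_rec[of "\<lambda>x. 0" "\<lambda>x m w. w + x"], rule rfun_const)
      (intro rfun_comp2[OF rfun_plus] rfun_nth; simp)
  then show ?thesis unfolding eq .
qed

lemma rfun_pred: "rfun 1 (\<lambda>xs. xs ! 0 - 1)"
proof -
  have eq: "rec_nat 0 (\<lambda>m w. m) x = x - 1" for x :: nat by (cases x) auto
  have "rfun 2 (\<lambda>xs. rec_nat 0 (\<lambda>m w. m) (xs ! 0))"
    by (rule rfun_rec[of "\<lambda>x. 0" "\<lambda>x m w. m"]) (rule rfun_const, rule rfun_nth, simp)
  then have "rfun 2 (\<lambda>xs. xs ! 0 - 1)" unfolding eq .
  from rfun_comp2[of "\<lambda>x y. x - 1", OF this rfun_nth[of 0 1] rfun_nth[of 0 1]] show ?thesis by simp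
qed

lemma rfun_minus: "rfun 2 (\<lambda>xs. xs ! 0 - xs ! 1)"
proof -
  have eq: "rec_nat y (\<lambda>m w. w - 1) x = y - x" for x y :: nat by (induction x) auto
  have "rfun 2 (\<lambda>xs. rec_nat (xs ! 1) (\<lambda>m w. w - 1) (xs ! 0))"
    by (rule rfun_rec[of "\<lambda>x. x" "\<lambda>x m w. w - 1"]) (intro rfun_comp1[OF rfun_pred] rfun_nth; simp)+
  then have "rfun 2 (\<lambda>xs. xs ! 1 - xs ! 0)" unfolding eq .
  from rfun_comp2[of "\<lambda>x y. y - x", OF this rfun_nth[of 1 2] rfun_nth[of 0 2]] show ?thesis by simp
qed

lemma rfun_triangle: "rfun 1 (\<lambda>xs. triangle (xs ! 0))"
proof -
  have eq: "rec_nat 0 (\<lambda>m w. w + Suc m) x = triangle x" for x :: nat by (induction x) auto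
  have "rfun 2 (\<lambda>xs. rec_nat 0 (\<lambda>m w. w + Suc m) (xs ! 0))"
    by (rule rfun_rec[of "\<lambda>x. 0" "\<lambda>x m w. w + Suc m"], rule rfun_const)
      (intro rfun_comp2[OF rfun_plus] rfun_Suc rfun_nth; simp)
  then have "rfun 2 (\<lambda>xs. triangle (xs ! 0))" unfolding eq .
  from rfun_comp2[of "\<lambda>x y. triangle x", OF this rfun_nth[of 0 1] rfun_nth[of 0 1]] show ?thesis by simp
qed

lemma rfun_prod_encode: "rfun 2 (\<lambda>xs. prod_encode (xs ! 0, xs ! 1))"
  unfolding prod_encode_def case_prod_conv
  by (intro rfun_comp2[OF rfun_plus] rfun_comp1[OF rfun_triangle] rfun_nth; simp)

lemma triangle_mono: "m \<le> n \<Longrightarrow> triangle m \<le> triangle n"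
  by (induction n) (auto simp: le_Suc_eq)

text \<open>A pair with first component m and sum s is coded by \<open>triangle s + m\<close>, which
  lies in the block from \<open>triangle s\<close> up to but excluding
  \<open>triangle (Suc s)\<close>. The sum is thus found by an unbounded search, and the components
  follow by subtraction.\<close>

lemma prod_decode_sum: "fst (prod_decode x) + snd (prod_decode x) = (LEAST s. Suc x - triangle (Suc s) = 0)"
proof -
  obtain m n where mn: "prod_decode x = (m, n)" by (cases "prod_decode x")
  then have "prod_encode (m, n) = x" using prod_decode_inverse[of x] by simp
  then have x: "x = triangle (m + n) + m" by (simp add: prod_encode_def)
  have "(LEAST s. Suc x - triangle (Suc s) = 0) = m + n"
  proof (rule Least_equality)
    show "Suc x - triangle (Suc (m + n)) = 0" unfolding x by simp
    show "m + n \<le> y" if "Suc x - triangle (Suc y) = 0" for y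
    proof (rule ccontr)
      assume "\<not> m + n \<le> y"
      then have "triangle (Suc y) \<le> triangle (m + n)" by (intro triangle_mono) simp
      with that show False unfolding x by (simp del: triangle_Suc)
    qed
  qed
  with mn show ?thesis by simp
qed

lemma computable_id: "computable (\<lambda>x. x)"
  unfolding computable_iff_rfun by (rule rfun_nth) simp

lemma computable_const: "computable (\<lambda>_. c)"
  unfolding computable_iff_rfun by (rule rfun_const)

lemma computable_comp: "computable f \<Longrightarrow> computable g \<Longrightarrow> computable (\<lambda>x. f (g x))"
  unfolding computable_iff_rfun by (rule rfun_comp1)

lemma computable_Suc: "computable f \<Longrightarrow> computable (\<lambda>x. Suc (f x))"
  unfolding computable_iff_rfun by (rule rfun_Suc)

lemma computable_plus: "computable f \<Longrightarrow> computable g \<Longrightarrow> computable (\<lambda>x. f x + g x)"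
  unfolding computable_iff_rfun by (rule rfun_comp2[OF rfun_plus])

lemma computable_times: "computable f \<Longrightarrow> computable g \<Longrightarrow> computable (\<lambda>x. f x * g x)"
  unfolding computable_iff_rfun by (rule rfun_comp2[OF rfun_times])

lemma computable_minus: "computable f \<Longrightarrow> computable g \<Longrightarrow> computable (\<lambda>x. f x - g x)"
  unfolding computable_iff_rfun by (rule rfun_comp2[OF rfun_minus])

lemma computable_prod_encode:
  "computable f \<Longrightarrow> computable g \<Longrightarrow> computable (\<lambda>x. prod_encode (f x, g x))"
  unfolding computable_iff_rfun by (rule rfun_comp2[OF rfun_prod_encode])

lemma computable_prod_decode_sum: "computable (\<lambda>x. fst (prod_decode x) + snd (prod_decode x))"
proof -
  have "\<exists>n. Suc x - triangle (Suc n) = 0" for x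
    using prod_decode_sum[of x] by (intro exI[of _ x]) (simp add: le_add1)
  moreover have "rfun 2 (\<lambda>xs. Suc (xs ! 0) - triangle (Suc (xs ! 1)))"
    by (intro rfun_comp2[OF rfun_minus] rfun_Suc rfun_comp1[OF rfun_triangle] rfun_nth; simp)
  ultimately show ?thesis unfolding computable_iff_rfun prod_decode_sum
    using rfun_Least[of "\<lambda>x s. Suc x - triangle (Suc s)"] by blast
qed

lemma computable_fst_prod_decode: "computable f \<Longrightarrow> computable (\<lambda>x. fst (prod_decode (f x)))"
proof (rule computable_comp[of "\<lambda>x. fst (prod_decode x)"])
  have "x - triangle (fst (prod_decode x) + snd (prod_decode x)) = fst (prod_decode x)" for x
  proof -
    have "prod_encode (fst (prod_decode x), snd (prod_decode x)) = x" by simp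
    then show ?thesis unfolding prod_encode_def case_prod_conv by linarith
  qed
  then show "computable (\<lambda>x. fst (prod_decode x))"
    using computable_minus[OF computable_id computable_comp[OF rfun_triangle[folded computable_iff_rfun]
      computable_prod_decode_sum]] by simp
qed

lemma computable_snd_prod_decode: "computable f \<Longrightarrow> computable (\<lambda>x. snd (prod_decode (f x)))"
proof (rule computable_comp[of "\<lambda>x. snd (prod_decode x)"])
  show "computable (\<lambda>x. snd (prod_decode x))"
    using computable_minus[OF computable_prod_decode_sum computable_fst_prod_decode[OF computable_id]] by simp
qed

lemma computable_rec:
  assumes a: "computable a" and s: "computable s" and n: "computable n"
  shows "computable (\<lambda>x. rec_nat (a x) (\<lambda>m w. s (prod_encode (x, prod_encode (m, w)))) (n x))"
proof -
  have "rfun 2 (\<lambda>xs. rec_nat (a (xs ! 1)) (\<lambda>m w. s (prod_encode (xs ! 1, prod_encode (m, w)))) (xs ! 0))"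
    by (rule rfun_rec[of a "\<lambda>x m w. s (prod_encode (x, prod_encode (m, w)))"])
      (intro a[unfolded computable_iff_rfun] rfun_comp1[OF s[unfolded computable_iff_rfun]]
        rfun_comp2[OF rfun_prod_encode] rfun_nth; simp)+
  from rfun_comp2[of "\<lambda>n x. rec_nat (a x) (\<lambda>m w. s (prod_encode (x, prod_encode (m, w)))) n",
      OF this n[unfolded computable_iff_rfun] rfun_nth[of 0 1]]
  show ?thesis unfolding computable_iff_rfun by simp
qed

lemma computable_Least:
  assumes "computable p" "\<And>x. \<exists>n. p (prod_encode (x, n)) = 0"
  shows "computable (\<lambda>x. LEAST n. p (prod_encode (x, n)) = 0)"
  unfolding computable_iff_rfun
  by (rule rfun_Least[of "\<lambda>x n. p (prod_encode (x, n))"])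
    (intro assms rfun_comp1[OF assms(1)[unfolded computable_iff_rfun]]
      rfun_comp2[OF rfun_prod_encode] rfun_nth; simp)+

lemma computable_if_zero:
  assumes "computable p" "computable f" "computable g"
  shows "computable (\<lambda>x. if p x = 0 then f x else g x)"
proof -
  have "(if p x = 0 then f x else g x) = (1 - p x) * f x + (1 - (1 - p x)) * g x" for x by simp
  then show ?thesis
    by (simp only:) (intro computable_plus computable_times computable_minus computable_const assms)
qed


section \<open>Effective functions between coded types\<close>

text \<open>Only injectivity is asked for. A map is effective when some computable function
  reproduces it on codes, and numbers that code nothing may be treated arbitrarily.\<close>

class codable =
  fixes enc :: "'a \<Rightarrow> nat"
  assumes enc_inject: "enc x = enc y \<longleftrightarrow> x = y"

instantiation nat :: codable
begin
definition "enc (n::nat) = n"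
instance by standard (simp add: enc_nat_def)
end

instantiation bool :: codable
begin
definition "enc (b::bool) = (of_bool b :: nat)"
instance by standard (simp add: enc_bool_def)
end

instantiation int :: codable
begin
definition "enc (i::int) = int_encode i"
instance by standard (simp add: enc_int_def int_encode_eq)
end

instantiation prod :: (codable, codable) codable
begin
definition "enc p = prod_encode (enc (fst p), enc (snd p))"
instance by standard (auto simp: enc_prod_def prod_encode_eq enc_inject prod_eq_iff)
end

instantiation list :: (codable) codable
begin
definition "enc xs = list_encode (map enc xs)"
instance
proof
  fix xs ys :: "'a list"
  have "inj (enc :: 'a \<Rightarrow> nat)" by (rule injI) (simp add: enc_inject)
  then show "enc xs = enc ys \<longleftrightarrow> xs = ys"
    by (simp add: enc_list_def list_encode_eq inj_map_eq_map)
qed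
end

instantiation option :: (codable) codable
begin
definition "enc v = (case v of None \<Rightarrow> 0 | Some x \<Rightarrow> Suc (enc x))"
instance by standard (auto simp: enc_option_def enc_inject split: option.splits)
end

definition effective :: "('a::codable \<Rightarrow> 'b::codable) \<Rightarrow> bool" where
  "effective f \<longleftrightarrow> computable_wrt enc enc f"

named_theorems eff

lemma effectiveI: "computable g \<Longrightarrow> (\<And>x. enc (f x) = g (enc x)) \<Longrightarrow> effective f"
  unfolding effective_def computable_wrt_def by blast

lemma effective_iff: "effective f \<longleftrightarrow> (\<exists>g. computable g \<and> (\<forall>x. enc (f x) = g (enc x)))"
  unfolding effective_def computable_wrt_def ..

lemma effectiveE:
  assumes "effective f"
  obtains g where "computable g" "\<And>x. enc (f x) = g (enc x)"
  using assms unfolding effective_def computable_wrt_def by blast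

lemma effective_nat_iff: "effective (f :: nat \<Rightarrow> nat) \<longleftrightarrow> computable f"
proof
  show "effective f \<Longrightarrow> computable f"
    by (elim effectiveE) (metis enc_nat_def ext)
qed (auto intro: effectiveI simp: enc_nat_def)

lemma effective_id[eff]: "effective (\<lambda>x. x)"
  by (rule effectiveI[OF computable_id]) simp

lemma effective_const[eff]: "effective (\<lambda>_. c)"
  by (rule effectiveI[OF computable_const]) simp

lemma effective_comp:
  assumes "effective f" "effective g"
  shows "effective (\<lambda>x. f (g x))"
proof -
  obtain f' g' where "computable f'" "\<And>x. enc (f x) = f' (enc x)" "computable g'" "\<And>x. enc (g x) = g' (enc x)"
    using assms unfolding effective_iff by blast
  then show ?thesis by (intro effectiveI[OF computable_comp[of f' g']]) simp_all
qed

lemma effective_Pair[eff]: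
  assumes "effective f" "effective g"
  shows "effective (\<lambda>x. (f x, g x))"
proof -
  obtain f' g' where "computable f'" "\<And>x. enc (f x) = f' (enc x)" "computable g'" "\<And>x. enc (g x) = g' (enc x)"
    using assms unfolding effective_iff by blast
  then show ?thesis by (intro effectiveI[OF computable_prod_encode[of f' g']]) (simp_all add: enc_prod_def)
qed

lemma effective_comp2:
  assumes "effective (\<lambda>p. h (fst p) (snd p))" "effective f" "effective g"
  shows "effective (\<lambda>x. h (f x) (g x))"
  using effective_comp[OF assms(1) effective_Pair[OF assms(2,3)]] by simp

lemma effective_fst[eff]: "effective f \<Longrightarrow> effective (\<lambda>x. fst (f x))"
  by (rule effective_comp, rule effectiveI[OF computable_fst_prod_decode[OF computable_id]])
    (simp_all add: enc_prod_def)

lemma effective_snd[eff]: "effective f \<Longrightarrow> effective (\<lambda>x. snd (f x))"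
  by (rule effective_comp, rule effectiveI[OF computable_snd_prod_decode[OF computable_id]])
    (simp_all add: enc_prod_def)

lemma effective_case_prod[eff]:
  "effective (\<lambda>x. g x (fst (h x)) (snd (h x))) \<Longrightarrow> effective (\<lambda>x. case_prod (g x) (h x))"
  by (simp add: case_prod_unfold)

lemma effective_enc[eff]:
  assumes "effective f"
  shows "effective (\<lambda>x. enc (f x))"
  by (rule effective_comp[OF _ assms], rule effectiveI[OF computable_id]) (simp add: enc_nat_def)

lemma effective_lift2:
  fixes h :: "nat \<Rightarrow> nat \<Rightarrow> nat"
  assumes "\<And>f g. computable f \<Longrightarrow> computable g \<Longrightarrow> computable (\<lambda>x. h (f x) (g x))"
    and "effective f" "effective g"
  shows "effective (\<lambda>x. h (f x) (g x))"
proof (rule effective_comp2[OF _ assms(2,3)], rule effectiveI)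
  show "computable (\<lambda>x. h (fst (prod_decode x)) (snd (prod_decode x)))"
    by (intro assms(1) computable_fst_prod_decode computable_snd_prod_decode computable_id)
qed (simp add: enc_nat_def enc_prod_def)

lemma effective_Suc[eff]: "effective f \<Longrightarrow> effective (\<lambda>x. Suc (f x))"
  by (rule effective_comp[of Suc]) (simp_all add: effective_nat_iff computable_Suc computable_id)

lemma effective_plus[eff]: "effective f \<Longrightarrow> effective g \<Longrightarrow> effective (\<lambda>x. f x + g x :: nat)"
  by (rule effective_lift2[of "\<lambda>x y. x + y"]) (rule computable_plus)

lemma effective_times[eff]: "effective f \<Longrightarrow> effective g \<Longrightarrow> effective (\<lambda>x. f x * g x :: nat)"
  by (rule effective_lift2[of "\<lambda>x y. x * y"]) (rule computable_times)

lemma effective_minus[eff]: "effective f \<Longrightarrow> effective g \<Longrightarrow> effective (\<lambda>x. f x - g x :: nat)"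
  by (rule effective_lift2[of "\<lambda>x y. x - y"]) (rule computable_minus)

lemma effective_prod_encode[eff]: "effective f \<Longrightarrow> effective g \<Longrightarrow> effective (\<lambda>x. prod_encode (f x, g x))"
  by (rule effective_lift2[of "\<lambda>x y. prod_encode (x, y)"]) (rule computable_prod_encode)

lemma effective_prod_decode[eff]: "effective f \<Longrightarrow> effective (\<lambda>x. prod_decode (f x))"
  by (rule effective_comp, rule effectiveI[OF computable_id]) (simp_all add: enc_prod_def enc_nat_def)

lemma effective_if[eff]:
  assumes "effective b" "effective f" "effective g"
  shows "effective (\<lambda>x. if b x then f x else g x)"
proof -
  obtain b' where *: "computable b'" "\<And>x. enc (b x) = b' (enc x)"
    using assms(1) by (rule effectiveE) blast
  obtain f' where f': "computable f'" "\<And>x. enc (f x) = f' (enc x)"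
    using assms(2) by (rule effectiveE) blast
  obtain g' where g': "computable g'" "\<And>x. enc (g x) = g' (enc x)"
    using assms(3) by (rule effectiveE) blast
  from *(2) have "b x \<longleftrightarrow> b' (enc x) \<noteq> 0" for x
    by (metis enc_bool_def of_bool_eq_0_iff)
  with * f' g' show ?thesis by (intro effectiveI[OF computable_if_zero[of b' g' f']]) simp_all
qed

lemma effective_eq_zero: "effective f \<Longrightarrow> effective (\<lambda>x. f x = (0::nat))"
  by (rule effective_comp, rule effectiveI[OF computable_minus[OF computable_const[of 1] computable_id]])
    (simp_all add: enc_nat_def enc_bool_def)

lemma effective_le[eff]:
  assumes "effective f" "effective g"
  shows "effective (\<lambda>x. f x \<le> (g x :: nat))"
  using effective_eq_zero[OF effective_minus[OF assms]] by simp

lemma effective_less[eff]: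
  assumes "effective f" "effective g"
  shows "effective (\<lambda>x. f x < (g x :: nat))"
  using effective_le[OF effective_Suc[OF assms(1)] assms(2)] by (simp add: Suc_le_eq)

lemma effective_conj[eff]:
  assumes "effective f" "effective g"
  shows "effective (\<lambda>x. f x \<and> g x)"
proof -
  have "(\<lambda>x. f x \<and> g x) = (\<lambda>x. if f x then g x else False)" by auto
  then show ?thesis by (simp only:) (intro eff assms)
qed

lemma effective_not[eff]:
  assumes "effective f"
  shows "effective (\<lambda>x. \<not> f x)"
proof -
  have "(\<lambda>x. \<not> f x) = (\<lambda>x. if f x then False else True)" by auto
  then show ?thesis by (simp only:) (intro eff assms)
qed

lemma effective_disj[eff]:
  assumes "effective f" "effective g"
  shows "effective (\<lambda>x. f x \<or> g x)"
proof -
  have "(\<lambda>x. f x \<or> g x) = (\<lambda>x. if f x then True else g x)" by auto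
  then show ?thesis by (simp only:) (intro eff assms)
qed

lemma effective_eq[eff]:
  assumes "effective f" "effective g"
  shows "effective (\<lambda>x. f x = g x)"
proof -
  have "effective (\<lambda>x. enc (f x) \<le> enc (g x) \<and> enc (g x) \<le> enc (f x))"
    by (intro eff assms)
  then show ?thesis by (simp add: eq_iff[symmetric] enc_inject)
qed

lemma effective_rec_nat[eff]:
  assumes "effective a" "effective (\<lambda>q. s (fst q) (fst (snd q)) (snd (snd q)))" "effective n"
  shows "effective (\<lambda>x. rec_nat (a x) (s x) (n x))"
proof -
  obtain a' where a': "computable a'" "\<And>x. enc (a x) = a' (enc x)"
    using assms(1) by (rule effectiveE) blast
  obtain s' where s': "computable s'" "\<And>q. enc (s (fst q) (fst (snd q)) (snd (snd q))) = s' (enc q)"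
    using assms(2) by (rule effectiveE) blast
  obtain n' where n': "computable n'" "\<And>x. enc (n x) = n' (enc x)"
    using assms(3) by (rule effectiveE) blast
  have s: "enc (s x m w) = s' (prod_encode (enc x, prod_encode (m, enc w)))" for x m w
    using s'(2)[of "(x, m, w)"] by (simp add: enc_prod_def enc_nat_def)
  have "enc (rec_nat (a x) (s x) k) =
      rec_nat (a' (enc x)) (\<lambda>m w. s' (prod_encode (enc x, prod_encode (m, w)))) k" for x k
    by (induction k) (simp_all add: a' s)
  with a' s'(1) n' show ?thesis
    by (intro effectiveI[OF computable_rec[of a' s' n']]) (simp_all add: enc_nat_def)
qed


section \<open>Lists, options, integers\<close>

lemma effective_comp3:
  assumes "effective (\<lambda>q. h (fst q) (fst (snd q)) (snd (snd q)))" "effective f" "effective g" "effective k"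
  shows "effective (\<lambda>x. h (f x) (g x) (k x))"
  using effective_comp[OF assms(1) effective_Pair[OF assms(2) effective_Pair[OF assms(3,4)]]] by simp

lemma effective_comp4:
  assumes "effective (\<lambda>q. h (fst q) (fst (snd q)) (fst (snd (snd q))) (snd (snd (snd q))))"
    and "effective f" "effective g" "effective k" "effective l"
  shows "effective (\<lambda>x. h (f x) (g x) (k x) (l x))"
  using effective_comp[OF assms(1) effective_Pair[OF assms(2) effective_Pair[OF assms(3) effective_Pair[OF assms(4,5)]]]]
  by simp

lemma effective_Cons[eff]:
  assumes "effective f" "effective g"
  shows "effective (\<lambda>x. f x # g x)"
proof (rule effective_comp2[OF _ assms])
  show "effective (\<lambda>p. fst p # snd p)"
    by (rule effectiveI[OF computable_Suc[OF computable_id]]) (simp add: enc_prod_def enc_list_def)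
qed

lemma effective_tl[eff]:
  assumes "effective f"
  shows "effective (\<lambda>x. tl (f x))"
proof (rule effective_comp[OF _ assms], rule effectiveI)
  show "computable (\<lambda>c. if c = 0 then 0 else snd (prod_decode (c - 1)))"
    by (intro computable_if_zero computable_const computable_snd_prod_decode computable_minus computable_id)
  show "enc (tl xs) = (if enc xs = 0 then 0 else snd (prod_decode (enc xs - 1)))" for xs :: "'b list"
    by (cases xs) (simp_all add: enc_list_def)
qed

text \<open>\<^term>\<open>hd []\<close> is an unspecified value, whose code is used for the code of \<^term>\<open>[]\<close>.\<close>

lemma effective_hd[eff]:
  assumes "effective f"
  shows "effective (\<lambda>x. hd (f x))"
proof (rule effective_comp[OF _ assms], rule effectiveI)
  show "computable (\<lambda>c. if c = 0 then enc (hd ([] :: 'b list)) else fst (prod_decode (c - 1)))"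
    by (intro computable_if_zero computable_const computable_fst_prod_decode computable_minus computable_id)
  show "enc (hd xs) = (if enc xs = 0 then enc (hd ([] :: 'b list)) else fst (prod_decode (enc xs - 1)))"
    for xs :: "'b list"
    by (cases xs) (simp_all add: enc_list_def)
qed

lemma length_le_list_encode: "length xs \<le> list_encode xs"
proof (induction xs)
  case (Cons x xs)
  have "list_encode xs \<le> prod_encode (x, list_encode xs)" by (rule le_prod_encode_2)
  with Cons show ?case by simp
qed simp

text \<open>The fold iterates a step on pairs of accumulator and remaining list. The number of
  rounds is \<open>enc (l x)\<close>, which bounds the length of the list; surplus rounds meet an
  empty list and change nothing. Most list functions below, \<open>length\<close> included, are
  folds.\<close>

lemma effective_foldl[eff]:
  assumes "effective (\<lambda>q. g (fst q) (fst (snd q)) (snd (snd q)))" "effective a" "effective l"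
  shows "effective (\<lambda>x. foldl (g x) (a x) (l x))"
proof -
  define step where
    "step x p = (if snd p = [] then p else (g x (fst p) (hd (snd p)), tl (snd p)))" for x p
  have "effective (\<lambda>x. fst (rec_nat (a x, l x) (\<lambda>m. step x) (enc (l x))))"
    unfolding step_def by (intro eff assms(2,3) effective_comp3[OF assms(1)])
  moreover have "foldl (g x) (a x) (l x) = fst (rec_nat (a x, l x) (\<lambda>m. step x) (enc (l x)))" for x
  proof -
    have "rec_nat (c, ys) (\<lambda>m. step x) k = (foldl (g x) c (take k ys), drop k ys)" for k c ys
    proof (induction k)
      case (Suc k)
      have "rec_nat (c, ys) (\<lambda>m. step x) (Suc k) = step x (foldl (g x) c (take k ys), drop k ys)"
        using Suc by simp
      also have "\<dots> = (foldl (g x) c (take (Suc k) ys), drop (Suc k) ys)"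
        by (cases "k < length ys")
          (simp_all add: step_def take_Suc_conv_app_nth hd_drop_conv_nth drop_Suc tl_drop)
      finally show ?case .
    qed simp
    moreover have "length (l x) \<le> enc (l x)"
      using length_le_list_encode[of "map enc (l x)"] by (simp add: enc_list_def)
    ultimately show ?thesis by simp
  qed
  ultimately show ?thesis by simp
qed

lemma effective_rev[eff]:
  assumes "effective f"
  shows "effective (\<lambda>x. rev (f x))"
proof -
  have "foldl (\<lambda>a y. y # a) ys xs = rev xs @ ys" for xs ys :: "'b list"
    by (induction xs arbitrary: ys) auto
  then have "(\<lambda>x. rev (f x)) = (\<lambda>x. foldl (\<lambda>a y. y # a) [] (f x))" by simp
  then show ?thesis by (simp only:) (intro eff assms)
qed

lemma effective_foldr[eff]:
  assumes "effective (\<lambda>q. g (fst q) (fst (snd q)) (snd (snd q)))" "effective l" "effective a"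
  shows "effective (\<lambda>x. foldr (g x) (l x) (a x))"
  unfolding foldr_conv_foldl
  by (intro eff assms(2,3) effective_comp3[OF assms(1)])

lemma effective_append[eff]:
  assumes "effective f" "effective g"
  shows "effective (\<lambda>x. f x @ g x)"
proof -
  have "xs @ ys = foldr (\<lambda>a b. a # b) xs ys" for xs ys :: "'b list"
    by (induction xs) auto
  then show ?thesis by (simp only:) (intro eff assms)
qed

lemma effective_map[eff]:
  assumes "effective (\<lambda>q. g (fst q) (snd q))" "effective l"
  shows "effective (\<lambda>x. map (g x) (l x))"
proof -
  have "map h xs = foldr (\<lambda>y ys. h y # ys) xs []" for h :: "'b \<Rightarrow> 'c" and xs
    by (induction xs) auto
  then show ?thesis
    by (simp only:) (intro eff assms(2) effective_comp2[OF assms(1)])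
qed

lemma effective_filter[eff]:
  assumes "effective (\<lambda>q. g (fst q) (snd q))" "effective l"
  shows "effective (\<lambda>x. filter (g x) (l x))"
proof -
  have "filter h xs = foldr (\<lambda>y ys. if h y then y # ys else ys) xs []" for h :: "'b \<Rightarrow> bool" and xs
    by (induction xs) auto
  then show ?thesis
    by (simp only:) (intro eff assms(2) effective_comp2[OF assms(1)])
qed

lemma effective_list_ex[eff]:
  assumes "effective (\<lambda>q. g (fst q) (snd q))" "effective l"
  shows "effective (\<lambda>x. list_ex (g x) (l x))"
proof -
  have "list_ex h xs = foldr (\<lambda>y b. h y \<or> b) xs False" for h :: "'b \<Rightarrow> bool" and xs
    by (induction xs) auto
  then show ?thesis
    by (simp only:) (intro eff assms(2) effective_comp2[OF assms(1)])
qed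

lemma effective_list_all[eff]:
  assumes "effective (\<lambda>q. g (fst q) (snd q))" "effective l"
  shows "effective (\<lambda>x. list_all (g x) (l x))"
proof -
  have "list_all h xs = foldr (\<lambda>y b. h y \<and> b) xs True" for h :: "'b \<Rightarrow> bool" and xs
    by (induction xs) auto
  then show ?thesis
    by (simp only:) (intro eff assms(2) effective_comp2[OF assms(1)])
qed

lemma effective_concat[eff]:
  assumes "effective f"
  shows "effective (\<lambda>x. concat (f x))"
  unfolding concat_conv_foldr by (intro eff assms)

lemma effective_length[eff]:
  assumes "effective f"
  shows "effective (\<lambda>x. length (f x))"
proof -
  have "length xs = foldr (\<lambda>y n. Suc n) xs 0" for xs :: "'b list"
    by (induction xs) auto
  then show ?thesis by (simp only:) (intro eff assms)
qed

lemma effective_drop[eff]: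
  assumes "effective n" "effective f"
  shows "effective (\<lambda>x. drop (n x) (f x))"
proof -
  have "drop k xs = rec_nat xs (\<lambda>_. tl) k" for k and xs :: "'b list"
    by (induction k) (auto simp: drop_Suc simp flip: tl_drop)
  then show ?thesis by (simp only:) (intro eff assms)
qed

lemma effective_take[eff]:
  assumes "effective n" "effective f"
  shows "effective (\<lambda>x. take (n x) (f x))"
proof -
  have "take k xs = rev (drop (length xs - k) (rev xs))" for k and xs :: "'b list"
    by (cases "k \<le> length xs") (simp_all add: rev_drop)
  then show ?thesis by (simp only:) (intro eff assms)
qed

lemma effective_upt[eff]:
  assumes "effective m" "effective n"
  shows "effective (\<lambda>x. [m x..<n x])"
proof -
  have "[0..<k] = rec_nat [] (\<lambda>i xs. xs @ [i]) k" for k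
    by (induction k) auto
  then have "[j..<k] = drop j (rec_nat [] (\<lambda>i xs. xs @ [i]) k)" for j k
    using drop_upt[of j 0 k] by simp
  then show ?thesis by (simp only:) (intro eff assms)
qed

lemma effective_n_lists[eff]:
  assumes "effective n" "effective f"
  shows "effective (\<lambda>x. List.n_lists (n x) (f x))"
proof -
  have "List.n_lists k xs = rec_nat [[]] (\<lambda>_ l. concat (map (\<lambda>ys. map (\<lambda>y. y # ys) xs) l)) k"
    for k and xs :: "'b list"
    by (induction k) auto
  then show ?thesis by (simp only:) (intro eff assms assms(2)[THEN effective_comp])
qed

lemma effective_prefix[eff]:
  assumes "effective f" "effective g"
  shows "effective (\<lambda>x. prefix (f x) (g x))"
proof -
  have "prefix xs ys \<longleftrightarrow> take (length xs) ys = xs" for xs ys :: "'b list"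
    by (metis append_eq_conv_conj prefix_def take_is_prefix)
  then show ?thesis by (simp only:) (intro eff assms)
qed

lemma effective_sum_list[eff]:
  assumes "effective f"
  shows "effective (\<lambda>x. sum_list (f x) :: nat)"
  unfolding sum_list.eq_foldr by (intro eff assms)

lemma effective_power[eff]:
  assumes "effective f" "effective g"
  shows "effective (\<lambda>x. (f x :: nat) ^ g x)"
proof -
  have "b ^ k = rec_nat 1 (\<lambda>_ w. b * w) k" for b k :: nat by (induction k) auto
  then show ?thesis by (simp only:) (intro eff assms assms(1)[THEN effective_comp])
qed

lemma effective_Some[eff]: "effective f \<Longrightarrow> effective (\<lambda>x. Some (f x))"
  by (rule effective_comp, rule effectiveI[OF computable_Suc[OF computable_id]])
    (simp_all add: enc_option_def)

lemma effective_the[eff]: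
  assumes "effective f"
  shows "effective (\<lambda>x. the (f x))"
proof (rule effective_comp[OF _ assms], rule effectiveI)
  show "computable (\<lambda>c. if c = 0 then enc (the (None :: 'b option)) else c - 1)"
    by (intro computable_if_zero computable_const computable_minus computable_id)
  show "enc (the v) = (if enc v = 0 then enc (the (None :: 'b option)) else enc v - 1)" for v :: "'b option"
    by (cases v) (simp_all add: enc_option_def)
qed

lemma effective_int[eff]:
  assumes "effective f"
  shows "effective (\<lambda>x. int (f x))"
proof (rule effective_comp[OF _ assms], rule effectiveI)
  show "computable (\<lambda>c. 2 * c)"
    by (intro computable_times computable_const computable_id)
qed (simp add: enc_int_def enc_nat_def int_encode_def sum_encode_def)

lemma effective_even: "effective (\<lambda>n::nat. even n)"
proof -
  have "(\<lambda>n::nat. even n) = (\<lambda>n. rec_nat True (\<lambda>_ b. \<not> b) n)"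
  proof
    show "even n = rec_nat True (\<lambda>_ b. \<not> b) n" for n :: nat by (induction n) auto
  qed
  then show ?thesis by (simp only:) (intro eff)
qed

lemma effective_half: "effective (\<lambda>n::nat. n div 2)"
proof -
  have "n div 2 = length (filter (\<lambda>i. 0 < i \<and> 2 * i \<le> n) [0..<Suc n])" for n :: nat
  proof -
    have "set (filter (\<lambda>i. 0 < i \<and> 2 * i \<le> n) [0..<Suc n]) = {1..n div 2}" by auto
    then have "card (set (filter (\<lambda>i. 0 < i \<and> 2 * i \<le> n) [0..<Suc n])) = n div 2" by simp
    then show ?thesis by (simp only: distinct_card[OF distinct_filter[OF distinct_upt]])
  qed
  then show ?thesis by (simp only:) (intro eff)
qed

lemma effective_nat[eff]:
  assumes "effective f"
  shows "effective (\<lambda>x. nat (f x))"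
proof (rule effective_comp[OF _ assms], rule effectiveI)
  have "effective (\<lambda>c::nat. if even c then c div 2 else 0)"
    by (intro eff effective_even effective_half)
  then show "computable (\<lambda>c. if even c then c div 2 else 0)" by (simp add: effective_nat_iff)
qed (auto simp: enc_int_def enc_nat_def int_encode_def sum_encode_def)

lemma effective_uminus_int[eff]:
  assumes "effective f"
  shows "effective (\<lambda>x. - (f x) :: int)"
proof (rule effective_comp[OF _ assms], rule effectiveI)
  have "effective (\<lambda>c::nat. if c = 0 then 0 else if even c then c - 1 else Suc c)"
    by (intro eff effective_even)
  then show "computable (\<lambda>c. if c = 0 then 0 else if even c then c - 1 else Suc c)"
    by (simp add: effective_nat_iff)
qed (auto simp: enc_int_def enc_nat_def int_encode_def sum_encode_def; presburger)

lemma effective_minus_of_nats: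
  assumes "effective f" "effective g"
  shows "effective (\<lambda>x. int (f x) - int (g x))"
proof -
  have "int a - int b = (if b \<le> a then int (a - b) else - int (b - a))" for a b by auto
  then show ?thesis by (simp only:) (intro eff assms)
qed

lemma effective_plus_int[eff]:
  assumes "effective f" "effective g"
  shows "effective (\<lambda>x. f x + g x :: int)"
proof -
  have "a + b = int (nat a + nat b) - int (nat (- a) + nat (- b))" for a b by auto
  then show ?thesis by (simp only:) (intro eff effective_minus_of_nats assms)
qed

lemma effective_times_int[eff]:
  assumes "effective f" "effective g"
  shows "effective (\<lambda>x. f x * g x :: int)"
proof -
  have "a * b = int (nat a * nat b + nat (- a) * nat (- b)) - int (nat a * nat (- b) + nat (- a) * nat b)"
    for a b
    by (cases "0 \<le> a"; cases "0 \<le> b") (auto simp: mult_nonpos_nonpos mult_nonneg_nonneg algebra_simps)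
  then show ?thesis by (simp only:) (intro eff effective_minus_of_nats assms)
qed

lemma effective_less_int[eff]:
  assumes "effective f" "effective g"
  shows "effective (\<lambda>x. f x < (g x :: int))"
proof -
  have "a < b \<longleftrightarrow> 0 < nat (b + - a)" for a b by auto
  then show ?thesis by (simp only:) (intro eff assms)
qed


text \<open>Searches and uniform families run over all natural numbers as codes. Here every number
  decodes to something and \<open>enc (dec n)\<close> computes its canonical code, so a condition
  assumed for all elements of the type also covers numbers that are not codes.\<close>

class decodable = codable +
  fixes dec :: "nat \<Rightarrow> 'a"
  assumes dec_enc[simp]: "dec (enc x) = x"
    and computable_enc_dec: "computable (\<lambda>n. enc (dec n))"

lemma effective_dec[eff]: "effective f \<Longrightarrow> effective (\<lambda>x. dec (f x))"
  by (rule effective_comp, rule effectiveI[OF computable_enc_dec]) (simp_all add: enc_nat_def)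

instantiation nat :: decodable
begin
definition "dec (n::nat) = n"
instance by standard (simp_all add: enc_nat_def dec_nat_def computable_id)
end

instantiation bool :: decodable
begin
definition "dec n \<longleftrightarrow> n \<noteq> (0::nat)"
instance
proof
  show "dec (enc b) = b" for b :: bool by (simp add: dec_bool_def enc_bool_def)
  have "effective (\<lambda>n::nat. enc (n \<noteq> 0))" by (intro eff)
  then show "computable (\<lambda>n. enc (dec n :: bool))" by (simp add: effective_nat_iff dec_bool_def)
qed
end

instantiation int :: decodable
begin
definition "dec n = int_decode n"
instance by standard (simp_all add: enc_int_def dec_int_def computable_id)
end

instantiation prod :: (decodable, decodable) decodable
begin
definition "dec n = (dec (fst (prod_decode n)), dec (snd (prod_decode n)))"
instance
proof
  show "dec (enc p) = p" for p :: "'a \<times> 'b" by (simp add: dec_prod_def enc_prod_def)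
  have "effective (\<lambda>n::nat. enc (dec (fst (prod_decode n)) :: 'a, dec (snd (prod_decode n)) :: 'b))"
    by (intro eff)
  then show "computable (\<lambda>n. enc (dec n :: 'a \<times> 'b))" by (simp add: effective_nat_iff dec_prod_def)
qed
end

instantiation list :: (decodable) decodable
begin
definition "dec n = map dec (list_decode n)"
instance
proof
  show "dec (enc xs) = xs" for xs :: "'a list"
    by (simp add: dec_list_def enc_list_def o_def)
  have "effective (\<lambda>n. list_decode n)"
    by (rule effectiveI[OF computable_id]) (simp add: enc_list_def enc_nat_def[abs_def])
  then have "effective (\<lambda>n. enc (map (dec :: nat \<Rightarrow> 'a) (list_decode n)))"
    by (intro eff)
  then show "computable (\<lambda>n. enc (dec n :: 'a list))"
    by (simp add: effective_nat_iff dec_list_def)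
qed
end

lemma effective_Least[eff]:
  fixes P :: "'a::decodable \<Rightarrow> nat \<Rightarrow> bool"
  assumes "effective (\<lambda>q. P (fst q) (snd q))" "\<And>x. \<exists>n. P x n"
  shows "effective (\<lambda>x. LEAST n. P x n)"
proof -
  define p where "p y = (if P (dec (fst (prod_decode y))) (snd (prod_decode y)) then 0 else 1 :: nat)" for y
  have "effective p"
    unfolding p_def by (intro eff effective_comp2[OF assms(1)])
  then have "computable p" by (simp add: effective_nat_iff)
  moreover have p: "p (prod_encode (y, n)) = 0 \<longleftrightarrow> P (dec y) n" for y n by (simp add: p_def)
  ultimately have "computable (\<lambda>y. LEAST n. p (prod_encode (y, n)) = 0)"
    using assms(2) by (intro computable_Least) simp_all
  then show ?thesis by (rule effectiveI) (simp add: p enc_nat_def)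
qed


section \<open>Partial computable functions as unbounded searches\<close>

text \<open>The main source of partial functions: a decidable condition is searched by a single
  \<open>Mu\<close>, and a total function is applied to what was found. All index translations used
  by the learners later have this shape, so closure rules for total functions suffice for
  them.\<close>

lemma partial_computable2_search:
  fixes P :: "nat \<Rightarrow> nat \<Rightarrow> nat \<Rightarrow> bool"
  assumes P: "effective (\<lambda>q. P (fst q) (fst (snd q)) (snd (snd q)))"
    and F: "effective (\<lambda>q. F (fst q) (fst (snd q)) (snd (snd q)))"
  shows "partial_computable2 (\<lambda>e x. if \<exists>s. P e x s then Some (F e x (LEAST s. P e x s)) else None)"
proof -
  define p where "p y = (case dec y of (e, x, s) \<Rightarrow> if P e x s then 0 else (1::nat))" for y
  define f where "f y = (case dec y of (e, x, s) \<Rightarrow> F e x s)" for y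
  have "effective p" "effective f"
    unfolding p_def f_def by (intro eff effective_comp3[OF P] effective_comp3[OF F])+
  then obtain rp rf where rp: "\<And>y. eval rp [y] = Some (p y)" and rf: "\<And>y. eval rf [y] = Some (f y)"
    unfolding effective_nat_iff computable_def partial_computable_def by blast
  obtain pr where "\<And>xs. length xs = 2 \<Longrightarrow> eval pr xs = Some (prod_encode (xs ! 0, xs ! 1))"
    using rfun_prod_encode unfolding rfun_def by blast
  then have pr: "eval pr [a, b] = Some (prod_encode (a, b))" for a b by simp
  define t where "t = Comp rp [Comp pr [Proj 1, Comp pr [Proj 2, Proj 0]]]"
  have dec3: "dec (prod_encode (e, prod_encode (x, s))) = (e, x, s)" for e x s :: nat
    by (simp add: dec_prod_def dec_nat_def)
  have t: "eval t [s, e, x] = Some (if P e x s then 0 else 1)" for s e x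
    by (simp add: t_def pr rp p_def dec3)
  have mu: "eval (Mu t) [e, x] = (if \<exists>s. P e x s then Some (LEAST s. P e x s) else None)" for e x
  proof (cases "\<exists>s. P e x s")
    case True
    then have "P e x (LEAST s. P e x s)" by (rule LeastI_ex)
    then have "\<exists>n. eval t (n # [e, x]) = Some 0 \<and> (\<forall>m<n. \<exists>y. eval t (m # [e, x]) = Some (Suc y))"
      unfolding t by (intro exI[of _ "LEAST s. P e x s"]) (auto dest: not_less_Least)
    then show ?thesis using True unfolding eval.simps(6) t by (auto intro!: arg_cong[of _ _ Least])
  qed (simp add: t)
  have "eval (Comp rf [Comp pr [Proj 0, Comp pr [Proj 1, Mu t]]]) [e, x] =
      (if \<exists>s. P e x s then Some (F e x (LEAST s. P e x s)) else None)" for e x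
    by (simp add: mu pr rf f_def dec3 del: eval.simps(6))
  then show ?thesis unfolding partial_computable2_def by blast
qed

text \<open>Conversely, a partial recursive function is a limit of total ones: evaluate with fuel.\<close>

fun stage :: "recf \<Rightarrow> nat \<Rightarrow> nat list \<Rightarrow> nat option" where
  "stage Zero s xs = Some 0"
| "stage Succ s xs = (if xs = [] then None else Some (Suc (hd xs)))"
| "stage (Proj i) s xs = (if i < length xs then Some (hd (drop i xs)) else None)"
| "stage (Comp r rs) s xs =
    (let ys = map (\<lambda>q. stage q s xs) rs
     in if list_ex (\<lambda>y. y = None) ys then None else stage r s (map the ys))"
| "stage (PrimRec r q) s xs =
    (if xs = [] then None
     else rec_nat (stage r s (tl xs))
       (\<lambda>m v. if v = None then None else stage q s (m # the v # tl xs)) (hd xs))"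
| "stage (Mu r) s xs =
    (let ns = filter (\<lambda>n. stage r s (n # xs) = Some 0 \<and>
         list_all (\<lambda>m. stage r s (m # xs) \<noteq> None \<and> stage r s (m # xs) \<noteq> Some 0) [0..<n]) [0..<s]
     in if ns = [] then None else Some (hd ns))"

text \<open>The induction treats each program \<open>r\<close> separately; uniformity in the program
  is left to the acceptable numberings. \<open>stage\<close> is phrased with
  \<open>hd (drop i xs)\<close> and filters over \<open>[0..<s]\<close> because the closure rules
  cover these.\<close>

lemma effective_stage: "effective (\<lambda>p. stage r (fst p) (snd p))"
proof (induction r)
  case (Comp r rs)
  have "effective (\<lambda>p. map (\<lambda>q. stage q (fst p) (snd p)) rs)" using Comp(2)
  proof (induction rs)
    case (Cons q rs)
    then have "effective (\<lambda>p. stage q (fst p) (snd p) # map (\<lambda>q. stage q (fst p) (snd p)) rs)"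
      by (intro eff) auto
    then show ?case by simp
  qed (simp add: effective_const)
  then show ?case
    unfolding stage.simps Let_def by (intro eff effective_comp2[OF Comp(1)])
next
  case (PrimRec r q)
  then show ?case
    unfolding stage.simps by (intro eff effective_comp2[OF PrimRec(1)] effective_comp2[OF PrimRec(2)])
next
  case (Mu r)
  show ?case
    unfolding stage.simps Let_def by (intro eff effective_comp2[OF Mu])
qed (simp_all only: stage.simps; intro eff)+

text \<open>A zero preceded only by positive values is unique, so the first candidate in the list is
  the only one. The fuel thus bounds the search from above without affecting its result, which is
  what makes \<open>stage\<close> monotone at \<open>Mu\<close>.\<close>

lemma stage_Mu_iff:
  "stage (Mu r) s xs = Some n \<longleftrightarrow>
    n < s \<and> stage r s (n # xs) = Some 0 \<and> (\<forall>m<n. \<exists>y. stage r s (m # xs) = Some (Suc y))"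
proof -
  define Q where "Q n \<longleftrightarrow> stage r s (n # xs) = Some 0 \<and> (\<forall>m<n. \<exists>y. stage r s (m # xs) = Some (Suc y))" for n
  have Suc_iff: "(v \<noteq> None \<and> v \<noteq> Some 0) \<longleftrightarrow> (\<exists>y. v = Some (Suc y))" for v :: "nat option"
    by (cases v) (auto simp: gr0_conv_Suc)
  have uniq: "m = n" if "Q m" "Q n" for m n
    using that unfolding Q_def by (metis Zero_not_Suc linorder_neqE_nat option.inject)
  have "(\<lambda>n. stage r s (n # xs) = Some 0 \<and>
      list_all (\<lambda>m. stage r s (m # xs) \<noteq> None \<and> stage r s (m # xs) \<noteq> Some 0) [0..<n]) = Q"
    by (rule ext, simp only: Q_def Suc_iff list_all_iff) auto
  then have "stage (Mu r) s xs = (let ns = filter Q [0..<s] in if ns = [] then None else Some (hd ns))"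
    by simp
  moreover have "(let ns = filter Q [0..<s] in if ns = [] then None else Some (hd ns)) = Some n \<longleftrightarrow> n < s \<and> Q n"
  proof (cases "filter Q [0..<s]")
    case Nil
    then show ?thesis by (auto simp: filter_empty_conv)
  next
    case (Cons m ms)
    then have "m \<in> set (filter Q [0..<s])" by simp
    then have "m < s" "Q m" by auto
    with uniq Cons show ?thesis by auto
  qed
  ultimately show ?thesis by (simp add: Q_def)
qed

lemma stage_Comp_iff:
  "stage (Comp r rs) s xs = Some y \<longleftrightarrow>
    (\<forall>q\<in>set rs. stage q s xs \<noteq> None) \<and> stage r s (map (\<lambda>q. the (stage q s xs)) rs) = Some y"
proof -
  have "list_ex (\<lambda>y. y = None) (map (\<lambda>q. stage q s xs) rs) \<longleftrightarrow> \<not> (\<forall>q\<in>set rs. stage q s xs \<noteq> None)"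
    by (induction rs) auto
  then show ?thesis by (simp only: stage.simps Let_def map_map o_def) auto
qed

lemma eval_Comp_iff:
  "eval (Comp r rs) xs = Some y \<longleftrightarrow>
    (\<forall>q\<in>set rs. eval q xs \<noteq> None) \<and> eval r (map (\<lambda>q. the (eval q xs)) rs) = Some y"
proof -
  have "None \<in> set (map (\<lambda>q. eval q xs) rs) \<longleftrightarrow> \<not> (\<forall>q\<in>set rs. eval q xs \<noteq> None)"
    by (induction rs) auto
  then show ?thesis by (simp only: eval.simps(4) Let_def map_map o_def) auto
qed

lemma eval_Mu_iff:
  "eval (Mu r) xs = Some n \<longleftrightarrow>
    eval r (n # xs) = Some 0 \<and> (\<forall>m<n. \<exists>y. eval r (m # xs) = Some (Suc y))"
proof -
  have "(LEAST n. eval r (n # xs) = Some 0) = n"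
    if "eval r (n # xs) = Some 0" "\<forall>m<n. \<exists>y. eval r (m # xs) = Some (Suc y)" for n
    using that by (intro Least_equality) (auto simp: not_less[symmetric])
  then show ?thesis by auto
qed

lemma stage_mono: "stage r s xs = Some y \<Longrightarrow> s \<le> t \<Longrightarrow> stage r t xs = Some y"
proof (induction r arbitrary: xs y)
  case (Comp r rs)
  have eq: "stage q t xs = stage q s xs" if "q \<in> set rs" for q
    using Comp.prems Comp.IH(2)[OF that] that unfolding stage_Comp_iff by fastforce
  then have "map (\<lambda>q. the (stage q t xs)) rs = map (\<lambda>q. the (stage q s xs)) rs" by simp
  then show ?case using Comp.prems Comp.IH(1) eq unfolding stage_Comp_iff by (simp only:) metis
next
  case (PrimRec r q)
  let ?R = "\<lambda>s. rec_nat (stage r s (tl xs)) (\<lambda>m v. if v = None then None else stage q s (m # the v # tl xs))"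
  have "?R t n = Some v" if "?R s n = Some v" for n v
    using that
  proof (induction n arbitrary: v)
    case (Suc n)
    then obtain w where "?R s n = Some w" by (auto split: if_splits)
    with Suc PrimRec show ?case by auto
  qed (use PrimRec in auto)
  with PrimRec.prems show ?case by (auto split: if_splits)
next
  case (Mu r)
  then show ?case unfolding stage_Mu_iff by (meson order.strict_trans2)
qed (auto split: if_splits)

lemma stage_sound: "stage r s xs = Some y \<Longrightarrow> eval r xs = Some y"
proof (induction r arbitrary: xs y)
  case Succ
  then show ?case by (cases xs) auto
next
  case (Proj i)
  then show ?case by (auto split: if_splits simp: hd_drop_conv_nth)
next
  case (Comp r rs)
  have eq: "eval q xs = stage q s xs" if "q \<in> set rs" for q
    using Comp.prems Comp.IH(2)[OF that] that unfolding stage_Comp_iff by fastforce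
  then have "map (\<lambda>q. the (eval q xs)) rs = map (\<lambda>q. the (stage q s xs)) rs" by simp
  then show ?case using Comp.prems Comp.IH(1) eq unfolding stage_Comp_iff eval_Comp_iff by (simp only:) metis
next
  case (PrimRec r q)
  then obtain n ys where xs: "xs = n # ys" by (cases xs) auto
  let ?R = "rec_nat (stage r s ys) (\<lambda>m v. if v = None then None else stage q s (m # the v # ys))"
  let ?E = "rec_nat (eval r ys) (\<lambda>m v. Option.bind v (\<lambda>w. eval q (m # w # ys)))"
  have "?E k = Some v" if "?R k = Some v" for k v
    using that
  proof (induction k arbitrary: v)
    case (Suc k)
    then obtain w where "?R k = Some w" by (auto split: if_splits)
    with Suc PrimRec show ?case by auto
  qed (use PrimRec in auto)
  with PrimRec.prems show ?case by (simp add: xs cong: if_cong)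
next
  case (Mu r)
  then show ?case unfolding stage_Mu_iff eval_Mu_iff by meson
qed auto

lemma stage_complete: "eval r xs = Some y \<Longrightarrow> \<forall>\<^sub>F s in sequentially. stage r s xs = Some y"
proof (induction r arbitrary: xs y)
  case Succ
  then show ?case by (cases xs) auto
next
  case (Proj i)
  then show ?case by (auto split: if_splits simp: hd_drop_conv_nth)
next
  case (Comp r rs)
  have "\<forall>\<^sub>F s in sequentially. \<forall>q\<in>set rs. stage q s xs = eval q xs"
  proof (intro eventually_ball_finite ballI)
    fix q assume "q \<in> set rs"
    then obtain v where "eval q xs = Some v" using Comp.prems unfolding eval_Comp_iff by blast
    with Comp.IH(2)[OF \<open>q \<in> set rs\<close>] show "\<forall>\<^sub>F s in sequentially. stage q s xs = eval q xs" by simp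
  qed simp
  moreover have "\<forall>\<^sub>F s in sequentially. stage r s (map (\<lambda>q. the (eval q xs)) rs) = Some y"
    using Comp unfolding eval_Comp_iff by blast
  ultimately show ?case
  proof eventually_elim
    case (elim s)
    have "map (\<lambda>q. the (stage q s xs)) rs = map (\<lambda>q. the (eval q xs)) rs" using elim by simp
    with elim Comp.prems show ?case unfolding stage_Comp_iff eval_Comp_iff by (simp only:) metis
  qed
next
  case (PrimRec r q)
  then obtain n ys where xs: "xs = n # ys" by (cases xs) auto
  let ?R = "\<lambda>s. rec_nat (stage r s ys) (\<lambda>m v. if v = None then None else stage q s (m # the v # ys))"
  let ?E = "rec_nat (eval r ys) (\<lambda>m v. Option.bind v (\<lambda>w. eval q (m # w # ys)))"
  have "\<forall>\<^sub>F s in sequentially. ?R s k = Some v" if "?E k = Some v" for k v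
    using that
  proof (induction k arbitrary: v)
    case (Suc k)
    then obtain w where w: "?E k = Some w" "eval q (k # w # ys) = Some v"
      by (auto simp: bind_eq_Some_conv)
    from Suc.IH[OF w(1)] PrimRec.IH(2)[OF w(2)] show ?case
      by eventually_elim simp
  qed (use PrimRec in simp)
  with PrimRec.prems show ?case by (simp add: xs cong: if_cong)
next
  case (Mu r)
  then have n: "eval r (y # xs) = Some 0" "\<And>m. m < y \<Longrightarrow> \<exists>v. eval r (m # xs) = Some (Suc v)"
    unfolding eval_Mu_iff by auto
  have "\<forall>\<^sub>F s in sequentially. \<forall>m\<in>{..<y}. \<exists>v. stage r s (m # xs) = Some (Suc v)"
  proof (intro eventually_ball_finite ballI)
    fix m assume "m \<in> {..<y}"
    then obtain v where "eval r (m # xs) = Some (Suc v)" using n(2) by auto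
    from Mu.IH[OF this] show "\<forall>\<^sub>F s in sequentially. \<exists>v. stage r s (m # xs) = Some (Suc v)"
      by eventually_elim simp
  qed simp
  moreover note Mu.IH[OF n(1)] eventually_gt_at_top[of y]
  ultimately show ?case unfolding stage_Mu_iff by eventually_elim auto
qed auto

lemma partial_computable2_stages:
  assumes "partial_computable2 p"
  obtains st :: "nat \<Rightarrow> nat \<Rightarrow> nat \<Rightarrow> nat option"
  where "effective (\<lambda>q. st (fst q) (fst (snd q)) (snd (snd q)))"
    and "\<And>s t e x y. st s e x = Some y \<Longrightarrow> s \<le> t \<Longrightarrow> st t e x = Some y"
    and "\<And>e x y. p e x = Some y \<longleftrightarrow> (\<exists>s. st s e x = Some y)"
proof -
  obtain r where r: "\<And>e x. eval r [e, x] = p e x"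
    using assms unfolding partial_computable2_def by blast
  show thesis
  proof (rule that[of "\<lambda>s e x. stage r s [e, x]"])
    show "effective (\<lambda>q. stage r (fst q) [fst (snd q), snd (snd q)])"
      by (intro eff effective_comp2[OF effective_stage])
    show "p e x = Some y \<longleftrightarrow> (\<exists>s. stage r s [e, x] = Some y)" for e x y
      using stage_sound[of r _ "[e, x]" y] stage_complete[of r "[e, x]" y] r[of e x]
      by (auto simp: eventually_sequentially)
  qed (rule stage_mono)
qed

lemma partial_computable2_const:
  assumes "partial_computable p"
  shows "partial_computable2 (\<lambda>_. p)"
proof -
  obtain r where "\<And>x. eval r [x] = p x" using assms unfolding partial_computable_def by blast
  then have "eval (Comp r [Proj 1]) [e, x] = p x" for e x by simp
  then show ?thesis unfolding partial_computable2_def by blast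
qed

lemma uniformly_ce_stages:
  assumes "uniformly_ce A"
  obtains En :: "nat \<Rightarrow> nat \<Rightarrow> nat \<Rightarrow> bool"
  where "effective (\<lambda>q. En (fst q) (fst (snd q)) (snd (snd q)))"
    and "\<And>s t k x. En s k x \<Longrightarrow> s \<le> t \<Longrightarrow> En t k x"
    and "\<And>k x. x \<in> A k \<longleftrightarrow> (\<exists>s. En s k x)"
proof -
  obtain p where p: "partial_computable2 p" "\<And>k. A k = {x. p k x \<noteq> None}"
    using assms unfolding uniformly_ce_def by blast
  obtain st :: "nat \<Rightarrow> nat \<Rightarrow> nat \<Rightarrow> nat option" where
    st: "effective (\<lambda>q. st (fst q) (fst (snd q)) (snd (snd q)))"
    "\<And>s t e x y. st s e x = Some y \<Longrightarrow> s \<le> t \<Longrightarrow> st t e x = Some y"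
    "\<And>e x y. p e x = Some y \<longleftrightarrow> (\<exists>s. st s e x = Some y)"
    using partial_computable2_stages[OF p(1)] by blast
  show thesis
  proof (rule that[of "\<lambda>s k x. st s k x \<noteq> None"])
    show "effective (\<lambda>q. st (fst q) (fst (snd q)) (snd (snd q)) \<noteq> None)"
      by (intro eff st(1))
    show "st t k x \<noteq> None" if "st s k x \<noteq> None" "s \<le> t" for s t k x
      using that st(2)[of s k x _ t] by (cases "st s k x") auto
    show "x \<in> A k \<longleftrightarrow> (\<exists>s. st s k x \<noteq> None)" for k x
      unfolding p(2) mem_Collect_eq not_None_eq st(3) by blast
  qed
qed

lemma ce_stages:
  assumes "ce A"
  obtains En :: "nat \<Rightarrow> nat \<Rightarrow> bool"
  where "effective (\<lambda>q. En (fst q) (snd q))"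
    and "\<And>s t x. En s x \<Longrightarrow> s \<le> t \<Longrightarrow> En t x"
    and "\<And>x. x \<in> A \<longleftrightarrow> (\<exists>s. En s x)"
proof -
  obtain p where p: "partial_computable p" "A = {x. p x \<noteq> None}"
    using assms unfolding ce_def by blast
  then have "uniformly_ce (\<lambda>_. A)"
    unfolding uniformly_ce_def by (intro exI[of _ "\<lambda>_. p"] conjI partial_computable2_const) auto
  then obtain En :: "nat \<Rightarrow> nat \<Rightarrow> nat \<Rightarrow> bool" where
    En: "effective (\<lambda>q. En (fst q) (fst (snd q)) (snd (snd q)))"
    "\<And>s t k x. En s k x \<Longrightarrow> s \<le> t \<Longrightarrow> En t k x"
    "\<And>k x. x \<in> A \<longleftrightarrow> (\<exists>s. En s k x)"
    by (rule uniformly_ce_stages) blast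
  show thesis
  proof (rule that[of "\<lambda>s. En s 0"])
    show "effective (\<lambda>q. En (fst q) 0 (snd q))"
      by (intro eff effective_comp3[OF En(1)])
  qed (use En in blast)+
qed

lemma uniformly_ceI:
  fixes P :: "nat \<Rightarrow> nat \<Rightarrow> nat \<Rightarrow> bool"
  assumes "effective (\<lambda>q. P (fst q) (fst (snd q)) (snd (snd q)))"
  shows "uniformly_ce (\<lambda>k. {x. \<exists>s. P k x s})"
  unfolding uniformly_ce_def
  using partial_computable2_search[OF assms, of "\<lambda>_ _ _. 0", OF effective_const]
  by (intro exI conjI) (assumption, auto)


section \<open>Cantor space, its probability measures, and maps into them\<close>

section \<open>Strings and compactness\<close>

lemma string_code_eq_enc: "string_code = enc"
  by (rule ext) (simp add: string_code_def enc_list_def enc_bool_def[abs_def])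

lemma length_initial[simp]: "length (X \<restriction> n) = n"
  by (simp add: initial_def)

lemma nth_initial[simp]: "i < n \<Longrightarrow> (X \<restriction> n) ! i = X i"
  by (simp add: initial_def)

lemma take_initial[simp]: "take m (X \<restriction> n) = X \<restriction> min m n"
  by (simp add: initial_def take_map min_def)

lemma initial_Suc: "X \<restriction> Suc n = X \<restriction> n @ [X n]"
  by (simp add: initial_def)

lemma prefix_initial: "m \<le> n \<Longrightarrow> prefix (X \<restriction> m) (X \<restriction> n)"
  by (metis min.absorb1 take_initial take_is_prefix)

lemma prefix_initial_iff: "prefix \<sigma> (X \<restriction> n) \<longleftrightarrow> length \<sigma> \<le> n \<and> X \<in> cylinder \<sigma>"
proof
  assume *: "prefix \<sigma> (X \<restriction> n)"
  then have "length \<sigma> \<le> n" using prefix_length_le by fastforce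
  moreover have "take (length \<sigma>) (X \<restriction> n) = \<sigma>" using * by (metis append_eq_conv_conj prefix_def)
  ultimately show "length \<sigma> \<le> n \<and> X \<in> cylinder \<sigma>" by (simp add: cylinder_def)
next
  assume "length \<sigma> \<le> n \<and> X \<in> cylinder \<sigma>"
  then show "prefix \<sigma> (X \<restriction> n)" using prefix_initial[of "length \<sigma>" n X] by (simp add: cylinder_def)
qed

lemma mem_cylinder_initial[simp]: "X \<in> cylinder (X \<restriction> n)"
  by (simp add: cylinder_def)

definition strings :: "nat \<Rightarrow> bitstring list" where
  "strings n = List.n_lists n [False, True]"

lemma set_strings[simp]: "set (strings n) = {\<sigma>. length \<sigma> = n}"
  by (auto simp: strings_def set_n_lists)

lemma distinct_strings: "distinct (strings n)"
  by (simp add: strings_def distinct_n_lists)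

lemma length_strings: "length (strings n) = 2 ^ n"
  by (simp add: strings_def length_n_lists numeral_2_eq_2)

lemma finite_strings: "finite {\<sigma>::bitstring. length \<sigma> = n}"
  using finite_set[of "strings n"] by simp

lemma list_all_strings_le:
  "list_all (\<lambda>k. list_all Q (strings k)) [0..<Suc p] \<longleftrightarrow> (\<forall>\<sigma>. length \<sigma> \<le> p \<longrightarrow> Q \<sigma>)"
  by (auto simp: list_all_iff less_Suc_eq_le simp del: upt_Suc)

lemma list_ex_strings_le:
  "list_ex (\<lambda>k. list_ex Q (strings k)) [0..<Suc p] \<longleftrightarrow> (\<exists>\<sigma>. length \<sigma> \<le> p \<and> Q \<sigma>)"
  by (auto simp: list_ex_iff less_Suc_eq_le simp del: upt_Suc)

lemma effective_strings[eff]: "effective f \<Longrightarrow> effective (\<lambda>x. strings (f x))"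
  unfolding strings_def by (intro eff)

text \<open>Compactness of Cantor space, proved as Koenig's lemma: a string is \<open>bad\<close> if
  it has arbitrarily long extensions outside \<open>P\<close>. Every bad string has a bad extension
  by one bit, and following such bits from the empty string yields a real none of whose initial
  segments satisfies \<open>P\<close>.\<close>

lemma fan_theorem:
  fixes P :: "bitstring \<Rightarrow> bool"
  assumes mono: "\<And>\<rho> \<tau>. P \<rho> \<Longrightarrow> prefix \<rho> \<tau> \<Longrightarrow> P \<tau>"
    and bar: "\<And>Z. \<exists>n. P (Z \<restriction> n)"
  shows "\<exists>N. \<forall>\<rho>. N \<le> length \<rho> \<longrightarrow> P \<rho>"
proof (rule ccontr)
  assume contra: "\<not> ?thesis"
  define bad where "bad \<rho> \<longleftrightarrow> (\<forall>N. \<exists>\<tau>. prefix \<rho> \<tau> \<and> N \<le> length \<tau> \<and> \<not> P \<tau>)" for \<rho>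
  have "bad []" using contra by (auto simp: bad_def)
  have step: "\<exists>b. bad (\<rho> @ [b])" if "bad \<rho>" for \<rho>
  proof (rule ccontr)
    assume "\<not> ?thesis"
    then have "\<forall>b. \<exists>N. \<forall>\<tau>. prefix (\<rho> @ [b]) \<tau> \<longrightarrow> N \<le> length \<tau> \<longrightarrow> P \<tau>" unfolding bad_def by blast
    then obtain N where N: "\<And>b \<tau>. prefix (\<rho> @ [b]) \<tau> \<Longrightarrow> N b \<le> length \<tau> \<Longrightarrow> P \<tau>" by metis
    \<comment> \<open>This length forces a proper extension of \<open>\<rho>\<close> and exceeds the
      bounds for both possible next bits.\<close>
    have "\<exists>\<tau>. prefix \<rho> \<tau> \<and> Suc (length \<rho> + N False + N True) \<le> length \<tau> \<and> \<not> P \<tau>"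
      using \<open>bad \<rho>\<close> unfolding bad_def by (rule spec)
    then obtain \<tau> where \<tau>: "prefix \<rho> \<tau>" "Suc (length \<rho> + N False + N True) \<le> length \<tau>" "\<not> P \<tau>"
      by blast
    then obtain zs where zs: "\<tau> = \<rho> @ zs" by (auto simp: prefix_def)
    with \<tau>(2) obtain b \<tau>' where "\<tau> = \<rho> @ b # \<tau>'" by (cases zs) auto
    then have "prefix (\<rho> @ [b]) \<tau>" by simp
    moreover have "N b \<le> length \<tau>" using \<tau>(2) by (cases b) auto
    ultimately show False using N[of b \<tau>] \<tau>(3) by blast
  qed
  define s where "s = rec_nat [] (\<lambda>_ \<rho>. \<rho> @ [SOME b. bad (\<rho> @ [b])])"
  have s0: "s 0 = []" and sS: "s (Suc n) = s n @ [SOME b. bad (s n @ [b])]" for n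
    by (simp_all add: s_def)
  have bad: "bad (s n)" for n
  proof (induction n)
    case (Suc n)
    show ?case unfolding sS using step[OF Suc] by (rule someI_ex)
  qed (simp add: s0 \<open>bad []\<close>)
  define Z where "Z n = (SOME b. bad (s n @ [b]))" for n
  have "Z \<restriction> n = s n" for n
    by (induction n) (simp_all add: s0 sS initial_Suc Z_def, simp add: initial_def)
  moreover obtain n where "P (Z \<restriction> n)" using bar by blast
  ultimately show False using bad[of n] mono unfolding bad_def by metis
qed

text \<open>Read \<open>K\<close> as having been ruled out. If every real other than
  \<open>Z\<close> is ruled out at some finite stage, compactness leaves, at all large lengths, only
  strings that agree with \<open>Z\<close> on the first \<open>k\<close> bits. Both recoveries of
  \<open>Z\<close>, from a random real and from an index of its image, rest on this.\<close>

lemma alive_strings_agree: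
  assumes mono: "\<And>\<rho> \<tau>. K \<rho> \<Longrightarrow> prefix \<rho> \<tau> \<Longrightarrow> K \<tau>"
    and kill: "\<And>Y. Y \<noteq> Z \<Longrightarrow> \<exists>n. K (Y \<restriction> n)"
  obtains N where "k \<le> N" "\<And>\<rho>. N \<le> length \<rho> \<Longrightarrow> \<not> K \<rho> \<Longrightarrow> take k \<rho> = Z \<restriction> k"
proof -
  have "\<exists>N. \<forall>\<rho>. N \<le> length \<rho> \<longrightarrow> K \<rho> \<or> prefix (Z \<restriction> k) \<rho>"
  proof (rule fan_theorem)
    show "K \<tau> \<or> prefix (Z \<restriction> k) \<tau>" if "K \<rho> \<or> prefix (Z \<restriction> k) \<rho>" "prefix \<rho> \<tau>" for \<rho> \<tau>
      using that mono prefix_order.trans by blast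
    show "\<exists>n. K (Y \<restriction> n) \<or> prefix (Z \<restriction> k) (Y \<restriction> n)" for Y
      using kill[of Y] by (cases "Y = Z") auto
  qed
  then obtain N where "\<And>\<rho>. N \<le> length \<rho> \<Longrightarrow> K \<rho> \<or> prefix (Z \<restriction> k) \<rho>" by blast
  then have "take k \<rho> = Z \<restriction> k" if "max N k \<le> length \<rho>" "\<not> K \<rho>" for \<rho>
    using that by (force simp: prefix_def)
  then show thesis by (intro that[of "max N k"]) auto
qed


section \<open>Dyadic arithmetic\<close>

definition dadd :: "dyadic \<Rightarrow> dyadic \<Rightarrow> dyadic" where
  "dadd q r = (fst q * int (2 ^ snd r) + fst r * int (2 ^ snd q), snd q + snd r)"

definition dless :: "dyadic \<Rightarrow> dyadic \<Rightarrow> bool" where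
  "dless q r \<longleftrightarrow> fst q * int (2 ^ snd r) < fst r * int (2 ^ snd q)"

lemma dyadic_val_Pair: "dyadic_val (a, b) = of_int a / 2 ^ b"
  by (simp add: dyadic_val_def)

lemma dyadic_val_dadd[simp]: "dyadic_val (dadd q r) = dyadic_val q + dyadic_val r"
  by (cases q; cases r) (simp add: dadd_def dyadic_val_def field_simps power_add)

lemma dless_iff[simp]: "dless q r \<longleftrightarrow> dyadic_val q < dyadic_val r"
proof -
  have "dless q r \<longleftrightarrow> real_of_int (fst q * int (2 ^ snd r)) < real_of_int (fst r * int (2 ^ snd q))"
    unfolding dless_def of_int_less_iff ..
  then show ?thesis by (cases q; cases r) (simp add: dyadic_val_def field_simps)
qed

lemma effective_dadd[eff]: "effective f \<Longrightarrow> effective g \<Longrightarrow> effective (\<lambda>x. dadd (f x) (g x))"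
  unfolding dadd_def by (intro eff)

lemma effective_dless[eff]: "effective f \<Longrightarrow> effective g \<Longrightarrow> effective (\<lambda>x. dless (f x) (g x))"
  unfolding dless_def by (intro eff)

lemma dyadic_code_eq_enc: "dyadic_code = enc"
  by (rule ext) (simp add: dyadic_code_def enc_prod_def enc_int_def enc_nat_def split: prod.splits)

lemma basic_code_eq_enc: "basic_code = enc"
proof -
  have "(\<lambda>(\<sigma>, l, u). prod_encode (string_code \<sigma>, prod_encode (dyadic_code l, dyadic_code u))) = enc"
    unfolding string_code_eq_enc dyadic_code_eq_enc by (rule ext) (simp only: enc_prod_def case_prod_unfold fst_conv snd_conv)
  then show ?thesis by (intro ext) (simp only: basic_code_def enc_list_def)
qed


section \<open>Probability measures on Cantor space\<close>

lemma measures_iff: "\<mu> \<in> \<M> \<longleftrightarrow> prob_space \<mu> \<and> sets \<mu> = sets borel"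
  by (auto simp: prob_measures_def space_prob_algebra)

lemma open_cylinder: "open (cylinder \<sigma>)"
proof -
  have "open {X :: cantor. X i = b}" for i b
  proof -
    have "open ((\<lambda>X :: cantor. X i) -` {b})"
    proof (intro open_vimage continuous_on_product_coordinates)
      have "{b} = - {\<not> b}" by auto
      then show "open {b}" by (metis closed_singleton open_Compl)
    qed
    then show ?thesis by (simp add: vimage_def)
  qed
  then have "open (\<Inter>i<length \<sigma>. {X :: cantor. X i = \<sigma> ! i})"
    by (intro open_INT) auto
  moreover have "cylinder \<sigma> = (\<Inter>i<length \<sigma>. {X :: cantor. X i = \<sigma> ! i})"
    by (auto simp: cylinder_def list_eq_iff_nth_eq)
  ultimately show ?thesis by simp
qed

lemma sets_cylinder[simp]: "cylinder \<sigma> \<in> sets borel"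
  by (intro borel_open open_cylinder)

lemma disjoint_cylinders: "length \<sigma> = length \<tau> \<Longrightarrow> \<sigma> \<noteq> \<tau> \<Longrightarrow> cylinder \<sigma> \<inter> cylinder \<tau> = {}"
  by (auto simp: cylinder_def)

lemma sets_UN_cylinder[simp]: "(\<Union>\<sigma>\<in>S. cylinder \<sigma>) \<in> sets borel"
  by (intro borel_open open_UN ballI open_cylinder)

lemma measure_UN_cylinder:
  assumes "\<mu> \<in> \<M>" "\<And>\<sigma>. \<sigma> \<in> S \<Longrightarrow> length \<sigma> = n"
  shows "measure \<mu> (\<Union>\<sigma>\<in>S. cylinder \<sigma>) = (\<Sum>\<sigma>\<in>S. measure \<mu> (cylinder \<sigma>))"
proof -
  interpret prob_space \<mu> using assms(1) by (simp add: measures_iff)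
  have "S \<subseteq> {\<sigma>. length \<sigma> = n}" using assms(2) by auto
  then have "finite S" using finite_strings finite_subset by blast
  then show ?thesis
    using assms by (intro finite_measure_finite_Union)
      (auto simp: measures_iff disjoint_family_on_def intro!: disjoint_cylinders)
qed

lemma cylinder_eq_UN:
  assumes "length \<sigma> \<le> n"
  shows "cylinder \<sigma> = (\<Union>\<tau>\<in>{\<tau>. length \<tau> = n \<and> prefix \<sigma> \<tau>}. cylinder \<tau>)"
proof (intro set_eqI iffI)
  fix X assume "X \<in> cylinder \<sigma>"
  then have "prefix \<sigma> (X \<restriction> n)" using assms by (simp add: prefix_initial_iff)
  then show "X \<in> (\<Union>\<tau>\<in>{\<tau>. length \<tau> = n \<and> prefix \<sigma> \<tau>}. cylinder \<tau>)"
    by (intro UN_I[of "X \<restriction> n"]) auto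
next
  fix X assume "X \<in> (\<Union>\<tau>\<in>{\<tau>. length \<tau> = n \<and> prefix \<sigma> \<tau>}. cylinder \<tau>)"
  then obtain \<tau> where \<tau>: "length \<tau> = n" "prefix \<sigma> \<tau>" "X \<in> cylinder \<tau>" by blast
  then have "X \<restriction> n = \<tau>" by (simp add: cylinder_def)
  with \<tau> have "prefix \<sigma> (X \<restriction> n)" by simp
  then show "X \<in> cylinder \<sigma>" using prefix_initial_iff by blast
qed

lemma measure_cylinder_sum:
  assumes "\<mu> \<in> \<M>" "length \<sigma> \<le> n"
  shows "measure \<mu> (cylinder \<sigma>) = (\<Sum>\<tau> | length \<tau> = n \<and> prefix \<sigma> \<tau>. measure \<mu> (cylinder \<tau>))"
  unfolding cylinder_eq_UN[OF assms(2)] using assms(1) by (rule measure_UN_cylinder[of _ _ n]) auto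

lemma sum_measure_strings:
  assumes "\<mu> \<in> \<M>"
  shows "(\<Sum>\<tau> | length \<tau> = n. measure \<mu> (cylinder \<tau>)) = 1"
proof -
  interpret prob_space \<mu> using assms by (simp add: measures_iff)
  have "space \<mu> = UNIV" using assms sets_eq_imp_space_eq[of \<mu> borel] by (simp add: measures_iff)
  moreover have "cylinder [] = UNIV" by (auto simp: cylinder_def initial_def)
  ultimately show ?thesis using measure_cylinder_sum[OF assms, of "[]" n] prob_space by simp
qed

lemma measure_le_1: "\<mu> \<in> \<M> \<Longrightarrow> measure \<mu> A \<le> 1"
  by (simp add: measures_iff prob_space.prob_le_1)

text \<open>Toss a coin with bias \<open>t\<close> and sample from \<open>\<nu>\<close> on heads and
  from \<open>\<mu>\<close> on tails: as a monadic bind this mixture stays in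
  \<open>\<M>\<close>.\<close>

lemma convex_measures:
  assumes "\<mu> \<in> \<M>" "\<nu> \<in> \<M>" "0 \<le> t" "t \<le> 1"
  obtains \<kappa> where "\<kappa> \<in> \<M>"
    "\<And>\<sigma>. measure \<kappa> (cylinder \<sigma>) = (1 - t) * measure \<mu> (cylinder \<sigma>) + t * measure \<nu> (cylinder \<sigma>)"
proof -
  interpret \<mu>: prob_space \<mu> using assms by (simp add: measures_iff)
  interpret \<nu>: prob_space \<nu> using assms by (simp add: measures_iff)
  define \<kappa> where "\<kappa> = bind (measure_pmf (bernoulli_pmf t)) (\<lambda>b. if b then \<nu> else \<mu>)"
  have P: "measure_pmf (bernoulli_pmf t) \<in> space (prob_algebra (count_space UNIV))"
    by (simp add: space_prob_algebra prob_space_measure_pmf)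
  have K: "(\<lambda>b. if b then \<nu> else \<mu>) \<in> count_space UNIV \<rightarrow>\<^sub>M prob_algebra borel"
    using assms by (simp add: prob_measures_def)
  have \<kappa>: "\<kappa> \<in> \<M>" unfolding measures_iff \<kappa>_def
    using prob_space_bind'[OF P K] sets_bind'[OF P K] by simp
  have "emeasure \<kappa> A = ennreal ((1 - t) * measure \<mu> A + t * measure \<nu> A)" if "A \<in> sets borel" for A
    using assms unfolding \<kappa>_def emeasure_bind_prob_algebra[OF P K that]
    by (simp add: \<mu>.emeasure_eq_measure \<nu>.emeasure_eq_measure ennreal_mult'' ennreal_plus mult.commute add.commute)
  then have "measure \<kappa> A = (1 - t) * measure \<mu> A + t * measure \<nu> A" if "A \<in> sets borel" for A
    using that assms by (intro measure_eq_emeasure_eq_ennreal) auto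
  with \<kappa> that show thesis by simp
qed

text \<open>There are at most 2^k strings of length k, so an accuracy of 2^-2k for each leaves 2^-k
  for the whole sum. This is why the learners take the weights of strings of length k at precision
  \<open>2 * k\<close>.\<close>

lemma sum_measure_approx:
  assumes "\<mu> \<in> \<M>" "\<And>\<sigma>. \<sigma> \<in> S \<Longrightarrow> length \<sigma> = k"
    and "\<And>\<sigma>. \<sigma> \<in> S \<Longrightarrow> \<bar>w \<sigma> - measure \<mu> (cylinder \<sigma>)\<bar> \<le> (1/2) ^ (2 * k)"
  shows "\<bar>sum w S - measure \<mu> (\<Union>\<sigma>\<in>S. cylinder \<sigma>)\<bar> \<le> (1/2) ^ k"
proof -
  have S: "S \<subseteq> set (strings k)" using assms(2) by auto
  have "card S \<le> 2 ^ k"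
    using card_mono[OF _ S] distinct_card[OF distinct_strings[of k]] by (simp add: length_strings finite_strings)
  then have card: "real (card S) \<le> 2 ^ k" by (metis of_nat_le_iff of_nat_numeral of_nat_power)
  have "sum w S - measure \<mu> (\<Union>\<sigma>\<in>S. cylinder \<sigma>) = (\<Sum>\<sigma>\<in>S. w \<sigma> - measure \<mu> (cylinder \<sigma>))"
    using measure_UN_cylinder[OF assms(1,2)] by (simp add: sum_subtractf)
  also have "\<bar>\<dots>\<bar> \<le> (\<Sum>\<sigma>\<in>S. (1/2) ^ (2 * k))"
    by (rule order_trans[OF sum_abs sum_mono]) (rule assms(3))
  also have "\<dots> = card S * (1/2) ^ (2 * k)" by simp
  also have "\<dots> \<le> 2 ^ k * (1/2) ^ (2 * k)" using card by (intro mult_right_mono) auto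
  also have "\<dots> = (1/2) ^ k" by (simp add: mult_2 power_add power_divide)
  finally show ?thesis .
qed


section \<open>Empirical measures\<close>

text \<open>
  Lists of \<open>8\<^sup>N\<close> strings of length \<open>N\<close> serve as discretised measures: \<open>[\<sigma>]\<close> has as
  its measure the frequency of the extensions of \<open>\<sigma>\<close>. Rounding is so fine that even the sum of
  all the errors on strings of length \<open>N\<close> is small.
\<close>

definition grid :: "nat \<Rightarrow> bitstring list list" where
  "grid N = List.n_lists (8 ^ N) (strings N)"

definition freq :: "nat \<Rightarrow> bitstring list \<Rightarrow> bitstring \<Rightarrow> dyadic" where
  "freq N xs \<sigma> = (int (length (filter (prefix \<sigma>) xs)), 3 * N)"

lemma effective_grid[eff]: "effective f \<Longrightarrow> effective (\<lambda>x. grid (f x))"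
  unfolding grid_def by (intro eff)

lemma effective_freq[eff]:
  assumes "effective f" "effective g" "effective h"
  shows "effective (\<lambda>x. freq (f x) (g x) (h x))"
  unfolding freq_def by (intro eff assms assms[THEN effective_comp])

lemma set_grid: "xs \<in> set (grid N) \<longleftrightarrow> length xs = 8 ^ N \<and> (\<forall>x\<in>set xs. length x = N)"
  by (auto simp: grid_def set_n_lists)

lemma dyadic_val_freq: "dyadic_val (freq N xs \<sigma>) = length (filter (prefix \<sigma>) xs) / 8 ^ N"
proof -
  have "(2::real) ^ (3 * N) = 8 ^ N" by (simp add: power_mult)
  then show ?thesis by (simp add: freq_def dyadic_val_def)
qed

text \<open>The witness is the uniform distribution on the entries of the list, counted with
  multiplicity and continued by zeros. So every grid point comes from an actual measure, which can
  enter convex combinations.\<close>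

lemma grid_measure:
  assumes "xs \<in> set (grid N)"
  obtains \<nu> where "\<nu> \<in> \<M>"
    "\<And>\<sigma>. length \<sigma> \<le> N \<Longrightarrow> measure \<nu> (cylinder \<sigma>) = dyadic_val (freq N xs \<sigma>)"
proof -
  define X :: "nat \<Rightarrow> cantor" where "X i j = (j < N \<and> xs ! i ! j)" for i j
  let ?L = "8 ^ N :: nat"
  have xs: "length xs = ?L" "\<And>i. i < ?L \<Longrightarrow> length (xs ! i) = N"
    using assms by (auto simp: set_grid)
  have "0 \<in> {..<?L}" by simp
  then have ne: "{..<?L} \<noteq> {}" by blast
  define \<nu> where "\<nu> = distr (measure_pmf (pmf_of_set {..<?L})) borel X"
  interpret prob_space \<nu>
    unfolding \<nu>_def by (intro measure_pmf.prob_space_distr) simp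
  have "\<nu> \<in> \<M>" unfolding measures_iff using prob_space_axioms by (simp add: \<nu>_def)
  moreover have "measure \<nu> (cylinder \<sigma>) = dyadic_val (freq N xs \<sigma>)" if "length \<sigma> \<le> N" for \<sigma>
  proof -
    have "X i \<in> cylinder \<sigma> \<longleftrightarrow> prefix \<sigma> (xs ! i)" if "i < ?L" for i
    proof -
      have "xs ! i = X i \<restriction> N" using xs(2)[OF that] by (auto simp: list_eq_iff_nth_eq X_def)
      with \<open>length \<sigma> \<le> N\<close> show ?thesis by (simp add: prefix_initial_iff)
    qed
    then have "{..<?L} \<inter> X -` cylinder \<sigma> = {i. i < length xs \<and> prefix \<sigma> (xs ! i)}"
      using xs(1) by auto
    then have "card ({..<?L} \<inter> X -` cylinder \<sigma>) = length (filter (prefix \<sigma>) xs)"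
      by (simp add: length_filter_conv_card)
    moreover have "measure \<nu> (cylinder \<sigma>) = card ({..<?L} \<inter> X -` cylinder \<sigma>) / card {..<?L}"
      unfolding \<nu>_def using ne by (subst measure_distr) (simp_all add: measure_pmf_of_set)
    ultimately show ?thesis by (simp add: dyadic_val_freq)
  qed
  ultimately show thesis by (rule that)
qed

text \<open>Each string of length \<open>N\<close> is repeated 8^N times its measure, rounded down,
  and the list is filled up with the zero string. Rounding loses at most one per string and the
  filling adds what was lost, so counts are off by at most 2^N, and division by 8^N leaves
  4^-N.\<close>

lemma grid_approx:
  assumes "\<mu> \<in> \<M>"
  obtains xs where "xs \<in> set (grid N)"
    "\<And>\<sigma>. length \<sigma> \<le> N \<Longrightarrow> \<bar>dyadic_val (freq N xs \<sigma>) - measure \<mu> (cylinder \<sigma>)\<bar> \<le> (1/4) ^ N"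
proof -
  let ?L = "8 ^ N :: nat" and ?S = "{\<tau>::bitstring. length \<tau> = N}"
  define m where "m \<tau> = ?L * measure \<mu> (cylinder \<tau>)" for \<tau>
  define c where "c \<tau> = nat \<lfloor>m \<tau>\<rfloor>" for \<tau>
  have c: "real (c \<tau>) \<le> m \<tau>" "m \<tau> \<le> real (c \<tau>) + 1" for \<tau>
    unfolding c_def m_def by simp_all
  have fin: "finite ?S" and card_S: "card ?S = 2 ^ N"
    using finite_strings distinct_card[OF distinct_strings[of N]] by (simp_all add: length_strings)
  have sum_m: "sum m ?S = ?L" unfolding m_def
    by (simp add: sum_distrib_left[symmetric] sum_measure_strings[OF assms])
  have "real (sum c ?S) \<le> sum m ?S" unfolding of_nat_sum by (intro sum_mono c)
  then have "real (sum c ?S) \<le> real ?L" using sum_m by simp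
  then have le: "sum c ?S \<le> ?L" by (simp only: of_nat_le_iff)
  have "sum m ?S \<le> (\<Sum>\<tau>\<in>?S. real (c \<tau>) + 1)" by (intro sum_mono c)
  then have rest: "real (?L - sum c ?S) \<le> 2 ^ N"
    using sum_m le by (simp add: sum.distrib card_S of_nat_diff)
  define ys where "ys = concat (map (\<lambda>\<tau>. replicate (c \<tau>) \<tau>) (strings N))"
  define zs where "zs = replicate (?L - sum c ?S) (replicate N False)"
  have "length ys = sum c ?S"
    by (simp add: ys_def length_concat o_def sum_list_distinct_conv_sum_set[OF distinct_strings])
  then have grid: "ys @ zs \<in> set (grid N)" using le by (auto simp: set_grid ys_def zs_def)
  have "\<bar>dyadic_val (freq N (ys @ zs) \<sigma>) - measure \<mu> (cylinder \<sigma>)\<bar> \<le> (1/4) ^ N" if "length \<sigma> \<le> N" for \<sigma>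
  proof -
    let ?A = "{\<tau>. length \<tau> = N \<and> prefix \<sigma> \<tau>}"
    have A: "?A \<subseteq> ?S" "finite ?A" using fin by (auto intro: finite_subset)
    have "length (filter (prefix \<sigma>) ys) = (\<Sum>\<tau>\<in>?S. if prefix \<sigma> \<tau> then c \<tau> else 0)"
      by (simp add: ys_def filter_concat length_concat o_def filter_replicate if_distrib
          sum_list_distinct_conv_sum_set[OF distinct_strings] cong: if_cong)
    also have "\<dots> = sum c ?A"
      using fin by (simp add: sum.inter_filter[symmetric])
    finally have ys: "length (filter (prefix \<sigma>) ys) = sum c ?A" .
    have zs: "length (filter (prefix \<sigma>) zs) \<le> ?L - sum c ?S"
      using length_filter_le[of "prefix \<sigma>" zs] by (simp add: zs_def)
    have m\<sigma>: "?L * measure \<mu> (cylinder \<sigma>) = sum m ?A"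
      unfolding m_def measure_cylinder_sum[OF assms that] by (simp add: sum_distrib_left)
    have "sum m ?A \<le> (\<Sum>\<tau>\<in>?A. real (c \<tau>) + 1)" by (intro sum_mono c)
    also have "\<dots> \<le> real (sum c ?A) + 2 ^ N"
      using card_mono[OF fin A(1)] by (simp add: sum.distrib card_S)
    finally have 1: "sum m ?A \<le> real (sum c ?A) + 2 ^ N" .
    have 2: "real (sum c ?A) \<le> sum m ?A" unfolding of_nat_sum by (intro sum_mono c)
    have "real (length (filter (prefix \<sigma>) zs)) \<le> 2 ^ N" using zs rest by linarith
    with 1 2 ys have "\<bar>real (length (filter (prefix \<sigma>) (ys @ zs))) - ?L * measure \<mu> (cylinder \<sigma>)\<bar> \<le> 2 ^ N"
      unfolding m\<sigma> filter_append length_append of_nat_add ys abs_le_iff by linarith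
    then have "\<bar>real (length (filter (prefix \<sigma>) (ys @ zs))) - ?L * measure \<mu> (cylinder \<sigma>)\<bar> / 8 ^ N \<le> 2 ^ N / 8 ^ N"
      by (intro divide_right_mono) auto
    moreover have "dyadic_val (freq N (ys @ zs) \<sigma>) - measure \<mu> (cylinder \<sigma>) =
        (real (length (filter (prefix \<sigma>) (ys @ zs))) - ?L * measure \<mu> (cylinder \<sigma>)) / 8 ^ N"
      unfolding dyadic_val_freq by (simp add: field_simps)
    moreover have "(2::real) ^ N / 8 ^ N = (1/4) ^ N" by (simp add: power_divide[symmetric])
    ultimately show ?thesis by (simp only: abs_divide power_abs abs_numeral)
  qed
  with grid show thesis by (rule that)
qed


section \<open>Effective evaluation of a computable map into measures\<close>

text \<open>Level n enters \<open>mdistance\<close> with weight 2^-n, so a single cylinder is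
  controlled at the price of the factor \<open>2 ^ length \<sigma>\<close>. Comparison with the
  geometric series of sum 2 gives convergence, without which the infinite sum would carry no
  information.\<close>

lemma
  assumes "\<mu> \<in> \<M>" "\<nu> \<in> \<M>"
  shows abs_measure_diff_le_mdistance:
      "\<bar>measure \<mu> (cylinder \<sigma>) - measure \<nu> (cylinder \<sigma>)\<bar> \<le> 2 ^ length \<sigma> * mdistance \<mu> \<nu>"
    and mdistance_le_2: "mdistance \<mu> \<nu> \<le> 2"
proof -
  define D where "D n = (\<lambda>\<sigma>. \<bar>measure \<mu> (cylinder \<sigma>) - measure \<nu> (cylinder \<sigma>)\<bar>) ` {\<sigma>. length \<sigma> = n}" for n
  have fin: "finite (D n)" for n unfolding D_def using finite_strings by blast
  have "D n \<noteq> {}" for n unfolding D_def using Ex_list_of_length by blast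
  then have mem: "Max (D n) \<in> D n" for n using fin by (intro Max_in)
  have range: "0 \<le> Max (D n)" "Max (D n) \<le> 1" for n
  proof -
    obtain \<tau> where \<tau>: "Max (D n) = \<bar>measure \<mu> (cylinder \<tau>) - measure \<nu> (cylinder \<tau>)\<bar>"
      using mem[of n] unfolding D_def by blast
    show "0 \<le> Max (D n)" unfolding \<tau> by simp
    have "measure \<mu> (cylinder \<tau>) \<le> 1" "measure \<nu> (cylinder \<tau>) \<le> 1"
      using assms measure_le_1 by blast+
    then show "Max (D n) \<le> 1" unfolding \<tau>
      using measure_nonneg[of \<mu> "cylinder \<tau>"] measure_nonneg[of \<nu> "cylinder \<tau>"] by linarith
  qed
  have geo: "(\<lambda>n. (1/2::real) ^ n) sums 2" using geometric_sums[of "1/2::real"] by simp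
  have sm: "summable (\<lambda>n. (1/2) ^ n * Max (D n))"
    by (rule summable_comparison_test'[OF sums_summable[OF geo], of 0])
      (simp add: range abs_mult mult_left_le)
  have md: "mdistance \<mu> \<nu> = (\<Sum>n. (1/2) ^ n * Max (D n))" unfolding mdistance_def D_def ..
  have "(\<Sum>n. (1/2) ^ n * Max (D n)) \<le> (\<Sum>n. (1/2::real) ^ n)"
    using sm geo by (intro suminf_le) (auto simp: range mult_left_le sums_iff)
  then show "mdistance \<mu> \<nu> \<le> 2" using md geo by (simp add: sums_iff)
  let ?n = "length \<sigma>"
  have "\<bar>measure \<mu> (cylinder \<sigma>) - measure \<nu> (cylinder \<sigma>)\<bar> \<le> Max (D ?n)"
    using fin by (intro Max_ge) (auto simp: D_def)
  moreover have "(1/2) ^ ?n * Max (D ?n) \<le> mdistance \<mu> \<nu>"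
    unfolding md using sum_le_suminf[OF sm, of "{?n}"] by (simp add: range)
  moreover have "(2::real) ^ ?n * ((1/2) ^ ?n * Max (D ?n)) = Max (D ?n)"
    by (simp add: power_divide)
  ultimately show "\<bar>measure \<mu> (cylinder \<sigma>) - measure \<nu> (cylinder \<sigma>)\<bar> \<le> 2 ^ length \<sigma> * mdistance \<mu> \<nu>"
    by (smt (verit) mult_left_mono zero_le_power)
qed

lemma mdistance_le_mdiameter:
  assumes "S \<subseteq> \<M>" "\<mu> \<in> S" "\<nu> \<in> S"
  shows "mdistance \<mu> \<nu> \<le> mdiameter S"
proof -
  have "bdd_above ((\<lambda>(\<mu>, \<nu>). mdistance \<mu> \<nu>) ` (S \<times> S))"
    using assms(1) mdistance_le_2 by (intro bdd_aboveI[of _ 2]) auto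
  then show ?thesis unfolding mdiameter_def
    using assms by (intro cSUP_upper2[of _ _ "(\<mu>, \<nu>)"]) auto
qed

text \<open>
  The grid points in a slight enlargement of \<^term>\<open>basic_open B\<close>. Every point of the set is near
  one of them, and if the set is not empty, then by convexity each of them is near a point of the set.
\<close>

definition candidates :: "nat \<Rightarrow> basic \<Rightarrow> bitstring list list" where
  "candidates N B = filter (\<lambda>xs. list_all (\<lambda>(\<sigma>, l, u).
     dless (dadd l (- 2, 2 * N)) (freq N xs \<sigma>) \<and> dless (freq N xs \<sigma>) (dadd u (2, 2 * N))) B) (grid N)"

text \<open>A decidable substitute for small diameter: any two candidates agree up to 2^-(p+1) on
  strings of length at most \<open>p\<close>. The resolution \<open>N\<close> has to reach all
  strings occurring in \<open>B\<close>, and \<open>p < N\<close> keeps the grid error 4^-N within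
  2^-(p+1).\<close>

definition determined :: "nat \<Rightarrow> nat \<Rightarrow> basic \<Rightarrow> bool" where
  "determined p N B \<longleftrightarrow> p < N \<and> list_all (\<lambda>(\<sigma>, l, u). length \<sigma> \<le> N) B \<and>
     list_all (\<lambda>xs. list_all (\<lambda>ys. list_all (\<lambda>k. list_all (\<lambda>\<sigma>.
       dless (freq N xs \<sigma>) (dadd (freq N ys \<sigma>) (1, Suc p))) (strings k)) [0..<Suc p])
     (candidates N B)) (candidates N B)"

lemma effective_candidates[eff]:
  assumes "effective f" "effective g"
  shows "effective (\<lambda>x. candidates (f x) (g x))"
  unfolding candidates_def by (intro eff assms assms[THEN effective_comp])

lemma effective_determined[eff]:
  assumes "effective h" "effective f" "effective g"
  shows "effective (\<lambda>x. determined (h x) (f x) (g x))"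
  unfolding determined_def by (intro eff assms assms[THEN effective_comp])

lemma dyadic_val_slack: "dyadic_val (2, 2 * N) = 2 * (1/4) ^ N" "dyadic_val (- 2, 2 * N) = - 2 * (1/4) ^ N"
  by (simp_all add: dyadic_val_def power_mult power_divide)

lemma dyadic_val_inverse_power: "dyadic_val (1, n) = (1/2) ^ n"
  by (simp add: dyadic_val_def power_divide)

lemma determined_iff:
  "determined p N B \<longleftrightarrow> p < N \<and> (\<forall>(\<sigma>, l, u)\<in>set B. length \<sigma> \<le> N) \<and>
    (\<forall>xs\<in>set (candidates N B). \<forall>ys\<in>set (candidates N B). \<forall>\<sigma>. length \<sigma> \<le> p \<longrightarrow>
      dyadic_val (freq N xs \<sigma>) < dyadic_val (freq N ys \<sigma>) + (1/2) ^ Suc p)"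
  unfolding determined_def list_all_strings_le
  by (simp add: list_all_iff dyadic_val_inverse_power case_prod_unfold)

lemma basic_open_iff:
  "\<mu> \<in> basic_open B \<longleftrightarrow> \<mu> \<in> \<M> \<and>
    (\<forall>(\<sigma>, l, u)\<in>set B. dyadic_val l < measure \<mu> (cylinder \<sigma>) \<and> measure \<mu> (cylinder \<sigma>) < dyadic_val u)"
  by (simp add: basic_open_def)

lemma candidates_near:
  assumes "\<mu> \<in> basic_open B" "\<forall>(\<sigma>, l, u)\<in>set B. length \<sigma> \<le> N"
  obtains xs where "xs \<in> set (candidates N B)"
    "\<And>\<sigma>. length \<sigma> \<le> N \<Longrightarrow> \<bar>dyadic_val (freq N xs \<sigma>) - measure \<mu> (cylinder \<sigma>)\<bar> \<le> (1/4) ^ N"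
proof -
  have "\<mu> \<in> \<M>" using assms(1) by (simp add: basic_open_iff)
  then obtain xs where xs: "xs \<in> set (grid N)"
    "\<And>\<sigma>. length \<sigma> \<le> N \<Longrightarrow> \<bar>dyadic_val (freq N xs \<sigma>) - measure \<mu> (cylinder \<sigma>)\<bar> \<le> (1/4) ^ N"
    using grid_approx by metis
  have pos: "(0::real) < (1/4) ^ N" by simp
  have "dyadic_val l - 2 * (1/4) ^ N < dyadic_val (freq N xs \<sigma>) \<and>
      dyadic_val (freq N xs \<sigma>) < dyadic_val u + 2 * (1/4) ^ N" if "(\<sigma>, l, u) \<in> set B" for \<sigma> l u
  proof -
    have "dyadic_val l < measure \<mu> (cylinder \<sigma>)" "measure \<mu> (cylinder \<sigma>) < dyadic_val u"
      using assms(1) that by (auto simp: basic_open_iff)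
    moreover have "\<bar>dyadic_val (freq N xs \<sigma>) - measure \<mu> (cylinder \<sigma>)\<bar> \<le> (1/4) ^ N"
      using assms(2) that by (intro xs(2)) auto
    ultimately show ?thesis using pos by linarith
  qed
  then have "xs \<in> set (candidates N B)"
    using xs(1) by (auto simp: candidates_def list_all_iff dyadic_val_slack)
  with xs(2) show thesis by (intro that)
qed

text \<open>The first candidate can stand for all of \<open>basic_open B\<close>: it is within
  2^-(p+1) of the candidate that approximates \<open>\<mu>\<close>, which is itself within 4^-N of
  \<open>\<mu>\<close>. The measure \<open>\<mu>\<close> also guarantees that there is a candidate,
  so that \<open>hd\<close> is meaningful.\<close>

lemma determined_sound:
  assumes "determined p N B" "\<mu> \<in> basic_open B" "length \<sigma> \<le> p"
  shows "\<bar>dyadic_val (freq N (hd (candidates N B)) \<sigma>) - measure \<mu> (cylinder \<sigma>)\<bar> \<le> (1/2) ^ p"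
proof -
  have N: "p < N" "\<forall>(\<sigma>, l, u)\<in>set B. length \<sigma> \<le> N" using assms(1) by (auto simp: determined_iff)
  obtain xs where xs: "xs \<in> set (candidates N B)"
    "\<bar>dyadic_val (freq N xs \<sigma>) - measure \<mu> (cylinder \<sigma>)\<bar> \<le> (1/4) ^ N"
    using candidates_near[OF assms(2) N(2)] N(1) assms(3) by (metis le_trans less_imp_le)
  let ?ys = "hd (candidates N B)"
  have ys: "?ys \<in> set (candidates N B)" using xs(1) by (cases "candidates N B") auto
  have "dyadic_val (freq N xs \<sigma>) < dyadic_val (freq N ?ys \<sigma>) + (1/2) ^ Suc p"
    "dyadic_val (freq N ?ys \<sigma>) < dyadic_val (freq N xs \<sigma>) + (1/2) ^ Suc p"
    using assms(1,3) xs(1) ys unfolding determined_iff by blast+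
  moreover have "(1/4::real) ^ N \<le> (1/4) ^ Suc p" using N(1) by (intro power_decreasing) auto
  moreover have "(1/4::real) ^ Suc p \<le> (1/2) ^ Suc p" by (intro power_mono) auto
  moreover have "(1/2::real) ^ Suc p + (1/2) ^ Suc p = (1/2) ^ p" by simp
  ultimately show ?thesis using xs(2) by linarith
qed

text \<open>A candidate may violate the conditions by up to 2 * 4^-N. Mixing it with
  \<open>\<mu>\<^sub>0\<close>, which satisfies them with slack \<open>\<delta>\<close>, repairs
  this, and the required share of \<open>\<mu>\<^sub>0\<close> tends to 0 as \<open>N\<close>
  grows.\<close>

lemma candidates_sound:
  assumes "\<mu>\<^sub>0 \<in> \<M>" "\<delta> > 0"
    and slack: "\<And>\<sigma> l u. (\<sigma>, l, u) \<in> set B \<Longrightarrow>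
      dyadic_val l + \<delta> \<le> measure \<mu>\<^sub>0 (cylinder \<sigma>) \<and> measure \<mu>\<^sub>0 (cylinder \<sigma>) \<le> dyadic_val u - \<delta>"
    and N: "\<forall>(\<sigma>, l, u)\<in>set B. length \<sigma> \<le> N" and xs: "xs \<in> set (candidates N B)"
  obtains \<kappa> where "\<kappa> \<in> basic_open B"
    "\<And>\<sigma>. length \<sigma> \<le> N \<Longrightarrow> \<bar>dyadic_val (freq N xs \<sigma>) - measure \<kappa> (cylinder \<sigma>)\<bar> \<le> 2 * (1/4) ^ N / \<delta>"
proof -
  have "xs \<in> set (grid N)" using xs by (simp add: candidates_def)
  then obtain \<nu> where \<nu>: "\<nu> \<in> \<M>"
    "\<And>\<sigma>. length \<sigma> \<le> N \<Longrightarrow> measure \<nu> (cylinder \<sigma>) = dyadic_val (freq N xs \<sigma>)"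
    using grid_measure by blast
  define \<eta> where "\<eta> = (2 * (1/4) ^ N :: real)"
  \<comment> \<open>The share of \<open>\<mu>\<^sub>0\<close> for which violation and slack cancel
    exactly: \<open>(1 - t) * \<eta> = t * \<delta>\<close>.\<close>
  define t where "t = \<eta> / (\<eta> + \<delta>)"
  have \<eta>: "\<eta> > 0" by (simp add: \<eta>_def)
  have t: "0 \<le> t" "t \<le> 1" and bal: "(1 - t) * \<eta> = t * \<delta>"
    using \<eta> \<open>\<delta> > 0\<close> unfolding t_def by (auto simp: field_simps)
  have "t < 1" "t \<le> \<eta> / \<delta>"
    using \<eta> \<open>\<delta> > 0\<close> unfolding t_def by (auto simp: field_simps)
  obtain \<kappa> where \<kappa>: "\<kappa> \<in> \<M>"
    "\<And>\<sigma>. measure \<kappa> (cylinder \<sigma>) = (1 - t) * measure \<nu> (cylinder \<sigma>) + t * measure \<mu>\<^sub>0 (cylinder \<sigma>)"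
    using convex_measures[OF \<nu>(1) assms(1) t] by blast
  have "dyadic_val l < measure \<kappa> (cylinder \<sigma>) \<and> measure \<kappa> (cylinder \<sigma>) < dyadic_val u"
    if B: "(\<sigma>, l, u) \<in> set B" for \<sigma> l u
  proof -
    have \<sigma>: "length \<sigma> \<le> N" using N B by auto
    have "dyadic_val l - \<eta> < measure \<nu> (cylinder \<sigma>)" "measure \<nu> (cylinder \<sigma>) < dyadic_val u + \<eta>"
      using xs B \<nu>(2)[OF \<sigma>] by (auto simp: candidates_def list_all_iff \<eta>_def dyadic_val_slack)
    then have "(1 - t) * (dyadic_val l - \<eta>) < (1 - t) * measure \<nu> (cylinder \<sigma>)"
      "(1 - t) * measure \<nu> (cylinder \<sigma>) < (1 - t) * (dyadic_val u + \<eta>)"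
      using \<open>t < 1\<close> by simp_all
    moreover have "t * (dyadic_val l + \<delta>) \<le> t * measure \<mu>\<^sub>0 (cylinder \<sigma>)"
      "t * measure \<mu>\<^sub>0 (cylinder \<sigma>) \<le> t * (dyadic_val u - \<delta>)"
      using slack[OF B] t(1) by (auto intro!: mult_left_mono)
    moreover have "(1 - t) * (dyadic_val l - \<eta>) + t * (dyadic_val l + \<delta>) = dyadic_val l"
      "(1 - t) * (dyadic_val u + \<eta>) + t * (dyadic_val u - \<delta>) = dyadic_val u"
      using bal by (auto simp: algebra_simps)
    ultimately show ?thesis unfolding \<kappa>(2) by linarith
  qed
  then have "\<kappa> \<in> basic_open B" using \<kappa>(1) by (auto simp: basic_open_iff)
  moreover have "\<bar>dyadic_val (freq N xs \<sigma>) - measure \<kappa> (cylinder \<sigma>)\<bar> \<le> 2 * (1/4) ^ N / \<delta>"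
    if "length \<sigma> \<le> N" for \<sigma>
  proof -
    have "measure \<nu> (cylinder \<sigma>) - measure \<kappa> (cylinder \<sigma>) =
        t * (measure \<nu> (cylinder \<sigma>) - measure \<mu>\<^sub>0 (cylinder \<sigma>))"
      unfolding \<kappa>(2) by (simp add: algebra_simps)
    moreover have "\<bar>measure \<nu> (cylinder \<sigma>) - measure \<mu>\<^sub>0 (cylinder \<sigma>)\<bar> \<le> 1"
      using measure_le_1[OF \<nu>(1), of "cylinder \<sigma>"] measure_le_1[OF assms(1), of "cylinder \<sigma>"]
        measure_nonneg[of \<nu> "cylinder \<sigma>"] measure_nonneg[of \<mu>\<^sub>0 "cylinder \<sigma>"] by linarith
    ultimately have "\<bar>measure \<nu> (cylinder \<sigma>) - measure \<kappa> (cylinder \<sigma>)\<bar> \<le> t"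
      using t(1) by (simp add: abs_mult mult_left_le)
    also have "t \<le> 2 * (1/4) ^ N / \<delta>" using \<open>t \<le> \<eta> / \<delta>\<close> by (simp add: \<eta>_def)
    finally show ?thesis using \<nu>(2)[OF that] by simp
  qed
  ultimately show thesis by (rule that)
qed

text \<open>One factor 2^-p of the diameter bound pays for passing from \<open>mdistance\<close> to
  strings of length at most \<open>p\<close>. What remains is 2^-(p+2), and \<open>N\<close> is
  taken so large that repairing the two candidates costs less than another 2^-(p+2), together
  2^-(p+1).\<close>

lemma determined_complete:
  assumes "\<mu>\<^sub>0 \<in> basic_open B" "mdiameter (basic_open B) < (1/2) ^ (p + p + 2)"
  shows "\<exists>N. determined p N B"
proof -
  \<comment> \<open>The slack in the tightest condition, capped at 1 so that the minimum exists also
    for empty \<open>B\<close>.\<close>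
  define d where "d = Min (insert 1 ((\<lambda>(\<sigma>, l, u). min (measure \<mu>\<^sub>0 (cylinder \<sigma>) - dyadic_val l)
      (dyadic_val u - measure \<mu>\<^sub>0 (cylinder \<sigma>))) ` set B))"
  have "d > 0" using assms(1) unfolding d_def by (auto simp: basic_open_iff)
  have "d \<le> min (measure \<mu>\<^sub>0 (cylinder \<sigma>) - dyadic_val l) (dyadic_val u - measure \<mu>\<^sub>0 (cylinder \<sigma>))"
    if "(\<sigma>, l, u) \<in> set B" for \<sigma> l u
    unfolding d_def using that by (intro Min_le) force+
  then have slack: "dyadic_val l + d \<le> measure \<mu>\<^sub>0 (cylinder \<sigma>) \<and> measure \<mu>\<^sub>0 (cylinder \<sigma>) \<le> dyadic_val u - d"
    if "(\<sigma>, l, u) \<in> set B" for \<sigma> l u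
    using that by fastforce
  have \<mu>\<^sub>0: "\<mu>\<^sub>0 \<in> \<M>" using assms(1) by (simp add: basic_open_iff)
  have "(\<lambda>N. (1/4::real) ^ N) \<longlonglongrightarrow> 0" by (rule LIMSEQ_power_zero) simp
  then have "(\<lambda>N. 4 / d * (1/4::real) ^ N) \<longlonglongrightarrow> 4 / d * 0" by (intro tendsto_mult_left)
  then have "(\<lambda>N. 4 * (1/4::real) ^ N / d) \<longlonglongrightarrow> 0" by simp
  then have "\<forall>\<^sub>F N in sequentially. 4 * (1/4::real) ^ N / d < (1/2) ^ (p + 2)"
    by (rule order_tendstoD) simp
  then obtain N\<^sub>0 where N\<^sub>0: "\<And>N. N\<^sub>0 \<le> N \<Longrightarrow> 4 * (1/4::real) ^ N / d < (1/2) ^ (p + 2)"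
    unfolding eventually_sequentially by blast
  define N where "N = Suc p + N\<^sub>0 + Max (insert 0 ((\<lambda>(\<sigma>, l, u). length \<sigma>) ` set B))"
  have "length \<sigma> \<le> Max (insert 0 ((\<lambda>(\<sigma>, l, u). length \<sigma>) ` set B))" if "(\<sigma>, l, u) \<in> set B" for \<sigma> l u
    using that by (intro Max_ge) force+
  then have N: "\<forall>(\<sigma>, l, u)\<in>set B. length \<sigma> \<le> N" unfolding N_def by fastforce
  have small: "4 * (1/4::real) ^ N / d < (1/2) ^ (p + 2)" by (rule N\<^sub>0) (simp add: N_def)
  have "dyadic_val (freq N xs \<sigma>) < dyadic_val (freq N ys \<sigma>) + (1/2) ^ Suc p"
    if xs: "xs \<in> set (candidates N B)" and ys: "ys \<in> set (candidates N B)" and \<sigma>: "length \<sigma> \<le> p" for xs ys \<sigma>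
  proof -
    obtain \<kappa> where \<kappa>: "\<kappa> \<in> basic_open B"
      "\<And>\<sigma>. length \<sigma> \<le> N \<Longrightarrow> \<bar>dyadic_val (freq N xs \<sigma>) - measure \<kappa> (cylinder \<sigma>)\<bar> \<le> 2 * (1/4) ^ N / d"
      using candidates_sound[OF \<mu>\<^sub>0 \<open>d > 0\<close> slack N xs] by blast
    obtain \<kappa>' where \<kappa>': "\<kappa>' \<in> basic_open B"
      "\<And>\<sigma>. length \<sigma> \<le> N \<Longrightarrow> \<bar>dyadic_val (freq N ys \<sigma>) - measure \<kappa>' (cylinder \<sigma>)\<bar> \<le> 2 * (1/4) ^ N / d"
      using candidates_sound[OF \<mu>\<^sub>0 \<open>d > 0\<close> slack N ys] by blast
    have "basic_open B \<subseteq> \<M>" by (auto simp: basic_open_iff)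
    then have dist: "mdistance \<kappa> \<kappa>' < (1/2) ^ (p + p + 2)" and M: "\<kappa> \<in> \<M>" "\<kappa>' \<in> \<M>"
      using mdistance_le_mdiameter[of "basic_open B" \<kappa> \<kappa>'] assms(2) \<kappa>(1) \<kappa>'(1) by auto
    have nonneg: "0 \<le> mdistance \<kappa> \<kappa>'"
      using order_trans[OF abs_ge_zero abs_measure_diff_le_mdistance[OF M, of "[]"]] by simp
    have "\<bar>measure \<kappa> (cylinder \<sigma>) - measure \<kappa>' (cylinder \<sigma>)\<bar> \<le> 2 ^ length \<sigma> * mdistance \<kappa> \<kappa>'"
      by (rule abs_measure_diff_le_mdistance[OF M])
    also have "\<dots> \<le> 2 ^ p * mdistance \<kappa> \<kappa>'"
      using \<sigma> nonneg by (intro mult_right_mono power_increasing) auto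
    also have "\<dots> \<le> 2 ^ p * (1/2) ^ (p + p + 2)" using dist by simp
    also have "\<dots> = (1/2) ^ (p + 2)" by (simp add: power_add power_divide)
    finally have "\<bar>measure \<kappa> (cylinder \<sigma>) - measure \<kappa>' (cylinder \<sigma>)\<bar> \<le> (1/2) ^ (p + 2)" .
    moreover have "length \<sigma> \<le> N" using \<sigma> by (simp add: N_def)
    note \<kappa>(2)[OF this] \<kappa>'(2)[OF this]
    moreover have "2 * (1/4) ^ N / d + 2 * (1/4) ^ N / d = 4 * (1/4::real) ^ N / d" by (simp add: field_simps)
    moreover have "(1/2::real) ^ (p + 2) + (1/2) ^ (p + 2) = (1/2) ^ Suc p" by simp
    ultimately show ?thesis using small by linarith
  qed
  moreover have "p < N" by (simp add: N_def)
  ultimately show ?thesis using N unfolding determined_iff by blast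
qed

text \<open>Compactness supplies the missing rate of convergence. Every real has an initial segment
  whose image is determined, so all strings of a suitable length contain such a segment; this length
  is found by search and depends only on \<open>p\<close>. The values \<open>v\<close> read no more
  than the first \<open>M p\<close> bits, so they do not change when the string is extended.\<close>

lemma computable_measure_map_evaluation:
  assumes "computable_measure_map f"
  obtains M :: "nat \<Rightarrow> nat" and v :: "nat \<Rightarrow> bitstring \<Rightarrow> bitstring \<Rightarrow> dyadic"
  where "effective M" "effective (\<lambda>q. v (fst q) (fst (snd q)) (snd (snd q)))"
    "\<And>p Z n \<sigma>. M p \<le> n \<Longrightarrow> length \<sigma> \<le> p \<Longrightarrow>
       \<bar>dyadic_val (v p (Z \<restriction> n) \<sigma>) - measure (f Z) (cylinder \<sigma>)\<bar> \<le> (1/2) ^ p"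
    "\<And>p \<rho> \<tau> \<sigma>. M p \<le> length \<rho> \<Longrightarrow> prefix \<rho> \<tau> \<Longrightarrow> v p \<tau> \<sigma> = v p \<rho> \<sigma>"
proof -
  obtain fs where fs: "effective fs" "\<And>Z n. f Z \<in> basic_open (fs (Z \<restriction> n))"
    "\<And>Z. (\<lambda>n. mdiameter (basic_open (fs (Z \<restriction> n)))) \<longlonglongrightarrow> 0"
    using assms unfolding computable_measure_map_def string_code_eq_enc basic_code_eq_enc effective_def by blast
  define pairs where "pairs n = concat (map (\<lambda>k. map (\<lambda>N. (k, N)) [0..<n]) [0..<n])" for n :: nat
  \<comment> \<open>Both the initial segment and the resolution are sought below the length of the
    string. This makes the search finite, while longer strings retain all successes of their
    prefixes.\<close>
  define good where "good p \<rho> = filter (\<lambda>(k, N). determined p N (fs (take k \<rho>))) (pairs (length \<rho>))" for p \<rho>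
  have eff_good: "effective (\<lambda>x. good (g x) (h x))" if "effective g" "effective h" for g :: "'x::codable \<Rightarrow> nat" and h
    unfolding good_def pairs_def
    by (intro eff that that[THEN effective_comp] fs(1)[THEN effective_comp])
  have set_pairs: "set (pairs n) = {..<n} \<times> {..<n}" for n by (auto simp: pairs_def)
  have good_iff: "good p \<rho> \<noteq> [] \<longleftrightarrow>
      (\<exists>k N. k < length \<rho> \<and> N < length \<rho> \<and> determined p N (fs (take k \<rho>)))" for p \<rho>
    by (auto simp: good_def filter_empty_conv set_pairs)
  have bar: "\<exists>N. \<forall>\<rho>. N \<le> length \<rho> \<longrightarrow> good p \<rho> \<noteq> []" for p
  proof (rule fan_theorem)
    show "good p \<tau> \<noteq> []" if "good p \<rho> \<noteq> []" "prefix \<rho> \<tau>" for \<rho> \<tau>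
    proof -
      obtain k N where "k < length \<rho>" "N < length \<rho>" "determined p N (fs (take k \<rho>))"
        using \<open>good p \<rho> \<noteq> []\<close> unfolding good_iff by blast
      moreover have "take k \<tau> = take k \<rho>" "length \<rho> \<le> length \<tau>"
        using \<open>k < length \<rho>\<close> that(2) by (auto simp: prefix_def)
      ultimately show ?thesis unfolding good_iff by (metis order.strict_trans2)
    qed
    show "\<exists>n. good p (Z \<restriction> n) \<noteq> []" for Z
    proof -
      have "\<forall>\<^sub>F n in sequentially. mdiameter (basic_open (fs (Z \<restriction> n))) < (1/2) ^ (p + p + 2)"
        using fs(3)[of Z] by (rule order_tendstoD) simp
      then obtain k where "mdiameter (basic_open (fs (Z \<restriction> k))) < (1/2) ^ (p + p + 2)"
        by (auto simp: eventually_sequentially)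
      then obtain N where "determined p N (fs (Z \<restriction> k))"
        using determined_complete[OF fs(2)] by blast
      then have "good p (Z \<restriction> Suc (k + N)) \<noteq> []"
        unfolding good_iff by - (rule exI[of _ k], rule exI[of _ N], simp add: min_def)
      then show ?thesis by blast
    qed
  qed
  define M where "M p = (LEAST N. list_all (\<lambda>\<rho>. good p \<rho> \<noteq> []) (strings N))" for p
  have ex: "\<exists>N. list_all (\<lambda>\<rho>. good p \<rho> \<noteq> []) (strings N)" for p
  proof -
    obtain N where "\<forall>\<rho>. N \<le> length \<rho> \<longrightarrow> good p \<rho> \<noteq> []" using bar by blast
    then show ?thesis by (intro exI[of _ N]) (simp add: list_all_iff)
  qed
  have M: "good p \<rho> \<noteq> []" if "length \<rho> = M p" for p \<rho>
  proof -
    have "list_all (\<lambda>\<rho>. good p \<rho> \<noteq> []) (strings (M p))" unfolding M_def by (rule LeastI_ex[OF ex])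
    then show ?thesis using that by (simp add: list_all_iff)
  qed
  have eff_M: "effective M"
    unfolding M_def by (intro eff eff_good ex)
  define w where "w p \<rho> \<sigma> = (let c = hd (good p \<rho>)
    in freq (snd c) (hd (candidates (snd c) (fs (take (fst c) \<rho>)))) \<sigma>)" for p \<rho> \<sigma>
  define v where "v p \<rho> \<sigma> = w p (take (M p) \<rho>) \<sigma>" for p \<rho> \<sigma>
  have eff_w: "effective (\<lambda>q. w (fst q) (fst (snd q)) (snd (snd q)))"
    unfolding w_def Let_def by (intro eff eff_good fs(1)[THEN effective_comp])
  show thesis
  proof (rule that[OF eff_M])
    show "effective (\<lambda>q. v (fst q) (fst (snd q)) (snd (snd q)))"
      unfolding v_def by (intro effective_comp3[OF eff_w] eff eff_M[THEN effective_comp])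
    show "\<bar>dyadic_val (v p (Z \<restriction> n) \<sigma>) - measure (f Z) (cylinder \<sigma>)\<bar> \<le> (1/2) ^ p"
      if "M p \<le> n" "length \<sigma> \<le> p" for p Z n \<sigma>
    proof -
      obtain k N where kN: "hd (good p (Z \<restriction> M p)) = (k, N)" by fastforce
      have "hd (good p (Z \<restriction> M p)) \<in> set (good p (Z \<restriction> M p))" using M[of "Z \<restriction> M p" p] by simp
      then have "k < M p" "determined p N (fs (Z \<restriction> k))"
        unfolding kN by (auto simp: good_def set_pairs min_def)
      then show ?thesis
        using determined_sound[OF _ fs(2) that(2)] that(1) by (simp add: v_def w_def kN min_def)
    qed
    show "v p \<tau> \<sigma> = v p \<rho> \<sigma>" if "M p \<le> length \<rho>" "prefix \<rho> \<tau>" for p \<rho> \<tau> \<sigma>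
      using that by (auto simp: v_def prefix_def)
  qed
qed


section \<open>A universal uniform test\<close>

section \<open>Trimming a uniform test\<close>

text \<open>The inequalities are closed on purpose. If a measure misses a margin, so do all nearby
  measures; hence the part of a finite test selected by a margin cannot grow suddenly near it, and
  smallness of its measure is an open condition. With the strict inequalities of
  \<open>basic_open\<close> this would fail.\<close>

definition margin :: "(bitstring \<Rightarrow> real) \<Rightarrow> real \<Rightarrow> basic \<Rightarrow> bool" where
  "margin g r B \<longleftrightarrow> (\<forall>(\<sigma>, l, u)\<in>set B. dyadic_val l + r \<le> g \<sigma> \<and> g \<sigma> \<le> dyadic_val u - r)"

definition dmargin :: "nat \<Rightarrow> bitstring list \<Rightarrow> dyadic \<Rightarrow> basic \<Rightarrow> bool" where
  "dmargin N xs r B \<longleftrightarrow> list_all (\<lambda>(\<sigma>, l, u).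
     \<not> dless (freq N xs \<sigma>) (dadd l r) \<and> \<not> dless u (dadd (freq N xs \<sigma>) r)) B"

definition mass :: "nat \<Rightarrow> bitstring list \<Rightarrow> bitstring list \<Rightarrow> dyadic" where
  "mass N xs T = (int (sum_list (map (\<lambda>x. length (filter (prefix x) xs)) T)), 3 * N)"

definition neighbourhood :: "nat \<Rightarrow> bitstring list \<Rightarrow> basic" where
  "neighbourhood N xs = map (\<lambda>\<sigma>. (\<sigma>, dadd (freq N xs \<sigma>) (- 2, 2 * N), dadd (freq N xs \<sigma>) (2, 2 * N)))
     (concat (map strings [0..<Suc N]))"

text \<open>
  For every measure in \<^term>\<open>basic_open (neighbourhood N xs)\<close>, the certificate guarantees that the
  cylinders in the section of \<open>L\<close>, with margin \<open>2\<^sup>-\<^sup>n\<close>, have measure less than \<open>2\<^sup>-\<^sup>k\<close>, and that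
  \<open>\<sigma>\<close> is among them.
\<close>

definition certificate :: "nat \<Rightarrow> (basic \<times> bitstring) list \<Rightarrow> nat \<Rightarrow> nat \<Rightarrow> bitstring list \<Rightarrow> bitstring \<Rightarrow> bool" where
  "certificate k L n N xs \<sigma> \<longleftrightarrow>
     length xs = 8 ^ N \<and> list_all (\<lambda>x. length x = N) xs \<and>
     list_all (\<lambda>(B, \<tau>). length \<tau> \<le> N \<and> list_all (\<lambda>(\<tau>, l, u). length \<tau> \<le> N) B) L \<and>
     list_ex (\<lambda>(B, \<tau>). \<tau> = \<sigma> \<and> dmargin N xs (dadd (1, n) (2, 2 * N)) B) L \<and>
     dless (dadd (mass N xs (filter (\<lambda>x.
       list_ex (\<lambda>(B, \<tau>). dmargin N xs (dadd (1, n) (- 2, 2 * N)) B \<and> prefix \<tau> x) L) (strings N))) (2, N)) (1, k)"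

lemma effective_dmargin[eff]:
  assumes "effective a" "effective b" "effective c" "effective d"
  shows "effective (\<lambda>x. dmargin (a x) (b x) (c x) (d x))"
  unfolding dmargin_def by (intro eff assms assms[THEN effective_comp])

lemma effective_mass[eff]:
  assumes "effective a" "effective b" "effective c"
  shows "effective (\<lambda>x. mass (a x) (b x) (c x))"
  unfolding mass_def by (intro eff assms assms[THEN effective_comp])

lemma effective_neighbourhood[eff]:
  assumes "effective a" "effective b"
  shows "effective (\<lambda>x. neighbourhood (a x) (b x))"
  unfolding neighbourhood_def by (intro eff assms assms[THEN effective_comp])

lemma effective_certificate[eff]:
  assumes "effective a" "effective b" "effective c" "effective d" "effective e" "effective f"
  shows "effective (\<lambda>x. certificate (a x) (b x) (c x) (d x) (e x) (f x))"
  unfolding certificate_def by (intro eff assms assms[THEN effective_comp])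

lemma dmargin_iff: "dmargin N xs r B \<longleftrightarrow> margin (\<lambda>\<sigma>. dyadic_val (freq N xs \<sigma>)) (dyadic_val r) B"
  by (auto simp: dmargin_def margin_def list_all_iff not_less algebra_simps)

lemma margin_transfer:
  assumes "margin g r B" "\<forall>(\<sigma>, l, u)\<in>set B. length \<sigma> \<le> N"
    and "\<And>\<sigma>. length \<sigma> \<le> N \<Longrightarrow> \<bar>g \<sigma> - h \<sigma>\<bar> \<le> e" and "s + e \<le> r"
  shows "margin h s B"
  unfolding margin_def
proof clarify
  fix \<sigma> l u assume B: "(\<sigma>, l, u) \<in> set B"
  then have "length \<sigma> \<le> N" using assms(2) by auto
  from assms(3)[OF this] have "\<bar>g \<sigma> - h \<sigma>\<bar> \<le> e" .
  moreover have "dyadic_val l + r \<le> g \<sigma>" "g \<sigma> \<le> dyadic_val u - r"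
    using assms(1) B unfolding margin_def by auto
  ultimately show "dyadic_val l + s \<le> h \<sigma> \<and> h \<sigma> \<le> dyadic_val u - s"
    using assms(4) by linarith
qed

lemma margin_mono: "margin g r B \<Longrightarrow> s \<le> r \<Longrightarrow> margin g s B"
  unfolding margin_def by force

lemma margin_basic_open:
  assumes "\<mu> \<in> \<M>" "margin (\<lambda>\<sigma>. measure \<mu> (cylinder \<sigma>)) r B" "r > 0"
  shows "\<mu> \<in> basic_open B"
  using assms unfolding basic_open_iff margin_def by fastforce

lemma basic_open_margin:
  assumes "\<mu> \<in> basic_open B"
  shows "\<forall>\<^sub>F n in sequentially. margin (\<lambda>\<sigma>. measure \<mu> (cylinder \<sigma>)) (2 * (1/2) ^ n) B"
  unfolding margin_def
proof (intro eventually_ball_finite ballI)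
  fix b assume b: "b \<in> set B"
  obtain \<sigma> l u where \<sigma>: "b = (\<sigma>, l, u)" by (metis prod_cases3)
  define d where "d = min (measure \<mu> (cylinder \<sigma>) - dyadic_val l) (dyadic_val u - measure \<mu> (cylinder \<sigma>))"
  have "d > 0" using assms b by (auto simp: d_def basic_open_iff \<sigma>)
  have "(\<lambda>n. (1/2::real) ^ n) \<longlonglongrightarrow> 0" by (rule LIMSEQ_power_zero) simp
  from tendsto_mult_left[OF this, of 2] have "(\<lambda>n. 2 * (1/2::real) ^ n) \<longlonglongrightarrow> 0" by simp
  then have "\<forall>\<^sub>F n in sequentially. 2 * (1/2::real) ^ n < d" using \<open>d > 0\<close> by (rule order_tendstoD)
  then show "\<forall>\<^sub>F n in sequentially. case b of (\<sigma>, l, u) \<Rightarrow>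
      dyadic_val l + 2 * (1/2) ^ n \<le> measure \<mu> (cylinder \<sigma>) \<and>
      measure \<mu> (cylinder \<sigma>) \<le> dyadic_val u - 2 * (1/2) ^ n"
    unfolding \<sigma> case_prod_conv by eventually_elim (simp add: d_def)
qed simp

lemma not_margin_nearby:
  assumes "\<not> margin g r B"
  shows "\<forall>\<^sub>F N in sequentially. \<not> margin g (r - 3 * (1/4) ^ N) B"
proof -
  obtain b where b: "b \<in> set B" "\<not> (case b of (\<sigma>, l, u) \<Rightarrow> dyadic_val l + r \<le> g \<sigma> \<and> g \<sigma> \<le> dyadic_val u - r)"
    using assms unfolding margin_def by blast
  obtain \<sigma> l u where "b = (\<sigma>, l, u)" by (rule prod_cases3)
  with b have B: "(\<sigma>, l, u) \<in> set B" and out: "\<not> (dyadic_val l + r \<le> g \<sigma> \<and> g \<sigma> \<le> dyadic_val u - r)"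
    by simp_all
  define d where "d = max (dyadic_val l + r - g \<sigma>) (g \<sigma> - dyadic_val u + r)"
  have "d > 0" using out unfolding d_def by linarith
  have "(\<lambda>n. (1/4::real) ^ n) \<longlonglongrightarrow> 0" by (rule LIMSEQ_power_zero) simp
  from tendsto_mult_left[OF this, of 3] have "(\<lambda>n. 3 * (1/4::real) ^ n) \<longlonglongrightarrow> 0" by simp
  then have "\<forall>\<^sub>F n in sequentially. 3 * (1/4::real) ^ n < d" using \<open>d > 0\<close> by (rule order_tendstoD)
  then show ?thesis
  proof eventually_elim
    case (elim N)
    then have "\<not> (dyadic_val l + (r - 3 * (1/4) ^ N) \<le> g \<sigma> \<and> g \<sigma> \<le> dyadic_val u - (r - 3 * (1/4) ^ N))"
      unfolding d_def by linarith
    with B show ?case unfolding margin_def by blast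
  qed
qed

lemma mass_approx:
  assumes "\<mu> \<in> \<M>" "distinct T" "\<And>x. x \<in> set T \<Longrightarrow> length x = N"
    and "\<And>\<sigma>. length \<sigma> \<le> N \<Longrightarrow> \<bar>dyadic_val (freq N xs \<sigma>) - measure \<mu> (cylinder \<sigma>)\<bar> \<le> r"
  shows "\<bar>dyadic_val (mass N xs T) - measure \<mu> (\<Union>x\<in>set T. cylinder x)\<bar> \<le> 2 ^ N * r"
proof -
  have "r \<ge> 0" using assms(4)[of "[]"] by simp
  have "(2::real) ^ (3 * N) = 8 ^ N" by (simp add: power_mult)
  then have "dyadic_val (mass N xs T) = (\<Sum>x\<in>set T. dyadic_val (freq N xs x))"
    using assms(2) by (simp add: mass_def dyadic_val_freq dyadic_val_Pair sum_list_distinct_conv_sum_set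
        sum_divide_distrib)
  moreover have "measure \<mu> (\<Union>x\<in>set T. cylinder x) = (\<Sum>x\<in>set T. measure \<mu> (cylinder x))"
    using assms by (intro measure_UN_cylinder[of _ _ N])
  ultimately have "\<bar>dyadic_val (mass N xs T) - measure \<mu> (\<Union>x\<in>set T. cylinder x)\<bar> =
      \<bar>\<Sum>x\<in>set T. dyadic_val (freq N xs x) - measure \<mu> (cylinder x)\<bar>"
    by (simp add: sum_subtractf)
  also have "\<dots> \<le> (\<Sum>x\<in>set T. \<bar>dyadic_val (freq N xs x) - measure \<mu> (cylinder x)\<bar>)" by (rule sum_abs)
  also have "\<dots> \<le> (\<Sum>x\<in>set T. r)" using assms(3,4) by (intro sum_mono) auto
  also have "\<dots> = card (set T) * r" by simp
  also have "\<dots> \<le> 2 ^ N * r"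
  proof (rule mult_right_mono[OF _ \<open>r \<ge> 0\<close>])
    have "set T \<subseteq> set (strings N)" using assms(3) by auto
    then have "card (set T) \<le> 2 ^ N"
      using card_mono[of "set (strings N)" "set T"] distinct_card[OF distinct_strings[of N]]
      by (simp add: length_strings finite_strings)
    then show "real (card (set T)) \<le> 2 ^ N" by (metis of_nat_le_iff of_nat_numeral of_nat_power)
  qed
  finally show ?thesis .
qed

lemma neighbourhood_iff:
  "\<mu> \<in> basic_open (neighbourhood N xs) \<longleftrightarrow> \<mu> \<in> \<M> \<and>
    (\<forall>\<sigma>. length \<sigma> \<le> N \<longrightarrow> \<bar>dyadic_val (freq N xs \<sigma>) - measure \<mu> (cylinder \<sigma>)\<bar> < 2 * (1/4) ^ N)"
proof -
  have "set (concat (map strings [0..<Suc N])) = {\<sigma>. length \<sigma> \<le> N}"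
    by (auto simp: less_Suc_eq_le simp del: upt_Suc)
  moreover have "(\<forall>(\<sigma>, l, u)\<in>(\<lambda>\<sigma>. (\<sigma>, l' \<sigma>, u' \<sigma>)) ` A. Q \<sigma> l u) \<longleftrightarrow> (\<forall>\<sigma>\<in>A. Q \<sigma> (l' \<sigma>) (u' \<sigma>))"
    for l' u' :: "bitstring \<Rightarrow> dyadic" and A Q by auto
  moreover have "\<bar>a - b\<bar> < 2 * c \<longleftrightarrow> a + - 2 * c < b \<and> b < a + 2 * c" for a b c :: real
    by linarith
  ultimately show ?thesis unfolding basic_open_iff neighbourhood_def set_map
    by (simp only: dyadic_val_dadd dyadic_val_slack Ball_def mem_Collect_eq)
qed

definition section_upto :: "cantor measure \<Rightarrow> (basic \<times> bitstring) list \<Rightarrow> nat \<Rightarrow> cantor set" where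
  "section_upto \<mu> L n = (\<Union>(B, \<tau>)\<in>{(B, \<tau>)\<in>set L. margin (\<lambda>\<sigma>. measure \<mu> (cylinder \<sigma>)) ((1/2) ^ n) B}. cylinder \<tau>)"

text \<open>Measures in the neighbourhood differ from the rounded one by less than 2 * 4^-N on each
  string of length at most \<open>N\<close>. So \<open>\<sigma>\<close> is tested with the margin
  raised by this amount, which yields the true margin, and the strings to be weighed are selected
  with the margin lowered by it, which omits none. The reserve \<open>(2, N)\<close>, that is 2 *
  2^-N, covers the error of weighing up to 2^N strings.\<close>

lemma certificate_sound:
  assumes c: "certificate k L n N xs \<sigma>" and \<mu>: "\<mu> \<in> basic_open (neighbourhood N xs)"
  shows "measure \<mu> (section_upto \<mu> L n) < (1/2) ^ k" "cylinder \<sigma> \<subseteq> section_upto \<mu> L n"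
proof -
  let ?g = "\<lambda>\<sigma>. dyadic_val (freq N xs \<sigma>)" and ?m = "\<lambda>\<sigma>. measure \<mu> (cylinder \<sigma>)"
  have \<mu>M: "\<mu> \<in> \<M>" and near: "\<And>\<sigma>. length \<sigma> \<le> N \<Longrightarrow> \<bar>?g \<sigma> - ?m \<sigma>\<bar> \<le> 2 * (1/4) ^ N"
    using \<mu> unfolding neighbourhood_iff by (auto simp: less_imp_le)
  then have near': "\<And>\<sigma>. length \<sigma> \<le> N \<Longrightarrow> \<bar>?m \<sigma> - ?g \<sigma>\<bar> \<le> 2 * (1/4) ^ N" by (metis abs_minus_commute)
  interpret prob_space \<mu> using \<mu>M by (simp add: measures_iff)
  have fit: "\<And>B \<tau>. (B, \<tau>) \<in> set L \<Longrightarrow> length \<tau> \<le> N \<and> (\<forall>(\<tau>, l, u)\<in>set B. length \<tau> \<le> N)"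
    using c unfolding certificate_def list_all_iff by fastforce
  obtain B where B: "(B, \<sigma>) \<in> set L" "margin ?g ((1/2) ^ n + 2 * (1/4) ^ N) B"
    using c by (auto simp: certificate_def list_ex_iff dmargin_iff dyadic_val_inverse_power dyadic_val_slack)
  have "margin ?m ((1/2) ^ n) B"
    by (rule margin_transfer[OF B(2) _ near]) (use fit[OF B(1)] in auto)
  with B(1) show "cylinder \<sigma> \<subseteq> section_upto \<mu> L n" unfolding section_upto_def by blast
  define T where "T = filter (\<lambda>x. list_ex (\<lambda>(B, \<tau>). dmargin N xs (dadd (1, n) (- 2, 2 * N)) B \<and> prefix \<tau> x) L) (strings N)"
  have "section_upto \<mu> L n \<subseteq> (\<Union>x\<in>set T. cylinder x)"
  proof
    fix X assume "X \<in> section_upto \<mu> L n"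
    then obtain B \<tau> where B: "(B, \<tau>) \<in> set L" "margin ?m ((1/2) ^ n) B" "X \<in> cylinder \<tau>"
      unfolding section_upto_def by blast
    have "margin ?g ((1/2) ^ n - 2 * (1/4) ^ N) B"
      by (rule margin_transfer[OF B(2) _ near']) (use fit[OF B(1)] in auto)
    then have "dmargin N xs (dadd (1, n) (- 2, 2 * N)) B"
      by (simp add: dmargin_iff dyadic_val_inverse_power dyadic_val_slack)
    moreover have "prefix \<tau> (X \<restriction> N)" using B fit[OF B(1)] by (simp add: prefix_initial_iff)
    ultimately have "X \<restriction> N \<in> set T" using B(1) unfolding T_def list_ex_iff by auto
    then show "X \<in> (\<Union>x\<in>set T. cylinder x)" by (rule UN_I) simp
  qed
  then have "measure \<mu> (section_upto \<mu> L n) \<le> measure \<mu> (\<Union>x\<in>set T. cylinder x)"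
    using \<mu>M by (intro finite_measure_mono) (auto simp: measures_iff)
  also have "\<dots> \<le> dyadic_val (mass N xs T) + 2 ^ N * (2 * (1/4) ^ N)"
    using mass_approx[OF \<mu>M _ _ near, of T] by (fastforce simp: T_def distinct_strings)
  also have "(2::real) ^ N * (2 * (1/4) ^ N) = dyadic_val (2, N)"
    by (simp add: dyadic_val_def power_divide power_mult_distrib[symmetric] flip: power_mult_distrib)
      (simp add: field_simps flip: power_mult_distrib)
  also have "dyadic_val (mass N xs T) + dyadic_val (2, N) < (1/2) ^ k"
    using c by (simp add: certificate_def T_def dyadic_val_inverse_power)
  finally show "measure \<mu> (section_upto \<mu> L n) < (1/2) ^ k" .
qed

text \<open>The condition paired with \<open>\<sigma>\<close> holds with twice the margin of the
  section; the difference 2^-n absorbs the rounding. At fine enough resolution the rounded selection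
  lies inside the true section, because the finitely many conditions that miss the margin also miss
  slightly smaller ones.\<close>

lemma certificate_complete:
  assumes \<mu>M: "\<mu> \<in> \<M>" and small: "measure \<mu> (section_upto \<mu> L n) < (1/2) ^ k"
    and B: "(B, \<sigma>) \<in> set L" "margin (\<lambda>\<sigma>. measure \<mu> (cylinder \<sigma>)) (2 * (1/2) ^ n) B"
  shows "\<exists>N xs. certificate k L n N xs \<sigma> \<and> \<mu> \<in> basic_open (neighbourhood N xs)"
proof -
  let ?m = "\<lambda>\<sigma>. measure \<mu> (cylinder \<sigma>)"
  interpret prob_space \<mu> using \<mu>M by (simp add: measures_iff)
  define N\<^sub>0 where "N\<^sub>0 = Max (insert 0 (length ` (snd ` set L \<union> (\<Union>b\<in>set L. fst ` set (fst b)))))"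
  have N\<^sub>0: "length \<tau> \<le> N\<^sub>0 \<and> (\<forall>(\<tau>, l, u)\<in>set B. length \<tau> \<le> N\<^sub>0)" if "(B, \<tau>) \<in> set L" for B \<tau>
  proof -
    have fin: "finite (insert 0 (length ` (snd ` set L \<union> (\<Union>b\<in>set L. fst ` set (fst b)))))" by auto
    show ?thesis using that unfolding N\<^sub>0_def by (intro conjI ballI; force intro!: Max_ge[OF fin])
  qed
  have lim: "(\<lambda>n. c * (1/2::real) ^ n) \<longlonglongrightarrow> 0" "(\<lambda>n. c * (1/4::real) ^ n) \<longlonglongrightarrow> 0" for c
    using tendsto_mult_left[OF LIMSEQ_power_zero[of "1/2::real"], of c]
      tendsto_mult_left[OF LIMSEQ_power_zero[of "1/4::real"], of c] by simp_all
  \<comment> \<open>Of the three parts 2^-N, one is the rounding error of the mass of up to 2^N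
    strings and two are the reserve in the certificate. The next bound splits alike: 4^-N for
    rounding a value and 2 * 4^-N for the raised margin.\<close>
  have 1: "\<forall>\<^sub>F N in sequentially. 3 * (1/2::real) ^ N < (1/2) ^ k - measure \<mu> (section_upto \<mu> L n)"
    by (rule order_tendstoD(2)[OF lim(1)]) (use small in simp)
  have 2: "\<forall>\<^sub>F N in sequentially. 3 * (1/4::real) ^ N < (1/2) ^ n"
    by (rule order_tendstoD(2)[OF lim(2)]) simp
  have 3: "\<forall>\<^sub>F N in sequentially. \<forall>(B, \<tau>)\<in>set L.
      \<not> margin ?m ((1/2) ^ n) B \<longrightarrow> \<not> margin ?m ((1/2) ^ n - 3 * (1/4) ^ N) B"
  proof (intro eventually_ball_finite ballI)
    fix b assume "b \<in> set L"
    show "\<forall>\<^sub>F N in sequentially. case b of (B, \<tau>) \<Rightarrow>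
        \<not> margin ?m ((1/2) ^ n) B \<longrightarrow> \<not> margin ?m ((1/2) ^ n - 3 * (1/4) ^ N) B"
    proof (cases b)
      case (Pair B \<tau>)
      show ?thesis using not_margin_nearby[of ?m "(1/2) ^ n" B] by (cases "margin ?m ((1/2) ^ n) B") (auto simp: Pair)
    qed
  qed simp
  from 1 2 3 eventually_ge_at_top[of N\<^sub>0] have "\<forall>\<^sub>F N in sequentially.
      3 * (1/2::real) ^ N < (1/2) ^ k - measure \<mu> (section_upto \<mu> L n) \<and> 3 * (1/4::real) ^ N < (1/2) ^ n \<and>
      (\<forall>(B, \<tau>)\<in>set L. \<not> margin ?m ((1/2) ^ n) B \<longrightarrow> \<not> margin ?m ((1/2) ^ n - 3 * (1/4) ^ N) B) \<and> N\<^sub>0 \<le> N"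
    by eventually_elim blast
  then obtain N where N: "3 * (1/2::real) ^ N < (1/2) ^ k - measure \<mu> (section_upto \<mu> L n)"
    "3 * (1/4::real) ^ N < (1/2) ^ n" "N\<^sub>0 \<le> N"
    and sep: "\<forall>(B, \<tau>)\<in>set L. \<not> margin ?m ((1/2) ^ n) B \<longrightarrow> \<not> margin ?m ((1/2) ^ n - 3 * (1/4) ^ N) B"
    using eventually_happens'[OF sequentially_bot] by (metis (no_types, lifting))
  obtain xs where xs: "xs \<in> set (grid N)"
    and near: "\<And>\<sigma>. length \<sigma> \<le> N \<Longrightarrow> \<bar>dyadic_val (freq N xs \<sigma>) - ?m \<sigma>\<bar> \<le> (1/4) ^ N"
    using grid_approx[OF \<mu>M] by metis
  let ?g = "\<lambda>\<sigma>. dyadic_val (freq N xs \<sigma>)"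
  have near': "\<And>\<sigma>. length \<sigma> \<le> N \<Longrightarrow> \<bar>?m \<sigma> - ?g \<sigma>\<bar> \<le> (1/4) ^ N" using near by (metis abs_minus_commute)
  have fit: "length \<tau> \<le> N \<and> (\<forall>(\<tau>, l, u)\<in>set B. length \<tau> \<le> N)" if "(B, \<tau>) \<in> set L" for B \<tau>
    using N\<^sub>0[OF that] N(3) by fastforce
  define T where "T = filter (\<lambda>x. list_ex (\<lambda>(B, \<tau>). dmargin N xs (dadd (1, n) (- 2, 2 * N)) B \<and> prefix \<tau> x) L) (strings N)"
  have "(\<Union>x\<in>set T. cylinder x) \<subseteq> section_upto \<mu> L n"
  proof
    fix X assume "X \<in> (\<Union>x\<in>set T. cylinder x)"
    then obtain x where x: "x \<in> set T" "X \<in> cylinder x" by blast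
    then have X: "X \<restriction> N = x" by (auto simp: T_def cylinder_def)
    from x obtain B \<tau> where B: "(B, \<tau>) \<in> set L" "margin ?g ((1/2) ^ n - 2 * (1/4) ^ N) B" "prefix \<tau> x"
      by (auto simp: T_def list_ex_iff dmargin_iff dyadic_val_inverse_power dyadic_val_slack)
    have "margin ?m ((1/2) ^ n - 3 * (1/4) ^ N) B"
      by (rule margin_transfer[OF B(2) _ near]) (use fit[OF B(1)] in auto)
    then have "margin ?m ((1/2) ^ n) B" using sep B(1) by blast
    moreover have "X \<in> cylinder \<tau>" using B(3) X prefix_initial_iff by blast
    ultimately show "X \<in> section_upto \<mu> L n" using B(1) unfolding section_upto_def by blast
  qed
  moreover have "section_upto \<mu> L n \<in> sets borel"
    unfolding section_upto_def by (intro borel_open open_UN ballI) (auto simp: open_cylinder)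
  ultimately have "measure \<mu> (\<Union>x\<in>set T. cylinder x) \<le> measure \<mu> (section_upto \<mu> L n)"
    using \<mu>M by (intro finite_measure_mono) (auto simp: measures_iff)
  moreover have "\<bar>dyadic_val (mass N xs T) - measure \<mu> (\<Union>x\<in>set T. cylinder x)\<bar> \<le> 2 ^ N * (1/4) ^ N"
    by (rule mass_approx[OF \<mu>M _ _ near]) (auto simp: T_def distinct_strings)
  moreover have "(2::real) ^ N * (1/4) ^ N = (1/2) ^ N" by (simp flip: power_mult_distrib)
  moreover have "dyadic_val (2, N) = 2 * (1/2) ^ N" by (simp add: dyadic_val_def power_divide)
  ultimately have "dyadic_val (mass N xs T) + dyadic_val (2, N) < (1/2) ^ k" using N(1) by linarith
  moreover have "margin ?g ((1/2) ^ n + 2 * (1/4) ^ N) B"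
    by (rule margin_transfer[OF B(2) _ near']) (use fit[OF B(1)] N(2) in auto)
  moreover have "list_all (\<lambda>(B, \<tau>). length \<tau> \<le> N \<and> list_all (\<lambda>(\<tau>, l, u). length \<tau> \<le> N) B) L"
    unfolding list_all_iff using fit by blast
  ultimately have "certificate k L n N xs \<sigma>"
    using xs B(1) unfolding certificate_def T_def[symmetric]
    by (auto simp: list_all_iff list_ex_iff set_grid dmargin_iff dyadic_val_inverse_power dyadic_val_slack)
  moreover have "\<mu> \<in> basic_open (neighbourhood N xs)"
  proof -
    have "(1/4::real) ^ N < 2 * (1/4) ^ N" by simp
    then show ?thesis unfolding neighbourhood_iff using \<mu>M near le_less_trans by blast
  qed
  ultimately show ?thesis by blast
qed


section \<open>Existence of a uniform deficiency\<close>

lemma partial_computable2_comp: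
  assumes "partial_computable2 p" "computable g" "computable h"
  shows "partial_computable2 (\<lambda>e y. p (g y) (h y))"
proof -
  obtain r rg rh where "\<And>x y. eval r [x, y] = p x y" "\<And>x. eval rg [x] = Some (g x)" "\<And>x. eval rh [x] = Some (h x)"
    using assms unfolding partial_computable2_def computable_def partial_computable_def by blast
  then have "eval (Comp r [Comp rg [Proj 1], Comp rh [Proj 1]]) [e, y] = p (g y) (h y)" for e y
    by simp
  then show ?thesis unfolding partial_computable2_def by blast
qed

lemma section_upto_mono:
  assumes "set L \<subseteq> set L'" "n \<le> n'"
  shows "section_upto \<mu> L n \<subseteq> section_upto \<mu> L' n'"
proof -
  have "(1/2::real) ^ n' \<le> (1/2) ^ n" using assms(2) by (intro power_decreasing) auto
  then show ?thesis using assms(1) margin_mono unfolding section_upto_def by blast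
qed

lemma sets_section_upto[simp]: "section_upto \<mu> L n \<in> sets borel"
  unfolding section_upto_def by (intro borel_open open_UN ballI) (auto simp: open_cylinder)

lemma code_pair_eq_enc: "(\<lambda>(B, \<sigma>). prod_encode (basic_code B, string_code \<sigma>)) = enc"
  by (rule ext) (simp add: enc_prod_def string_code_eq_enc basic_code_eq_enc split: prod.splits)

text \<open>\<open>E n\<close> is the finite part of a candidate test known at stage
  \<open>n\<close>. The stage also fixes the margin 2^-n, so sections grow with the stage in both
  respects.\<close>

definition trimmed :: "nat \<Rightarrow> (nat \<Rightarrow> (basic \<times> bitstring) list) \<Rightarrow> (basic \<times> bitstring) set" where
  "trimmed k E = {(neighbourhood N xs, \<sigma>) | N xs \<sigma>. \<exists>n. certificate k (E n) n N xs \<sigma>}"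

definition test_section :: "(basic \<times> bitstring) set \<Rightarrow> cantor measure \<Rightarrow> cantor set" where
  "test_section W \<mu> = (\<Union>(B, \<sigma>)\<in>{(B, \<sigma>)\<in>W. \<mu> \<in> basic_open B}. cylinder \<sigma>)"

lemma sets_test_section[simp]: "test_section W \<mu> \<in> sets borel"
  unfolding test_section_def by (intro borel_open open_UN ballI) (auto simp: open_cylinder)

lemma mem_test_section: "X \<in> test_section W \<mu> \<longleftrightarrow> (\<exists>(B, \<sigma>)\<in>W. \<mu> \<in> basic_open B \<and> X \<in> cylinder \<sigma>)"
  unfolding test_section_def by auto

text \<open>Only stages whose section has measure below 2^-k contribute. Since sections grow with
  the stage, the union up to any stage is contained in a single contributing section, and passing to
  the limit keeps the bound, though no longer strictly.\<close>

lemma measure_trimmed_le: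
  assumes \<mu>: "\<mu> \<in> \<M>" and mono: "\<And>n n'. n \<le> n' \<Longrightarrow> set (E n) \<subseteq> set (E n')"
  shows "measure \<mu> (test_section (trimmed k E) \<mu>) \<le> (1/2) ^ k"
proof -
  interpret prob_space \<mu> using \<mu> by (simp add: measures_iff)
  have sets: "sets \<mu> = sets borel" using \<mu> by (simp add: measures_iff)
  let ?K = "\<lambda>n. section_upto \<mu> (E n) n"
  define G where "G = {n. measure \<mu> (?K n) < (1/2) ^ k}"
  define A where "A n = (\<Union>i\<in>{i\<in>G. i \<le> n}. ?K i)" for n
  have A: "A n \<in> sets \<mu>" for n unfolding A_def sets by (intro sets.countable_UN') auto
  have "measure \<mu> (A n) \<le> (1/2) ^ k" for n
  proof (cases "{i\<in>G. i \<le> n} = {}")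
    case False
    define j where "j = Max {i\<in>G. i \<le> n}"
    have "j \<in> {i\<in>G. i \<le> n}" unfolding j_def using False by (intro Max_in) auto
    moreover have "A n \<subseteq> ?K j"
      unfolding A_def j_def by (intro UN_least section_upto_mono mono Max_ge) auto
    then have "measure \<mu> (A n) \<le> measure \<mu> (?K j)" by (intro finite_measure_mono) (auto simp: sets)
    ultimately show ?thesis by (simp add: G_def)
  next
    case True
    then have "A n = {}" unfolding A_def by blast
    then show ?thesis by simp
  qed
  moreover have "(\<lambda>n. measure \<mu> (A n)) \<longlonglongrightarrow> measure \<mu> (\<Union>n. A n)"
    using A by (intro finite_Lim_measure_incseq) (auto simp: incseq_def A_def)
  ultimately have "measure \<mu> (\<Union>n. A n) \<le> (1/2) ^ k" by (meson LIMSEQ_le_const2)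
  moreover have sub: "test_section (trimmed k E) \<mu> \<subseteq> (\<Union>n. A n)"
  proof
    fix X assume "X \<in> test_section (trimmed k E) \<mu>"
    then obtain n N xs \<sigma> where c: "certificate k (E n) n N xs \<sigma>" "\<mu> \<in> basic_open (neighbourhood N xs)" "X \<in> cylinder \<sigma>"
      unfolding mem_test_section trimmed_def by blast
    then have "n \<in> G" "X \<in> ?K n" using certificate_sound[OF c(1,2)] by (auto simp: G_def)
    then show "X \<in> (\<Union>n. A n)" unfolding A_def by blast
  qed
  have "measure \<mu> (test_section (trimmed k E) \<mu>) \<le> measure \<mu> (\<Union>n. A n)"
    using A sub by (intro finite_measure_mono) auto
  ultimately show ?thesis by linarith
qed

text \<open>If the whole section at \<open>\<mu>\<close> is small, so is every finite stage of it
  with margin. Each pair valid at \<open>\<mu>\<close> is then certified at a stage that has listed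
  it and at which its condition holds with margin 2 * 2^-n.\<close>

lemma test_section_trimmed:
  assumes \<mu>: "\<mu> \<in> \<M>" and mono: "\<And>n n'. n \<le> n' \<Longrightarrow> set (E n) \<subseteq> set (E n')"
    and small: "measure \<mu> (test_section (\<Union>n. set (E n)) \<mu>) < (1/2) ^ k"
  shows "test_section (\<Union>n. set (E n)) \<mu> \<subseteq> test_section (trimmed k E) \<mu>"
proof
  interpret prob_space \<mu> using \<mu> by (simp add: measures_iff)
  have sets: "sets \<mu> = sets borel" using \<mu> by (simp add: measures_iff)
  fix X assume "X \<in> test_section (\<Union>n. set (E n)) \<mu>"
  then obtain j B \<sigma> where B: "(B, \<sigma>) \<in> set (E j)" "\<mu> \<in> basic_open B" "X \<in> cylinder \<sigma>"
    unfolding mem_test_section by blast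
  obtain n where n: "margin (\<lambda>\<sigma>. measure \<mu> (cylinder \<sigma>)) (2 * (1/2) ^ n) B" "j \<le> n"
    using eventually_happens'[OF sequentially_bot eventually_conj[OF basic_open_margin[OF B(2)] eventually_ge_at_top[of j]]]
    by blast
  have "section_upto \<mu> (E n) n \<subseteq> test_section (\<Union>n. set (E n)) \<mu>"
  proof
    fix Y assume "Y \<in> section_upto \<mu> (E n) n"
    then obtain C \<tau> where C: "(C, \<tau>) \<in> set (E n)" "margin (\<lambda>\<sigma>. measure \<mu> (cylinder \<sigma>)) ((1/2) ^ n) C" "Y \<in> cylinder \<tau>"
      unfolding section_upto_def by blast
    have "\<mu> \<in> basic_open C" by (rule margin_basic_open[OF \<mu> C(2)]) simp
    with C show "Y \<in> test_section (\<Union>n. set (E n)) \<mu>" unfolding mem_test_section by blast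
  qed
  then have "measure \<mu> (section_upto \<mu> (E n) n) \<le> measure \<mu> (test_section (\<Union>n. set (E n)) \<mu>)"
    by (intro finite_measure_mono) (auto simp: sets)
  then have "measure \<mu> (section_upto \<mu> (E n) n) < (1/2) ^ k" using small by linarith
  moreover have "(B, \<sigma>) \<in> set (E n)" using B(1) mono[OF n(2)] by blast
  ultimately obtain N xs where "certificate k (E n) n N xs \<sigma>" "\<mu> \<in> basic_open (neighbourhood N xs)"
    using certificate_complete[OF \<mu>] n(1) by blast
  then show "X \<in> test_section (trimmed k E) \<mu>"
    using B(3) unfolding mem_test_section trimmed_def by blast
qed

lemma measure_UN_geometric_le:
  assumes "\<mu> \<in> \<M>" "\<And>i. A i \<in> sets borel" "\<And>i. measure \<mu> (A i) \<le> (1/2) ^ (k + i + 1)"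
  shows "measure \<mu> (\<Union>i. A i) \<le> (1/2) ^ k"
proof -
  interpret prob_space \<mu> using assms(1) by (simp add: measures_iff)
  have sets: "sets \<mu> = sets borel" using assms(1) by (simp add: measures_iff)
  have "(\<lambda>i. (1/2::real) ^ i) sums 2" using geometric_sums[of "1/2::real"] by simp
  from sums_mult[OF this, of "(1/2) ^ (k + 1)"]
  have s: "(\<lambda>i. (1/2::real) ^ (k + i + 1)) sums (1/2) ^ k" by (simp add: power_add mult_ac)
  have sm: "summable (\<lambda>i. measure \<mu> (A i))"
    using assms(3) by (intro summable_comparison_test'[OF sums_summable[OF s], of 0]) auto
  have "measure \<mu> (\<Union>i. A i) \<le> (\<Sum>i. measure \<mu> (A i))"
    using assms(2) sm by (intro finite_measure_subadditive_countably) (auto simp: sets)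
  also have "\<dots> \<le> (\<Sum>i. (1/2) ^ (k + i + 1))"
    using sm s assms(3) by (intro suminf_le) (auto simp: sums_iff)
  also have "\<dots> = (1/2) ^ k" using s by (simp add: sums_iff)
  finally show ?thesis .
qed

lemma uniform_test_iff:
  "uniform_test d \<longleftrightarrow>
    (\<exists>W. uniformly_ce (\<lambda>k. enc ` W k) \<and> (\<forall>k. \<forall>\<mu>\<in>\<M>. {X. d \<mu> X > enat k} = test_section (W k) \<mu>)) \<and>
    (\<forall>\<mu>\<in>\<M>. \<forall>k. measure \<mu> {X. d \<mu> X > enat k} < (1/2) ^ k)"
proof -
  have "{(\<mu>, X). \<mu> \<in> \<M> \<and> d \<mu> X > enat k} = (\<Union>(B, \<sigma>)\<in>W k. basic_open B \<times> cylinder \<sigma>) \<longleftrightarrow>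
      (\<forall>\<mu>\<in>\<M>. {X. d \<mu> X > enat k} = test_section (W k) \<mu>)" (is "?l = ?r \<longleftrightarrow> _")
    for k and W :: "nat \<Rightarrow> (basic \<times> bitstring) set"
  proof -
    have "(\<mu>, X) \<in> ?r \<longleftrightarrow> \<mu> \<in> \<M> \<and> X \<in> test_section (W k) \<mu>" for \<mu> X
    proof -
      have "B \<in> basic_open C \<Longrightarrow> B \<in> \<M>" for B C by (simp add: basic_open_iff)
      then show ?thesis unfolding mem_test_section by auto
    qed
    then have "?r = {(\<mu>, X). \<mu> \<in> \<M> \<and> X \<in> test_section (W k) \<mu>}" by auto
    then show ?thesis by auto
  qed
  then show ?thesis unfolding uniform_test_def code_pair_eq_enc by simp
qed

text \<open>Every index \<open>e\<close> is read as a candidate test: the pair decoded from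
  \<open>x\<close> belongs to level \<open>k\<close> if the function with index \<open>e\<close> is
  defined at the code of \<open>(k, x)\<close>. Since every number decodes, each index yields some
  family of levels.\<close>

definition listed :: "(nat \<Rightarrow> nat \<Rightarrow> nat \<Rightarrow> nat option) \<Rightarrow> nat \<Rightarrow> nat \<Rightarrow> nat \<Rightarrow> (basic \<times> bitstring) list" where
  "listed st e k n = map dec (filter (\<lambda>x. st n e (prod_encode (k, x)) \<noteq> None) [0..<n])"

lemma effective_listed:
  assumes "effective (\<lambda>q. st (fst q) (fst (snd q)) (snd (snd q)))" "effective a" "effective b" "effective c"
  shows "effective (\<lambda>x. listed st (a x) (b x) (c x))"
  unfolding listed_def
  by (intro eff effective_comp3[OF assms(1)] assms(2-) assms(2-)[THEN effective_comp])

text \<open>All candidate tests are trimmed and merged, the candidate with index \<open>e\<close>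
  entering level \<open>k\<close> from its levels \<open>k + e + 3\<close> and beyond. A genuine
  uniform test loses nothing by trimming at any level, so it exceeds the merged test by at most
  \<open>e + 3\<close>, where \<open>e\<close> is an index of it.\<close>

lemma ex_uniform_deficiency:
  assumes m: "acceptable_numbering UNIV m"
  shows "\<exists>d. uniform_deficiency d"
proof -
  have "partial_computable2 m" using m by (simp add: acceptable_numbering_def)
  then obtain st :: "nat \<Rightarrow> nat \<Rightarrow> nat \<Rightarrow> nat option" where
    st: "effective (\<lambda>q. st (fst q) (fst (snd q)) (snd (snd q)))"
    "\<And>s t e x y. st s e x = Some y \<Longrightarrow> s \<le> t \<Longrightarrow> st t e x = Some y"
    "\<And>e x y. m e x = Some y \<longleftrightarrow> (\<exists>s. st s e x = Some y)"
    using partial_computable2_stages by blast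
  let ?E = "listed st"
  have E_mono: "set (?E e k n) \<subseteq> set (?E e k n')" if "n \<le> n'" for e k n n'
    using st(2)[OF _ that] that unfolding listed_def by fastforce
  have E_all: "(\<Union>n. set (?E e k n)) = dec ` {x. m e (prod_encode (k, x)) \<noteq> None}" for e k
  proof (intro set_eqI iffI)
    fix b assume "b \<in> (\<Union>n. set (?E e k n))"
    then obtain n x where "b = dec x" "st n e (prod_encode (k, x)) \<noteq> None" unfolding listed_def by auto
    then show "b \<in> dec ` {x. m e (prod_encode (k, x)) \<noteq> None}" using st(3)[of e "prod_encode (k, x)"] by auto
  next
    fix b :: "basic \<times> bitstring" assume "b \<in> dec ` {x. m e (prod_encode (k, x)) \<noteq> None}"
    then obtain x y s where x: "b = dec x" "st s e (prod_encode (k, x)) = Some y" using st(3) by auto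
    then have "st (s + Suc x) e (prod_encode (k, x)) = Some y" using st(2) le_add1 by blast
    then have "b \<in> set (?E e k (s + Suc x))" using x(1) unfolding listed_def
      by (auto simp del: upt_Suc add_Suc_right intro!: imageI)
    then show "b \<in> (\<Union>n. set (?E e k n))" by blast
  qed
  \<comment> \<open>The union over \<open>i\<close> makes the levels decreasing. Summing
    2^-(k+i+e+3) over \<open>i\<close> and \<open>e\<close> gives 2^-(k+1), which restores the
    strict bound 2^-k.\<close>
  define W where "W k = (\<Union>e i. trimmed (k + i + e + 3) (?E e (k + i + e + 3)))" for k
  have W_anti: "W k' \<subseteq> W k" if "k \<le> k'" for k k'
  proof -
    have "k' + i + e + 3 = k + (k' - k + i) + e + 3" for i e using that by simp
    then show ?thesis unfolding W_def by (intro UN_least) (metis (no_types, lifting) UN_upper UNIV_I order_trans)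
  qed
  define d where "d \<mu> X = (SUP k\<in>{k. X \<in> test_section (W k) \<mu>}. enat (Suc k))" for \<mu> X
  have d: "d \<mu> X > enat k \<longleftrightarrow> X \<in> test_section (W k) \<mu>" for \<mu> X k
  proof -
    have "d \<mu> X > enat k \<longleftrightarrow> (\<exists>j\<ge>k. X \<in> test_section (W j) \<mu>)"
      unfolding d_def less_SUP_iff by (auto simp: less_Suc_eq_le)
    also have "\<dots> \<longleftrightarrow> X \<in> test_section (W k) \<mu>"
      using W_anti unfolding mem_test_section by blast
    finally show ?thesis .
  qed
  have "uniform_test d"
    unfolding uniform_test_iff
  proof (intro conjI exI[of _ W] allI ballI)
    show "uniformly_ce (\<lambda>k. enc ` W k)"
    proof -
      define P where "P k x s \<longleftrightarrow> (case dec s :: ((nat \<times> nat \<times> nat) \<times> nat \<times> bitstring list \<times> bitstring) of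
          ((e, i, n), N, xs, \<sigma>) \<Rightarrow>
            certificate (k + i + e + 3) (?E e (k + i + e + 3) n) n N xs \<sigma> \<and> x = enc (neighbourhood N xs, \<sigma>))"
        for k x s :: nat
      have "effective (\<lambda>q. P (fst q) (fst (snd q)) (snd (snd q)))"
        unfolding P_def by (intro eff effective_listed[OF st(1)])
      then have "uniformly_ce (\<lambda>k. {x. \<exists>s. P k x s})" by (rule uniformly_ceI)
      moreover have "{x. \<exists>s. P k x s} = enc ` W k" for k
      proof (intro set_eqI iffI)
        fix x assume "x \<in> {x. \<exists>s. P k x s}"
        then obtain s where s: "P k x s" by blast
        obtain a N xs \<sigma> where "dec s = (a :: nat \<times> nat \<times> nat, N :: nat, xs :: bitstring list, \<sigma> :: bitstring)"
          by (rule prod_cases4)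
        moreover obtain e i n where "a = (e, i, n)" by (rule prod_cases3)
        ultimately have "certificate (k + i + e + 3) (?E e (k + i + e + 3) n) n N xs \<sigma>"
          "x = enc (neighbourhood N xs, \<sigma>)" using s unfolding P_def by simp_all
        then show "x \<in> enc ` W k" unfolding W_def trimmed_def by blast
      next
        fix x assume "x \<in> enc ` W k"
        then obtain e i n N xs \<sigma> where "certificate (k + i + e + 3) (?E e (k + i + e + 3) n) n N xs \<sigma>"
          "x = enc (neighbourhood N xs, \<sigma>)" unfolding W_def trimmed_def by blast
        then have "P k x (enc ((e, i, n), N, xs, \<sigma>))" unfolding P_def by simp
        then show "x \<in> {x. \<exists>s. P k x s}" by blast
      qed
      ultimately show ?thesis by simp
    qed
    show "{X. enat k < d \<mu> X} = test_section (W k) \<mu>" for k \<mu>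
      unfolding d by simp
    show "measure \<mu> {X. enat k < d \<mu> X} < (1/2) ^ k" if "\<mu> \<in> \<M>" for \<mu> k
    proof -
      let ?A = "\<lambda>e i. test_section (trimmed (k + i + e + 3) (?E e (k + i + e + 3))) \<mu>"
      have "{X. enat k < d \<mu> X} = (\<Union>e. \<Union>i. ?A e i)"
        unfolding d W_def set_eq_iff mem_Collect_eq UN_iff mem_test_section by blast
      moreover have "measure \<mu> (\<Union>i. ?A e i) \<le> (1/2) ^ (k + 1 + e + 1)" for e
      proof (rule measure_UN_geometric_le[OF that])
        fix i
        have "measure \<mu> (?A e i) \<le> (1/2) ^ (k + i + e + 3)"
          by (rule measure_trimmed_le[OF that E_mono])
        moreover have "k + i + e + 3 = k + 1 + e + 1 + i + 1" by simp
        ultimately show "measure \<mu> (?A e i) \<le> (1/2) ^ (k + 1 + e + 1 + i + 1)" by (simp only:)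
      qed simp
      then have "measure \<mu> (\<Union>e. \<Union>i. ?A e i) \<le> (1/2) ^ (k + 1)"
        by (intro measure_UN_geometric_le[OF that, of "\<lambda>e. \<Union>i. ?A e i"] sets.countable_UN) auto
      moreover have "(1/2::real) ^ (k + 1) < (1/2) ^ k" by simp
      ultimately show ?thesis by (metis le_less_trans)
    qed
  qed
  moreover have "\<exists>c. \<forall>\<mu>\<in>\<M>. \<forall>X. d' \<mu> X \<le> d \<mu> X + enat c" if d': "uniform_test d'" for d'
  proof -
    obtain W' where W': "uniformly_ce (\<lambda>k. enc ` W' k)"
      and sec: "\<And>k \<mu>. \<mu> \<in> \<M> \<Longrightarrow> {X. d' \<mu> X > enat k} = test_section (W' k) \<mu>"
      and small: "\<And>\<mu> k. \<mu> \<in> \<M> \<Longrightarrow> measure \<mu> {X. d' \<mu> X > enat k} < (1/2) ^ k"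
      using d' unfolding uniform_test_iff by blast
    obtain p where p: "partial_computable2 p" "\<And>k. enc ` W' k = {x. p k x \<noteq> None}"
      using W' unfolding uniformly_ce_def by blast
    have "partial_computable2 (\<lambda>e y. p (fst (prod_decode y)) (snd (prod_decode y)))"
      by (intro partial_computable2_comp p(1) computable_fst_prod_decode computable_snd_prod_decode computable_id)
    then obtain g where g: "\<And>e::nat. (\<lambda>y. p (fst (prod_decode y)) (snd (prod_decode y))) = m (g e)"
      using m unfolding acceptable_numbering_def by blast
    define e where "e = g 0"
    have "m e (prod_encode (k, x)) = p k x" for k x
      using fun_cong[OF g[of 0], of "prod_encode (k, x)"] by (simp add: e_def)
    then have E_W': "(\<Union>n. set (?E e k n)) = W' k" for k
    proof -
      have "{x. m e (prod_encode (k, x)) \<noteq> None} = enc ` W' k"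
        unfolding p(2) \<open>\<And>k x. m e (prod_encode (k, x)) = p k x\<close> ..
      then show ?thesis unfolding E_all by (simp only: image_image dec_enc image_ident)
    qed
    have "d' \<mu> X \<le> d \<mu> X + enat (e + 3)" if \<mu>: "\<mu> \<in> \<M>" for \<mu> X
    proof (cases "d \<mu> X")
      case (enat k)
      let ?k = "k + 0 + e + 3"
      have "\<not> d' \<mu> X > enat ?k"
      proof
        assume "d' \<mu> X > enat ?k"
        then have "X \<in> test_section (\<Union>n. set (?E e ?k n)) \<mu>" unfolding E_W' sec[OF \<mu>, symmetric] by simp
        moreover have "measure \<mu> (test_section (\<Union>n. set (?E e ?k n)) \<mu>) < (1/2) ^ ?k"
          unfolding E_W' sec[OF \<mu>, symmetric] by (rule small[OF \<mu>])
        ultimately have "X \<in> test_section (trimmed ?k (?E e ?k)) \<mu>"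
          using test_section_trimmed[OF \<mu>, of "?E e ?k"] E_mono by blast
        then have "X \<in> test_section (W k) \<mu>" unfolding mem_test_section W_def by blast
        then show False using d[of k \<mu> X] enat by simp
      qed
      then show ?thesis by (simp add: enat not_less add.assoc)
    qed simp
    then show ?thesis by blast
  qed
  ultimately show ?thesis unfolding uniform_deficiency_def by blast
qed

lemma nonrandom_null:
  assumes "uniform_test d" "\<mu> \<in> \<M>"
  shows "{X. d \<mu> X = \<infinity>} \<in> sets borel" "measure \<mu> {X. d \<mu> X = \<infinity>} = 0"
proof -
  interpret prob_space \<mu> using assms(2) by (simp add: measures_iff)
  have sets: "sets \<mu> = sets borel" using assms(2) by (simp add: measures_iff)
  obtain W where sec: "\<And>k. {X. d \<mu> X > enat k} = test_section (W k) \<mu>"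
    using assms unfolding uniform_test_iff by blast
  have small: "\<And>k. measure \<mu> {X. d \<mu> X > enat k} < (1/2) ^ k"
    using assms unfolding uniform_test_iff by blast
  have eq: "{X. d \<mu> X = \<infinity>} = (\<Inter>k. {X. d \<mu> X > enat k})"
  proof -
    have "v = \<infinity> \<longleftrightarrow> (\<forall>k. v > enat k)" for v :: enat by (cases v) auto
    then show ?thesis by auto
  qed
  show borel: "{X. d \<mu> X = \<infinity>} \<in> sets borel" unfolding eq sec by (intro sets.countable_INT) auto
  have "measure \<mu> {X. d \<mu> X = \<infinity>} \<le> (1/2) ^ k" for k
  proof -
    have "measure \<mu> {X. d \<mu> X = \<infinity>} \<le> measure \<mu> {X. d \<mu> X > enat k}"
    proof (rule finite_measure_mono)
      show "{X. d \<mu> X = \<infinity>} \<subseteq> {X. d \<mu> X > enat k}" by auto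
    qed (simp add: sec sets)
    then show ?thesis using small[of k] by linarith
  qed
  moreover have "(\<lambda>k. (1/2::real) ^ k) \<longlonglongrightarrow> 0" by (rule LIMSEQ_power_zero) simp
  ultimately have "measure \<mu> {X. d \<mu> X = \<infinity>} \<le> 0" by (intro LIMSEQ_le_const) auto
  then show "measure \<mu> {X. d \<mu> X = \<infinity>} = 0" using measure_nonneg[of \<mu>] by (intro antisym)
qed

lemma random_wrt_iff:
  assumes "uniform_deficiency d" "\<mu> \<in> \<M>"
  shows "random_wrt \<mu> X \<longleftrightarrow> d \<mu> X < \<infinity>"
proof
  assume "random_wrt \<mu> X"
  then obtain d' where d': "uniform_deficiency d'" "d' \<mu> X < \<infinity>" unfolding random_wrt_def by blast
  then obtain c where "d \<mu> X \<le> d' \<mu> X + enat c"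
    using assms unfolding uniform_deficiency_def by blast
  with d'(2) show "d \<mu> X < \<infinity>" by (cases "d \<mu> X"; cases "d' \<mu> X") auto
qed (use assms in \<open>auto simp: random_wrt_def\<close>)


section \<open>Translations between reals, indices, measures and random reals\<close>

section \<open>Bounded search in lists\<close>

definition dyadic_sum :: "dyadic list \<Rightarrow> dyadic" where
  "dyadic_sum qs = foldr dadd qs (0, 0)"

lemma dyadic_val_dyadic_sum[simp]: "dyadic_val (dyadic_sum qs) = sum_list (map dyadic_val qs)"
  by (induction qs) (simp_all add: dyadic_sum_def, simp add: dyadic_val_def)

lemma effective_dyadic_sum[eff]: "effective f \<Longrightarrow> effective (\<lambda>x. dyadic_sum (f x))"
  unfolding dyadic_sum_def by (intro eff)

lemma hd_filter_upt:
  assumes "P h" "h < n" "\<And>j. j < h \<Longrightarrow> \<not> P j"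
  shows "filter P [0..<n] \<noteq> []" "hd (filter P [0..<n]) = h"
proof -
  have "[0..<n] = [0..<h] @ h # [Suc h..<n]"
    using assms(2) by (metis less_imp_add_positive upt_add_eq_append upt_conv_Cons zero_le less_imp_le)
  moreover have "filter P [0..<h] = []" using assms(3) by (simp add: filter_empty_conv)
  ultimately have "filter P [0..<n] = h # filter P [Suc h..<n]" using assms(1) by simp
  then show "filter P [0..<n] \<noteq> []" "hd (filter P [0..<n]) = h" by simp_all
qed

definition largest :: "(nat \<Rightarrow> bool) \<Rightarrow> nat \<Rightarrow> nat" where
  "largest P n = (let ks = filter P (rev [0..<Suc n]) in if ks = [] then 0 else hd ks)"

lemma largest:
  assumes "P k" "k \<le> n"
  shows "P (largest P n)" "k \<le> largest P n" "largest P n \<le> n"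
proof -
  have "P (largest P n) \<and> k \<le> largest P n \<and> largest P n \<le> n" using assms
  proof (induction n)
    case (Suc n)
    then show ?case by (cases "P (Suc n)") (auto simp: largest_def Let_def le_Suc_eq)
  qed (simp add: largest_def)
  then show "P (largest P n)" "k \<le> largest P n" "largest P n \<le> n" by auto
qed

lemma effective_largest[eff]:
  assumes "effective (\<lambda>q. P (fst q) (snd q))" "effective f"
  shows "effective (\<lambda>x. largest (P x) (f x))"
  unfolding largest_def Let_def by (intro eff effective_comp2[OF assms(1)] assms(2))


section \<open>Indices\<close>

lemma partial_measure_eq_Some:
  "partial_measure m e \<sigma> = Some r \<longleftrightarrow>
    (\<forall>n. \<exists>q. m e (prod_encode (enc \<sigma>, n)) = Some (enc q) \<and> \<bar>dyadic_val q - r\<bar> < (1/2) ^ n)"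
    (is "_ \<longleftrightarrow> ?A r")
proof -
  have uniq: "r = s" if "?A r" "?A s" for r s
  proof (rule ccontr)
    assume "r \<noteq> s"
    have "(\<lambda>n. (1/2::real) ^ n) \<longlonglongrightarrow> 0" by (rule LIMSEQ_power_zero) simp
    from tendsto_mult_left[OF this, of 2] have "(\<lambda>n. 2 * (1/2::real) ^ n) \<longlonglongrightarrow> 0" by simp
    then have "\<forall>\<^sub>F n in sequentially. 2 * (1/2::real) ^ n < \<bar>r - s\<bar>"
      by (rule order_tendstoD) (use \<open>r \<noteq> s\<close> in simp)
    then obtain n where n: "2 * (1/2::real) ^ n < \<bar>r - s\<bar>" by (auto simp: eventually_sequentially)
    obtain q where q: "m e (prod_encode (enc \<sigma>, n)) = Some (enc q)" "\<bar>dyadic_val q - r\<bar> < (1/2) ^ n"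
      using \<open>?A r\<close> by blast
    obtain q' where q': "m e (prod_encode (enc \<sigma>, n)) = Some (enc q')" "\<bar>dyadic_val q' - s\<bar> < (1/2) ^ n"
      using \<open>?A s\<close> by blast
    have "q = q'" using q(1) q'(1) by (simp add: enc_inject)
    with q(2) have "\<bar>dyadic_val q' - r\<bar> < (1/2) ^ n" by simp
    with q'(2) n show False by linarith
  qed
  have eq: "partial_measure m e \<sigma> = (if \<exists>r. ?A r then Some (THE r. ?A r) else None)"
    unfolding partial_measure_def Let_def string_code_eq_enc dyadic_code_eq_enc ..
  have "(if \<exists>r. A r then Some (THE r. A r) else None) = Some r \<longleftrightarrow> A r"
    if "\<And>r s. A r \<Longrightarrow> A s \<Longrightarrow> r = s" for A :: "real \<Rightarrow> bool"
  proof (cases "\<exists>r. A r")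
    case True
    then obtain s where "A s" by blast
    moreover from this that have "(THE r. A r) = s" by (intro the_equality)
    ultimately show ?thesis using that by auto
  qed auto
  from this[of ?A] uniq show ?thesis unfolding eq by blast
qed

lemma measure_index_iff:
  "measure_index m e \<mu> \<longleftrightarrow> (\<forall>\<sigma> n. \<exists>q. m e (prod_encode (enc \<sigma>, n)) = Some (enc q) \<and>
    \<bar>dyadic_val q - measure \<mu> (cylinder \<sigma>)\<bar> < (1/2) ^ n)"
  unfolding measure_index_def partial_measure_eq_Some by blast

lemma computable_learner_iff: "computable_learner L \<longleftrightarrow> effective L"
proof -
  have "(id :: nat \<Rightarrow> nat) = enc" by (rule ext) (simp add: enc_nat_def)
  then show ?thesis unfolding computable_learner_def effective_def string_code_eq_enc by simp
qed

text \<open>This plays the part of the s-m-n theorem: a family of functions given by searches,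
  uniformly in \<open>e\<close>, has its indices produced by an effective function of
  \<open>e\<close>.\<close>

lemma acceptable_numbering_translate:
  fixes P :: "nat \<Rightarrow> nat \<Rightarrow> nat \<Rightarrow> bool" and F :: "nat \<Rightarrow> nat \<Rightarrow> nat \<Rightarrow> nat"
  assumes "acceptable_numbering V \<phi>"
    and "effective (\<lambda>q. P (fst q) (fst (snd q)) (snd (snd q)))"
    and "effective (\<lambda>q. F (fst q) (fst (snd q)) (snd (snd q)))"
    and "\<And>e x s. F e x s \<in> V"
  obtains g :: "nat \<Rightarrow> nat" where "effective g"
    "\<And>e x. \<phi> (g e) x = (if \<exists>s. P e x s then Some (F e x (LEAST s. P e x s)) else None)"
proof -
  define \<psi> where "\<psi> e x = (if \<exists>s. P e x s then Some (F e x (LEAST s. P e x s)) else None)" for e x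
  have "partial_computable2 \<psi>"
    unfolding \<psi>_def using assms(2,3) by (rule partial_computable2_search)
  moreover have "ran (\<psi> e) \<subseteq> V" for e using assms(4) by (auto simp: \<psi>_def ran_def)
  ultimately obtain g where g: "computable g" "\<And>e. \<psi> e = \<phi> (g e)"
    using assms(1) unfolding acceptable_numbering_def by blast
  show thesis
  proof (rule that)
    show "effective g" using g(1) by (simp add: effective_nat_iff)
    show "\<phi> (g e) x = (if \<exists>s. P e x s then Some (F e x (LEAST s. P e x s)) else None)" for e x
      using fun_cong[OF g(2)[of e], of x] unfolding \<psi>_def by (rule sym)
  qed
qed

lemma acceptable_numbering_stages:
  assumes "acceptable_numbering V \<phi>"
  obtains st :: "nat \<Rightarrow> nat \<Rightarrow> nat \<Rightarrow> nat option"
  where "effective (\<lambda>q. st (fst q) (fst (snd q)) (snd (snd q)))"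
    and "\<And>s t e x y. st s e x = Some y \<Longrightarrow> s \<le> t \<Longrightarrow> st t e x = Some y"
    and "\<And>e x y. \<phi> e x = Some y \<longleftrightarrow> (\<exists>s. st s e x = Some y)"
  using assms partial_computable2_stages unfolding acceptable_numbering_def by blast

lemma real_index_to_measure_index:
  assumes "acceptable_numbering V \<phi>" "acceptable_numbering UNIV m" "computable_measure_map f"
  obtains h where "effective h" "\<And>e Z. real_index \<phi> e Z \<Longrightarrow> measure_index m (h e) (f Z)"
proof -
  obtain st :: "nat \<Rightarrow> nat \<Rightarrow> nat \<Rightarrow> nat option" where
    st: "effective (\<lambda>q. st (fst q) (fst (snd q)) (snd (snd q)))"
    "\<And>s t e x y. st s e x = Some y \<Longrightarrow> s \<le> t \<Longrightarrow> st t e x = Some y"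
    "\<And>e x y. \<phi> e x = Some y \<longleftrightarrow> (\<exists>s. st s e x = Some y)"
    by (rule acceptable_numbering_stages[OF assms(1)]) blast
  obtain M v where M: "effective M" and v: "effective (\<lambda>q. v (fst q) (fst (snd q)) (snd (snd q)))"
    and approx: "\<And>p Z n \<sigma>. M p \<le> n \<Longrightarrow> length \<sigma> \<le> p \<Longrightarrow>
       \<bar>dyadic_val (v p (Z \<restriction> n) \<sigma>) - measure (f Z) (cylinder \<sigma>)\<bar> \<le> (1/2) ^ p"
    by (rule computable_measure_map_evaluation[OF assms(3)]) blast
  define arg where "arg x = (dec x :: bitstring \<times> nat)" for x
  \<comment> \<open>The precision covers the length of the string, up to which \<open>v\<close> is
    accurate, and exceeds the requested one, so that the non-strict error bound of \<open>v\<close>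
    becomes the strict bound that \<open>measure_index\<close> asks for.\<close>
  define prec where "prec x = Suc (snd (arg x) + length (fst (arg x)))" for x
  define P where "P e x s \<longleftrightarrow> list_all (\<lambda>i. st s e i \<noteq> None) [0..<M (prec x)]" for e x s
  define F where "F e x s = enc (v (prec x) (map (\<lambda>i. the (st s e i) \<noteq> 0) [0..<M (prec x)]) (fst (arg x)))" for e x s
  have "effective (\<lambda>q. P (fst q) (fst (snd q)) (snd (snd q)))"
    unfolding P_def prec_def arg_def by (intro eff effective_comp3[OF st(1)] M[THEN effective_comp])
  moreover have "effective (\<lambda>q. F (fst q) (fst (snd q)) (snd (snd q)))"
    unfolding F_def prec_def arg_def
    by (intro eff effective_comp3[OF st(1)] effective_comp3[OF v] M[THEN effective_comp])
  ultimately obtain h where h: "effective h"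
    "\<And>e x. m (h e) x = (if \<exists>s. P e x s then Some (F e x (LEAST s. P e x s)) else None)"
    using acceptable_numbering_translate[OF assms(2), of P F] by blast
  have "measure_index m (h e) (f Z)" if "real_index \<phi> e Z" for e Z
    unfolding measure_index_iff
  proof (intro allI)
    fix \<sigma> :: bitstring and n
    let ?x = "prod_encode (enc \<sigma>, n)"
    have x: "arg ?x = (\<sigma>, n)" by (simp add: arg_def dec_prod_def dec_nat_def)
    have val: "st s e i = Some y \<Longrightarrow> y = of_bool (Z i)" for s i y
      using that st(3)[of e i y] unfolding real_index_def by (metis option.inject)
    have "\<exists>s. P e ?x s"
    proof -
      have "\<forall>i. \<exists>s. st s e i = Some (of_bool (Z i))"
        using that st(3) unfolding real_index_def by metis
      then obtain s where s: "\<And>i. st (s i) e i = Some (of_bool (Z i))" by metis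
      have "st (Max (s ` {..<M (prec ?x)})) e i = Some (of_bool (Z i))" if "i < M (prec ?x)" for i
        using that by (intro st(2)[OF s] Max_ge) auto
      then show ?thesis unfolding P_def by (intro exI[of _ "Max (s ` {..<M (prec ?x)})"]) (auto simp: list_all_iff)
    qed
    moreover define s where "s = (LEAST s. P e ?x s)"
    ultimately have s: "P e ?x s" and m: "m (h e) ?x = Some (F e ?x s)" by (auto simp: h(2) intro: LeastI_ex)
    have "map (\<lambda>i. the (st s e i) \<noteq> 0) [0..<M (prec ?x)] = Z \<restriction> M (prec ?x)"
    proof (intro nth_equalityI)
      fix i assume "i < length (map (\<lambda>i. the (st s e i) \<noteq> 0) [0..<M (prec ?x)])"
      then have i: "i < M (prec ?x)" by simp
      then have "st s e i \<noteq> None" using s unfolding P_def list_all_iff by simp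
      then obtain y where "st s e i = Some y" by blast
      with val[OF this] i show "map (\<lambda>i. the (st s e i) \<noteq> 0) [0..<M (prec ?x)] ! i = (Z \<restriction> M (prec ?x)) ! i"
        by simp
    qed simp
    then have F: "F e ?x s = enc (v (prec ?x) (Z \<restriction> M (prec ?x)) \<sigma>)" unfolding F_def x by simp
    moreover have "\<bar>dyadic_val (v (prec ?x) (Z \<restriction> M (prec ?x)) \<sigma>) - measure (f Z) (cylinder \<sigma>)\<bar> \<le> (1/2) ^ prec ?x"
      by (rule approx) (simp_all add: prec_def x)
    moreover have "(1/2::real) ^ prec ?x < (1/2) ^ n"
      by (rule power_strict_decreasing) (simp_all add: prec_def x)
    ultimately show "\<exists>q. m (h e) ?x = Some (enc q) \<and> \<bar>dyadic_val q - measure (f Z) (cylinder \<sigma>)\<bar> < (1/2) ^ n"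
      by (intro exI[of _ "v (prec ?x) (Z \<restriction> M (prec ?x)) \<sigma>"] conjI) (simp add: m F, linarith)
  qed
  with h(1) show thesis by (rule that)
qed


section \<open>Orthogonal images of an effectively closed set\<close>

locale orthogonal_images =
  fixes f :: "cantor \<Rightarrow> cantor measure" and D :: "cantor set" and d :: "cantor measure \<Rightarrow> cantor \<Rightarrow> enat"
  assumes f_measures: "f Z \<in> \<M>"
    and f_computable: "computable_measure_map f"
    and D_closed: "effectively_closed D"
    and orthogonal: "X \<in> D \<Longrightarrow> Y \<in> D \<Longrightarrow> X \<noteq> Y \<Longrightarrow> effectively_orthogonal (f X) (f Y)"
    and deficiency: "uniform_deficiency d"
begin

lemma random_iff: "random_wrt (f Z) X \<longleftrightarrow> d (f Z) X < \<infinity>"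
  by (rule random_wrt_iff[OF deficiency f_measures])

lemma random_unique:
  "Y \<in> D \<Longrightarrow> Z \<in> D \<Longrightarrow> random_wrt (f Y) X \<Longrightarrow> random_wrt (f Z) X \<Longrightarrow> Y = Z"
  using orthogonal unfolding effectively_orthogonal_def by blast

lemma prob_space_f: "prob_space (f Z)" and sets_f: "sets (f Z) = sets borel"
  using f_measures[of Z] by (simp_all add: measures_iff)

lemma
  shows sets_nonrandom: "{X. \<not> random_wrt (f Z) X} \<in> sets borel"
    and measure_nonrandom: "measure (f Z) {X. \<not> random_wrt (f Z) X} = 0"
  using nonrandom_null[of d, OF _ f_measures[of Z]] deficiency
  by (simp_all add: random_iff uniform_deficiency_def)

lemma ex_random:
  assumes "A \<in> sets borel" "measure (f Z) A > 0"
  shows "\<exists>X\<in>A. random_wrt (f Z) X"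
proof (rule ccontr)
  assume "\<not> ?thesis"
  then have "A \<subseteq> {X. \<not> random_wrt (f Z) X}" by blast
  interpret prob_space "f Z" by (rule prob_space_f)
  have "measure (f Z) A \<le> measure (f Z) {X. \<not> random_wrt (f Z) X}"
    by (rule finite_measure_mono) (use \<open>A \<subseteq> _\<close> sets_nonrandom in \<open>simp_all add: sets_f\<close>)
  with assms(2) show False by (simp add: measure_nonrandom)
qed

lemma measure_f_covering:
  assumes "A \<in> sets borel" "\<And>X. random_wrt (f Z) X \<Longrightarrow> X \<in> A"
  shows "measure (f Z) A = 1"
proof -
  interpret prob_space "f Z" by (rule prob_space_f)
  have sp: "space (f Z) = UNIV" using sets_eq_imp_space_eq[OF sets_f[of Z]] by simp
  have "measure (f Z) (- A) \<le> measure (f Z) {X. \<not> random_wrt (f Z) X}"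
    by (rule finite_measure_mono) (use assms sets_nonrandom in \<open>auto simp: sets_f\<close>)
  then have "measure (f Z) (space (f Z) - A) = 0"
    using measure_nonneg[of "f Z" "- A"] unfolding measure_nonrandom sp Compl_eq_Diff_UNIV by linarith
  then show ?thesis using prob_compl[of A] assms(1) by (simp add: sets_f)
qed

text \<open>Tests see a measure only through its values on cylinders. If these agreed, the same
  reals would be random for both images, and there are such reals because the nonrandom ones form a
  null set. This contradicts orthogonality.\<close>

lemma distinct_images_on_cylinder:
  assumes "Y \<in> D" "Z \<in> D" "Y \<noteq> Z"
  shows "\<exists>\<sigma>. measure (f Y) (cylinder \<sigma>) \<noteq> measure (f Z) (cylinder \<sigma>)"
proof (rule ccontr)
  assume "\<not> ?thesis"
  then have eq: "measure (f Y) (cylinder \<sigma>) = measure (f Z) (cylinder \<sigma>)" for \<sigma> by blast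
  then have sec: "test_section W (f Y) = test_section W (f Z)" for W
    unfolding test_section_def basic_open_iff by (simp add: f_measures)
  obtain W where W: "\<And>k \<mu>. \<mu> \<in> \<M> \<Longrightarrow> {X. d \<mu> X > enat k} = test_section (W k) \<mu>"
    using deficiency unfolding uniform_deficiency_def uniform_test_iff by blast
  have gt: "d (f Y) X > enat k \<longleftrightarrow> d (f Z) X > enat k" for k X
    using W[OF f_measures[of Y], of k] W[OF f_measures[of Z], of k] sec by blast
  have "v = \<infinity> \<longleftrightarrow> (\<forall>k. v > enat k)" for v :: enat by (cases v) auto
  then have same: "random_wrt (f Y) X \<longleftrightarrow> random_wrt (f Z) X" for X
    unfolding random_iff using gt by (metis enat_ord_simps(4))
  have "cylinder [] = UNIV" by (auto simp: cylinder_def initial_def)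
  moreover have "measure (f Z) (cylinder []) = 1"
    using sum_measure_strings[OF f_measures[of Z], of 0] by simp
  ultimately obtain X where "random_wrt (f Z) X" using ex_random[of "cylinder []" Z] by auto
  with same random_unique assms show False by blast
qed

text \<open>By letting \<open>n\<close> be at once the stage of the enumeration and the number of
  bits read, leaving \<open>D\<close> becomes a single monotone condition on initial segments, the
  form in which compactness is applied.\<close>

lemma complement_stages:
  obtains kill :: "nat \<Rightarrow> bitstring \<Rightarrow> bool"
  where "effective (\<lambda>q. kill (fst q) (snd q))"
    and "\<And>s t \<rho> \<tau>. kill s \<rho> \<Longrightarrow> s \<le> t \<Longrightarrow> prefix \<rho> \<tau> \<Longrightarrow> kill t \<tau>"
    and "\<And>Y. Y \<notin> D \<longleftrightarrow> (\<exists>n. kill n (Y \<restriction> n))"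
proof -
  obtain W where W: "ce (enc ` W)" "- D = (\<Union>\<sigma>\<in>W. cylinder \<sigma>)"
    using D_closed unfolding effectively_closed_def string_code_eq_enc by blast
  obtain En :: "nat \<Rightarrow> nat \<Rightarrow> bool" where En: "effective (\<lambda>q. En (fst q) (snd q))"
    "\<And>s t x. En s x \<Longrightarrow> s \<le> t \<Longrightarrow> En t x" "\<And>x. x \<in> enc ` W \<longleftrightarrow> (\<exists>s. En s x)"
    using ce_stages[OF W(1)] by blast
  define kill where "kill s \<rho> \<longleftrightarrow> list_ex (\<lambda>x. En s x \<and> prefix (dec x) \<rho>) [0..<s]" for s and \<rho> :: bitstring
  show thesis
  proof (rule that[of kill])
    show "effective (\<lambda>q. kill (fst q) (snd q))"
      unfolding kill_def by (intro eff effective_comp2[OF En(1)])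
    show "kill t \<tau>" if "kill s \<rho>" "s \<le> t" "prefix \<rho> \<tau>" for s t \<rho> \<tau>
      using that En(2)[OF _ that(2)] prefix_order.trans[OF _ that(3)]
      unfolding kill_def list_ex_iff by force
    show "Y \<notin> D \<longleftrightarrow> (\<exists>n. kill n (Y \<restriction> n))" for Y
    proof
      assume "Y \<notin> D"
      then obtain \<sigma> where \<sigma>: "\<sigma> \<in> W" "Y \<in> cylinder \<sigma>" using W(2) by blast
      then obtain s where s: "En s (enc \<sigma>)" using En(3) by blast
      define n where "n = s + Suc (enc \<sigma>) + length \<sigma>"
      have "En n (enc \<sigma>)" using En(2)[OF s] by (simp add: n_def)
      moreover have "prefix \<sigma> (Y \<restriction> n)" using \<sigma>(2) by (simp add: prefix_initial_iff n_def)
      ultimately have "kill n (Y \<restriction> n)" unfolding kill_def list_ex_iff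
        by (intro bexI[of _ "enc \<sigma>"]) (auto simp: n_def)
      then show "\<exists>n. kill n (Y \<restriction> n)" ..
    next
      assume "\<exists>n. kill n (Y \<restriction> n)"
      then obtain n x where "En n x" "prefix (dec x) (Y \<restriction> n)" unfolding kill_def list_ex_iff by blast
      moreover from this obtain \<sigma> where "x = enc \<sigma>" "\<sigma> \<in> W" using En(3) by blast
      ultimately show "Y \<notin> D" using W(2) by (auto simp: prefix_initial_iff)
    qed
  qed
qed


text \<open>The strings of length n not yet ruled out at bound c cover all members of
  \<open>D\<close> for which the deficiency is at most c. Below the least possible c, compactness
  eventually rules out every string. At that value \<open>Z\<close> itself is never ruled out, so
  the longest common prefix of the survivors is an initial segment of \<open>Z\<close>, and its
  length tends to infinity.\<close>

lemma limit_recovery: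
  obtains G :: "bitstring \<Rightarrow> bitstring" where "effective G"
    "\<And>X Z k. Z \<in> D \<Longrightarrow> random_wrt (f Z) X \<Longrightarrow> \<forall>\<^sub>F n in sequentially. \<exists>j\<ge>k. G (X \<restriction> n) = Z \<restriction> j"
proof -
  obtain M v where M: "effective M" and v: "effective (\<lambda>q. v (fst q) (fst (snd q)) (snd (snd q)))"
    and approx: "\<And>p Z n \<sigma>. M p \<le> n \<Longrightarrow> length \<sigma> \<le> p \<Longrightarrow>
       \<bar>dyadic_val (v p (Z \<restriction> n) \<sigma>) - measure (f Z) (cylinder \<sigma>)\<bar> \<le> (1/2) ^ p"
    and v_prefix: "\<And>p \<rho> \<tau> \<sigma>. M p \<le> length \<rho> \<Longrightarrow> prefix \<rho> \<tau> \<Longrightarrow> v p \<tau> \<sigma> = v p \<rho> \<sigma>"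
    by (rule computable_measure_map_evaluation[OF f_computable]) blast
  obtain kill where kill: "effective (\<lambda>q. kill (fst q) (snd q))"
    and kill_mono: "\<And>s t \<rho> \<tau>. kill s \<rho> \<Longrightarrow> s \<le> t \<Longrightarrow> prefix \<rho> \<tau> \<Longrightarrow> kill t \<tau>"
    and kill_iff: "\<And>Y. Y \<notin> D \<longleftrightarrow> (\<exists>n. kill n (Y \<restriction> n))"
    by (rule complement_stages) blast
  obtain W where W_ce: "uniformly_ce (\<lambda>k. enc ` W k)"
    and W: "\<And>k \<mu>. \<mu> \<in> \<M> \<Longrightarrow> {X. d \<mu> X > enat k} = test_section (W k) \<mu>"
    using deficiency unfolding uniform_deficiency_def uniform_test_iff by blast
  obtain En :: "nat \<Rightarrow> nat \<Rightarrow> nat \<Rightarrow> bool" where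
    En: "effective (\<lambda>q. En (fst q) (fst (snd q)) (snd (snd q)))"
    and En_mono: "\<And>s t k x. En s k x \<Longrightarrow> s \<le> t \<Longrightarrow> En t k x"
    and En_iff: "\<And>k x. x \<in> enc ` W k \<longleftrightarrow> (\<exists>s. En s k x)"
    using uniformly_ce_stages[OF W_ce] by blast
  \<comment> \<open>The gap 2^-p covers the error of \<open>v\<close>, so passing the test puts the
    image of every real through \<open>\<rho>\<close> into \<open>basic_open B\<close>. Requiring
    \<open>M p\<close> bits makes the outcome stable under further extension.\<close>
  define ctest where "ctest p \<rho> B \<longleftrightarrow> M p \<le> length \<rho> \<and> list_all (\<lambda>(\<tau>, l, u). length \<tau> \<le> p \<and>
      dless (dadd l (1, p)) (v p \<rho> \<tau>) \<and> dless (dadd (v p \<rho> \<tau>) (1, p)) u) B"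
    for p \<rho> and B :: basic
  define cert where "cert s \<rho> B \<longleftrightarrow> list_ex (\<lambda>p. ctest p \<rho> B) [0..<s]" for s \<rho> and B :: basic
  define pair where "pair x = (dec x :: basic \<times> bitstring)" for x
  \<comment> \<open>Within \<open>s\<close> steps it is seen that no \<open>Y\<close> in
    \<open>D\<close> through \<open>\<rho>\<close> has an image with respect to which reals through
    \<open>\<xi>\<close> have deficiency at most \<open>c\<close>.\<close>
  define K where "K s c \<xi> \<rho> \<longleftrightarrow> kill s \<rho> \<or>
      list_ex (\<lambda>x. En s c x \<and> prefix (snd (pair x)) \<xi> \<and> cert s \<rho> (fst (pair x))) [0..<s]" for s c and \<xi> \<rho> :: bitstring
  have ctest_iff: "ctest p \<rho> B \<longleftrightarrow> M p \<le> length \<rho> \<and> (\<forall>(\<tau>, l, u)\<in>set B. length \<tau> \<le> p \<and>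
      dyadic_val l + (1/2) ^ p < dyadic_val (v p \<rho> \<tau>) \<and> dyadic_val (v p \<rho> \<tau>) + (1/2) ^ p < dyadic_val u)"
    for p \<rho> B
    by (simp only: ctest_def list_all_iff dless_iff dyadic_val_dadd dyadic_val_inverse_power)
  have cert_char: "cert s \<rho> B \<longleftrightarrow> (\<exists>p<s. ctest p \<rho> B)" for s \<rho> B
    by (auto simp: cert_def list_ex_iff)
  have K_char: "K s c \<xi> \<rho> \<longleftrightarrow> kill s \<rho> \<or>
      (\<exists>x<s. En s c x \<and> prefix (snd (pair x)) \<xi> \<and> cert s \<rho> (fst (pair x)))" for s c \<xi> \<rho>
    by (auto simp: K_def list_ex_iff)
  have eff_cert: "effective (\<lambda>q. cert (fst q) (fst (snd q)) (snd (snd q)))"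
    unfolding cert_def ctest_def by (intro eff M[THEN effective_comp] effective_comp3[OF v])
  have eff_K: "effective (\<lambda>q. K (fst q) (fst (snd q)) (fst (snd (snd q))) (snd (snd (snd q))))"
    unfolding K_def pair_def by (intro eff effective_comp3[OF eff_cert] effective_comp3[OF En] effective_comp2[OF kill])
  have cert_mono: "cert t \<tau> B" if "cert s \<rho> B" "s \<le> t" "prefix \<rho> \<tau>" for s t \<rho> \<tau> B
  proof -
    obtain p where p: "p < s" "ctest p \<rho> B" using \<open>cert s \<rho> B\<close> unfolding cert_char by blast
    then have M: "M p \<le> length \<rho>" by (simp add: ctest_iff)
    have "v p \<tau> = v p \<rho>" using v_prefix[OF M that(3)] by (rule ext)
    moreover have "M p \<le> length \<tau>" using M prefix_length_le[OF that(3)] by simp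
    ultimately have "ctest p \<tau> B" using p(2) unfolding ctest_iff by simp
    then show ?thesis using p(1) that(2) unfolding cert_char by (intro exI[of _ p]) simp
  qed
  have K_mono: "K t c \<zeta> \<tau>" if "K s c \<xi> \<rho>" "s \<le> t" "prefix \<xi> \<zeta>" "prefix \<rho> \<tau>" for s t c \<xi> \<zeta> \<rho> \<tau>
  proof (cases "kill s \<rho>")
    case True
    then show ?thesis using kill_mono that unfolding K_char by blast
  next
    case False
    then obtain x where "x < s" "En s c x" "prefix (snd (pair x)) \<xi>" "cert s \<rho> (fst (pair x))"
      using \<open>K s c \<xi> \<rho>\<close> unfolding K_char by blast
    then have "x < t" "En t c x" "prefix (snd (pair x)) \<zeta>" "cert t \<tau> (fst (pair x))"
      using that(2) En_mono[OF _ that(2)] cert_mono[OF _ that(2,4)] prefix_order.trans[OF _ that(3)]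
      by simp_all
    then show ?thesis unfolding K_char by blast
  qed
  have cert_iff: "f Y \<in> basic_open B \<longleftrightarrow> (\<exists>n. cert n (Y \<restriction> n) B)" for Y B
  proof
    assume "\<exists>n. cert n (Y \<restriction> n) B"
    then obtain n p where c: "ctest p (Y \<restriction> n) B" unfolding cert_char by blast
    then have p: "M p \<le> n" by (simp add: ctest_iff)
    have "dyadic_val l < measure (f Y) (cylinder \<tau>) \<and> measure (f Y) (cylinder \<tau>) < dyadic_val u"
      if "(\<tau>, l, u) \<in> set B" for \<tau> l u
    proof -
      have "length \<tau> \<le> p \<and> dyadic_val l + (1/2) ^ p < dyadic_val (v p (Y \<restriction> n) \<tau>) \<and>
          dyadic_val (v p (Y \<restriction> n) \<tau>) + (1/2) ^ p < dyadic_val u"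
        using c that unfolding ctest_iff by auto
      with approx[OF p, of \<tau> Y] show ?thesis by linarith
    qed
    then show "f Y \<in> basic_open B" unfolding basic_open_iff using f_measures by auto
  next
    assume Y: "f Y \<in> basic_open B"
    define N where "N = Max (insert 0 ((\<lambda>b. length (fst b)) ` set B))"
    have N: "length \<tau> \<le> N" if "(\<tau>, l, u) \<in> set B" for \<tau> l u
      unfolding N_def using that by (intro Max_ge) force+
    obtain p0 where p0: "\<And>n. p0 \<le> n \<Longrightarrow> margin (\<lambda>\<sigma>. measure (f Y) (cylinder \<sigma>)) (2 * (1/2) ^ n) B"
      using basic_open_margin[OF Y] unfolding eventually_sequentially by blast
    \<comment> \<open>The available margin is twice 2^-(p-1), that is 4 * 2^-p, which exceeds the
      error of \<open>v\<close> and the gap demanded by \<open>ctest\<close> together.\<close>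
    define p where "p = N + Suc p0"
    define n where "n = Suc p + M p"
    have "dyadic_val l + (1/2) ^ p < dyadic_val (v p (Y \<restriction> n) \<tau>) \<and>
        dyadic_val (v p (Y \<restriction> n) \<tau>) + (1/2) ^ p < dyadic_val u \<and> length \<tau> \<le> p" if "(\<tau>, l, u) \<in> set B" for \<tau> l u
    proof -
      have "length \<tau> \<le> p" using N[OF that] by (simp add: p_def)
      moreover from this have "\<bar>dyadic_val (v p (Y \<restriction> n) \<tau>) - measure (f Y) (cylinder \<tau>)\<bar> \<le> (1/2) ^ p"
        by (intro approx) (simp_all add: n_def)
      moreover have "dyadic_val l + 2 * (1/2) ^ (p - 1) \<le> measure (f Y) (cylinder \<tau>)"
        "measure (f Y) (cylinder \<tau>) \<le> dyadic_val u - 2 * (1/2) ^ (p - 1)"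
        using p0[of "p - 1"] that unfolding margin_def by (auto simp: p_def)
      moreover have "2 * (1/2::real) ^ (p - 1) = 4 * (1/2) ^ p" "(0::real) < (1/2) ^ p" by (simp_all add: p_def)
      ultimately show ?thesis by linarith
    qed
    then have "\<forall>(\<tau>, l, u)\<in>set B. length \<tau> \<le> p \<and> dyadic_val l + (1/2) ^ p < dyadic_val (v p (Y \<restriction> n) \<tau>) \<and>
        dyadic_val (v p (Y \<restriction> n) \<tau>) + (1/2) ^ p < dyadic_val u" by auto
    then have "ctest p (Y \<restriction> n) B" unfolding ctest_iff by (simp add: n_def)
    moreover have "p < n" by (simp add: n_def)
    ultimately have "cert n (Y \<restriction> n) B" unfolding cert_char by blast
    then show "\<exists>n. cert n (Y \<restriction> n) B" ..
  qed
  have gt_iff: "d (f Y) X > enat c \<longleftrightarrow> (\<exists>(B, \<sigma>)\<in>W c. f Y \<in> basic_open B \<and> X \<in> cylinder \<sigma>)" for Y X c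
    using W[OF f_measures[of Y], of c] mem_test_section[of X "W c" "f Y"] by blast
  have K_iff: "(Y \<in> D \<longrightarrow> d (f Y) X > enat c) \<longleftrightarrow> (\<exists>n. K n c (X \<restriction> n) (Y \<restriction> n))" for X Y c
  proof
    assume "\<exists>n. K n c (X \<restriction> n) (Y \<restriction> n)"
    then obtain n where "K n c (X \<restriction> n) (Y \<restriction> n)" ..
    then consider "Y \<notin> D" | x where "En n c x" "prefix (snd (pair x)) (X \<restriction> n)" "cert n (Y \<restriction> n) (fst (pair x))"
      using kill_iff unfolding K_char by blast
    then show "Y \<in> D \<longrightarrow> d (f Y) X > enat c"
    proof cases
      case 2
      then obtain b where b: "x = enc b" "b \<in> W c" using En_iff by blast
      then have "f Y \<in> basic_open (fst b)" "X \<in> cylinder (snd b)"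
        using 2 cert_iff by (auto simp: prefix_initial_iff pair_def)
      with b(2) show ?thesis unfolding gt_iff by (intro impI bexI[of _ b]) (simp_all add: case_prod_unfold)
    qed simp
  next
    assume *: "Y \<in> D \<longrightarrow> d (f Y) X > enat c"
    show "\<exists>n. K n c (X \<restriction> n) (Y \<restriction> n)"
    proof (cases "Y \<in> D")
      case True
      with * obtain B \<sigma> where B: "(B, \<sigma>) \<in> W c" "f Y \<in> basic_open B" "X \<in> cylinder \<sigma>"
        unfolding gt_iff by blast
      obtain s where s: "En s c (enc (B, \<sigma>))" using B(1) En_iff by blast
      obtain r where r: "cert r (Y \<restriction> r) B" using B(2) cert_iff by blast
      define n where "n = s + r + length \<sigma> + Suc (enc (B, \<sigma>))"
      have "En n c (enc (B, \<sigma>))" using En_mono[OF s] by (simp add: n_def)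
      moreover have "cert n (Y \<restriction> n) B" using cert_mono[OF r] by (simp add: n_def prefix_initial)
      moreover have "prefix \<sigma> (X \<restriction> n)" using B(3) by (simp add: prefix_initial_iff n_def)
      moreover have "enc (B, \<sigma>) < n" by (simp add: n_def)
      ultimately have "K n c (X \<restriction> n) (Y \<restriction> n)" unfolding K_char
        by (intro disjI2 exI[of _ "enc (B, \<sigma>)"]) (simp add: pair_def)
      then show ?thesis ..
    qed (use kill_iff in \<open>auto simp: K_char\<close>)
  qed
  define alive where "alive c \<xi> = filter (\<lambda>\<rho>. \<not> K (length \<xi>) c \<xi> \<rho>) (strings (length \<xi>))" for c \<xi>
  define level where "level \<xi> = hd (filter (\<lambda>c. alive c \<xi> \<noteq> []) [0..<length \<xi>])" for \<xi>
  define common where "common \<xi> j \<longleftrightarrow> list_all (\<lambda>\<rho>. take j \<rho> = take j (hd (alive (level \<xi>) \<xi>))) (alive (level \<xi>) \<xi>)" for \<xi> j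
  define G where "G \<xi> = take (largest (common \<xi>) (length \<xi>)) (hd (alive (level \<xi>) \<xi>))" for \<xi>
  have eff_alive: "effective (\<lambda>q. alive (fst q) (snd q))"
    unfolding alive_def by (intro eff effective_comp4[OF eff_K])
  have eff_level: "effective level"
    unfolding level_def by (intro eff effective_comp2[OF eff_alive])
  have eff_common: "effective (\<lambda>q. common (fst q) (snd q))"
    unfolding common_def by (intro eff effective_comp2[OF eff_alive] eff_level[THEN effective_comp])
  have eff_G: "effective G"
    unfolding G_def by (intro eff effective_comp2[OF eff_common] effective_comp2[OF eff_alive] eff_level[THEN effective_comp])
  have "\<forall>\<^sub>F n in sequentially. \<exists>j\<ge>k. G (X \<restriction> n) = Z \<restriction> j" if Z: "Z \<in> D" "random_wrt (f Z) X" for X Z k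
  proof -
    define ok where "ok c \<longleftrightarrow> (\<exists>Y\<in>D. d (f Y) X \<le> enat c)" for c
    have "d (f Z) X < \<infinity>" using Z(2) by (simp add: random_iff)
    then obtain c\<^sub>0 where "d (f Z) X = enat c\<^sub>0" by auto
    then have "ok c\<^sub>0" using Z(1) unfolding ok_def by (intro bexI[of _ Z]) simp_all
    define c where "c = (LEAST c. ok c)"
    have "ok c" unfolding c_def using \<open>ok c\<^sub>0\<close> by (rule LeastI)
    then obtain Y where Y: "Y \<in> D" "d (f Y) X \<le> enat c" unfolding ok_def by blast
    have only: "Y = Z" if "Y \<in> D" "d (f Y) X \<le> enat c'" for Y c'
    proof -
      have "random_wrt (f Y) X" using le_less_trans[OF that(2), of \<infinity>] by (simp add: random_iff)
      with that(1) Z show ?thesis using random_unique by blast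
    qed
    have K_prefix: "K (length \<tau>) c' (X \<restriction> length \<tau>) \<tau>"
      if "K (length \<rho>) c' (X \<restriction> length \<rho>) \<rho>" "prefix \<rho> \<tau>" for c' \<rho> \<tau>
      using K_mono[OF that(1) _ _ that(2)] prefix_length_le[OF that(2)] by (simp add: prefix_initial)
    have dead: "\<forall>\<^sub>F n in sequentially. alive c' (X \<restriction> n) = []" if "c' < c" for c'
    proof -
      have "\<exists>N. \<forall>\<rho>. N \<le> length \<rho> \<longrightarrow> K (length \<rho>) c' (X \<restriction> length \<rho>) \<rho>"
      proof (rule fan_theorem[OF K_prefix])
        fix Y
        have "\<not> ok c'" using that not_less_Least unfolding c_def by blast
        then have "Y \<in> D \<longrightarrow> d (f Y) X > enat c'" unfolding ok_def by auto
        then show "\<exists>n. K (length (Y \<restriction> n)) c' (X \<restriction> length (Y \<restriction> n)) (Y \<restriction> n)" unfolding K_iff by simp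
      qed
      then obtain N where N: "\<And>\<rho>. N \<le> length \<rho> \<Longrightarrow> K (length \<rho>) c' (X \<restriction> length \<rho>) \<rho>" by blast
      have "alive c' (X \<restriction> n) = []" if "N \<le> n" for n
        using N that unfolding alive_def by (auto simp: filter_empty_conv)
      then show ?thesis unfolding eventually_sequentially by blast
    qed
    then have all_dead: "\<forall>\<^sub>F n in sequentially. \<forall>c'\<in>{..<c}. alive c' (X \<restriction> n) = []"
      by (intro eventually_ball_finite) auto
    obtain N where N: "\<And>\<rho>. N \<le> length \<rho> \<Longrightarrow> \<not> K (length \<rho>) c (X \<restriction> length \<rho>) \<rho> \<Longrightarrow> take k \<rho> = Z \<restriction> k"
    proof (rule alive_strings_agree[of "\<lambda>\<rho>. K (length \<rho>) c (X \<restriction> length \<rho>) \<rho>" Z k])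
      show "K (length \<tau>) c (X \<restriction> length \<tau>) \<tau>" if "K (length \<rho>) c (X \<restriction> length \<rho>) \<rho>" "prefix \<rho> \<tau>" for \<rho> \<tau>
        using that by (rule K_prefix)
      show "\<exists>n. K (length (Y \<restriction> n)) c (X \<restriction> length (Y \<restriction> n)) (Y \<restriction> n)" if "Y \<noteq> Z" for Y
        using only[of Y c] that K_iff[where Y = Y and X = X and c = c] by force
    qed blast
    from all_dead eventually_gt_at_top[of c] eventually_ge_at_top[of N] eventually_ge_at_top[of k] show ?thesis
    proof eventually_elim
      case (elim n)
      have "\<not> K n c (X \<restriction> n) (Z \<restriction> n)" using K_iff[where Y = Z and X = X and c = c] only[OF Y] Y(2) Z(1) by auto
      then have mem: "Z \<restriction> n \<in> set (alive c (X \<restriction> n))" by (simp add: alive_def)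
      then have "alive c (X \<restriction> n) \<noteq> []" by auto
      then have level: "level (X \<restriction> n) = c"
        unfolding level_def using elim by (intro hd_filter_upt) auto
      let ?A = "alive c (X \<restriction> n)"
      have A: "length \<rho> = n \<and> take k \<rho> = Z \<restriction> k" if "\<rho> \<in> set ?A" for \<rho>
        using that N[of \<rho>] elim by (auto simp: alive_def)
      have hd: "hd ?A \<in> set ?A" using mem by (cases ?A) auto
      have "common (X \<restriction> n) k" unfolding common_def level list_all_iff using A hd by auto
      then have l: "common (X \<restriction> n) (largest (common (X \<restriction> n)) n)" "k \<le> largest (common (X \<restriction> n)) n"
        "largest (common (X \<restriction> n)) n \<le> n"
        using elim largest[of "common (X \<restriction> n)" k n] by auto
      have "G (X \<restriction> n) = take (largest (common (X \<restriction> n)) n) (hd ?A)"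
        unfolding G_def level by simp
      also have "\<dots> = take (largest (common (X \<restriction> n)) n) (Z \<restriction> n)"
        using l(1) mem unfolding common_def[of _ "largest _ _"] level list_all_iff by auto
      also have "\<dots> = Z \<restriction> largest (common (X \<restriction> n)) n" using l(3) by simp
      finally show ?case using l(2) by blast
    qed
  qed
  with eff_G show thesis by (rule that)
qed

text \<open>Strings seen to leave \<open>D\<close> are ruled out, and so are those whose image
  visibly disagrees with the values given by \<open>e\<close>. If \<open>e\<close> is an index of
  \<open>f Z\<close>, then \<open>Z\<close> survives and every other member of \<open>D\<close>
  falls, as its image differs on some cylinder. A bit is output once all survivors agree on it; for
  other \<open>e\<close> nothing is claimed about the output.\<close>

lemma measure_index_to_real_index:
  assumes \<phi>: "acceptable_numbering {0, 1} \<phi>" and m: "acceptable_numbering UNIV m"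
  obtains h where "effective h"
    "\<And>e Z. Z \<in> D \<Longrightarrow> measure_index m e (f Z) \<Longrightarrow> real_index \<phi> (h e) Z"
proof -
  obtain M v where M: "effective M" and v: "effective (\<lambda>q. v (fst q) (fst (snd q)) (snd (snd q)))"
    and approx: "\<And>p Z n \<sigma>. M p \<le> n \<Longrightarrow> length \<sigma> \<le> p \<Longrightarrow>
       \<bar>dyadic_val (v p (Z \<restriction> n) \<sigma>) - measure (f Z) (cylinder \<sigma>)\<bar> \<le> (1/2) ^ p"
    and v_prefix: "\<And>p \<rho> \<tau> \<sigma>. M p \<le> length \<rho> \<Longrightarrow> prefix \<rho> \<tau> \<Longrightarrow> v p \<tau> \<sigma> = v p \<rho> \<sigma>"
    by (rule computable_measure_map_evaluation[OF f_computable]) blast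
  obtain kill where kill: "effective (\<lambda>q. kill (fst q) (snd q))"
    and kill_mono: "\<And>s t \<rho> \<tau>. kill s \<rho> \<Longrightarrow> s \<le> t \<Longrightarrow> prefix \<rho> \<tau> \<Longrightarrow> kill t \<tau>"
    and kill_iff: "\<And>Y. Y \<notin> D \<longleftrightarrow> (\<exists>n. kill n (Y \<restriction> n))"
    by (rule complement_stages) blast
  obtain st :: "nat \<Rightarrow> nat \<Rightarrow> nat \<Rightarrow> nat option" where
    st: "effective (\<lambda>q. st (fst q) (fst (snd q)) (snd (snd q)))"
    "\<And>s t e x y. st s e x = Some y \<Longrightarrow> s \<le> t \<Longrightarrow> st t e x = Some y"
    "\<And>e x y. m e x = Some y \<longleftrightarrow> (\<exists>s. st s e x = Some y)"
    by (rule acceptable_numbering_stages[OF m]) blast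
  \<comment> \<open>Both approximations are off by at most 2^-p, so a distance beyond 2 * 2^-p
    proves the measures different.\<close>
  define far where "far p q r \<longleftrightarrow> dless (dadd r (2, p)) q \<or> dless (dadd q (2, p)) r" for p q r
  have far_iff: "far p q r \<longleftrightarrow> \<bar>dyadic_val q - dyadic_val r\<bar> > 2 * (1/2) ^ p" for p q r
  proof -
    have "dyadic_val (2, p) = 2 * (1/2) ^ p" by (simp add: dyadic_val_def power_divide)
    then show ?thesis unfolding far_def dless_iff dyadic_val_dadd by linarith
  qed
  define differ where "differ s e \<rho> \<longleftrightarrow> list_ex (\<lambda>p. M p \<le> length \<rho> \<and> list_ex (\<lambda>k. list_ex (\<lambda>\<sigma>.
      st s e (prod_encode (enc \<sigma>, p)) \<noteq> None \<and> far p (v p \<rho> \<sigma>) (dec (the (st s e (prod_encode (enc \<sigma>, p))))))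
      (strings k)) [0..<Suc p]) [0..<s]" for s e \<rho>
  have differ_iff: "differ s e \<rho> \<longleftrightarrow> (\<exists>p \<sigma> y. p < s \<and> M p \<le> length \<rho> \<and> length \<sigma> \<le> p \<and>
      st s e (prod_encode (enc \<sigma>, p)) = Some y \<and> far p (v p \<rho> \<sigma>) (dec y))" for s e \<rho>
  proof -
    have "st s e (prod_encode (enc \<sigma>, p)) \<noteq> None \<and> far p (v p \<rho> \<sigma>) (dec (the (st s e (prod_encode (enc \<sigma>, p))))) \<longleftrightarrow>
        (\<exists>y. st s e (prod_encode (enc \<sigma>, p)) = Some y \<and> far p (v p \<rho> \<sigma>) (dec y))" for p \<sigma>
      by (cases "st s e (prod_encode (enc \<sigma>, p))") auto
    then show ?thesis unfolding differ_def list_ex_strings_le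
      by (simp only: list_ex_iff set_upt Bex_def atLeastLessThan_iff le0 simp_thms) blast
  qed
  define alive where "alive s e = filter (\<lambda>\<rho>. \<not> (kill s \<rho> \<or> differ s e \<rho>)) (strings s)" for s e
  define P where "P e n s \<longleftrightarrow> n < s \<and> (list_all (\<lambda>\<rho>. hd (drop n \<rho>)) (alive s e) \<or> list_all (\<lambda>\<rho>. \<not> hd (drop n \<rho>)) (alive s e))" for e n s
  define F where "F e n s = (if list_all (\<lambda>\<rho>. hd (drop n \<rho>)) (alive s e) then 1 else 0 :: nat)" for e n s
  have eff_differ: "effective (\<lambda>q. differ (fst q) (fst (snd q)) (snd (snd q)))"
    unfolding differ_def far_def by (intro eff M[THEN effective_comp] effective_comp3[OF v] effective_comp3[OF st(1)])
  have eff_alive: "effective (\<lambda>q. alive (fst q) (snd q))"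
    unfolding alive_def by (intro eff effective_comp2[OF kill] effective_comp3[OF eff_differ])
  have "effective (\<lambda>q. P (fst q) (fst (snd q)) (snd (snd q)))" "effective (\<lambda>q. F (fst q) (fst (snd q)) (snd (snd q)))"
    unfolding P_def F_def by (intro eff effective_comp2[OF eff_alive])+
  moreover have "F e n s \<in> {0, 1}" for e n s by (simp add: F_def)
  ultimately obtain h where h: "effective h"
    "\<And>e x. \<phi> (h e) x = (if \<exists>s. P e x s then Some (F e x (LEAST s. P e x s)) else None)"
    using acceptable_numbering_translate[OF \<phi>, of P F] by blast
  have "real_index \<phi> (h e) Z" if Z: "Z \<in> D" and e: "measure_index m e (f Z)" for e Z
    unfolding real_index_def
  proof
    fix n
    have me: "\<bar>dyadic_val (dec y) - measure (f Z) (cylinder \<sigma>)\<bar> < (1/2) ^ p"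
      if "st s e (prod_encode (enc \<sigma>, p)) = Some y" for s \<sigma> p y
    proof -
      obtain q where q: "m e (prod_encode (enc \<sigma>, p)) = Some (enc q)" "\<bar>dyadic_val q - measure (f Z) (cylinder \<sigma>)\<bar> < (1/2) ^ p"
        using e unfolding measure_index_iff by blast
      have "m e (prod_encode (enc \<sigma>, p)) = Some y" using st(3) that by blast
      with q show ?thesis by auto
    qed
    have sound: "\<not> differ s e (Z \<restriction> s)" for s
    proof
      assume "differ s e (Z \<restriction> s)"
      then obtain p \<sigma> y where p: "M p \<le> s" "length \<sigma> \<le> p" "st s e (prod_encode (enc \<sigma>, p)) = Some y"
        and far: "far p (v p (Z \<restriction> s) \<sigma>) (dec y)" unfolding differ_iff by auto
      from far approx[OF p(1,2), of Z] me[OF p(3)] show False unfolding far_iff by linarith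
    qed
    have "\<not> kill s (Z \<restriction> s)" for s using Z kill_iff by blast
    with sound have Z_alive: "Z \<restriction> s \<in> set (alive s e)" for s unfolding alive_def by simp
    define K where "K \<rho> \<longleftrightarrow> kill (length \<rho>) \<rho> \<or> differ (length \<rho>) e \<rho>" for \<rho>
    obtain N where N: "Suc n \<le> N" "\<And>\<rho>. N \<le> length \<rho> \<Longrightarrow> \<not> K \<rho> \<Longrightarrow> take (Suc n) \<rho> = Z \<restriction> Suc n"
    proof (rule alive_strings_agree[of K Z "Suc n"])
      show "K \<tau>" if "K \<rho>" "prefix \<rho> \<tau>" for \<rho> \<tau>
      proof -
        have le: "length \<rho> \<le> length \<tau>" using that(2) by (rule prefix_length_le)
        have "differ (length \<tau>) e \<tau>" if d: "differ (length \<rho>) e \<rho>"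
        proof -
          obtain p \<sigma> y where p: "p < length \<rho>" "M p \<le> length \<rho>" "length \<sigma> \<le> p"
            "st (length \<rho>) e (prod_encode (enc \<sigma>, p)) = Some y" "far p (v p \<rho> \<sigma>) (dec y)"
            using d unfolding differ_iff by auto
          have "v p \<tau> \<sigma> = v p \<rho> \<sigma>" using p(2) \<open>prefix \<rho> \<tau>\<close> by (rule v_prefix)
          then show ?thesis unfolding differ_iff using p st(2)[OF p(4) le] le
            by - (rule exI[of _ p], rule exI[of _ \<sigma>], rule exI[of _ y], simp)
        qed
        then show ?thesis using that kill_mono le unfolding K_def by blast
      qed
      show "\<exists>n. K (Y \<restriction> n)" if "Y \<noteq> Z" for Y
      proof (cases "Y \<in> D")
        case True
        then obtain \<sigma> where \<sigma>: "measure (f Y) (cylinder \<sigma>) \<noteq> measure (f Z) (cylinder \<sigma>)"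
          using distinct_images_on_cylinder Z \<open>Y \<noteq> Z\<close> by blast
        have "(\<lambda>n. (1/2::real) ^ n) \<longlonglongrightarrow> 0" by (rule LIMSEQ_power_zero) simp
        from tendsto_mult_left[OF this, of 4] have "(\<lambda>n. 4 * (1/2::real) ^ n) \<longlonglongrightarrow> 0" by simp
        \<comment> \<open>Two errors of size 2^-p are subtracted from the true distance, and the
          rest must still exceed the threshold 2 * 2^-p of \<open>far\<close>; this accounts for the
          factor 4.\<close>
        then have "\<forall>\<^sub>F p in sequentially. 4 * (1/2::real) ^ p < \<bar>measure (f Y) (cylinder \<sigma>) - measure (f Z) (cylinder \<sigma>)\<bar>"
          by (rule order_tendstoD(2)) (use \<sigma> in simp)
        from eventually_happens'[OF sequentially_bot eventually_conj[OF this eventually_ge_at_top[of "length \<sigma>"]]]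
        obtain p where p: "4 * (1/2::real) ^ p < \<bar>measure (f Y) (cylinder \<sigma>) - measure (f Z) (cylinder \<sigma>)\<bar>" "length \<sigma> \<le> p"
          by blast
        obtain s y where s: "st s e (prod_encode (enc \<sigma>, p)) = Some y"
          using e st(3) unfolding measure_index_iff by metis
        define n where "n = s + M p + Suc p"
        have "st n e (prod_encode (enc \<sigma>, p)) = Some y" using st(2)[OF s] by (simp add: n_def)
        moreover have "far p (v p (Y \<restriction> n) \<sigma>) (dec y)"
        proof -
          have "\<bar>dyadic_val (v p (Y \<restriction> n) \<sigma>) - measure (f Y) (cylinder \<sigma>)\<bar> \<le> (1/2) ^ p"
            by (rule approx) (simp_all add: n_def p)
          with p(1) me[OF s] show ?thesis unfolding far_iff by linarith
        qed
        ultimately have "differ n e (Y \<restriction> n)" unfolding differ_iff using p(2)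
          by - (rule exI[of _ p], rule exI[of _ \<sigma>], rule exI[of _ y], simp add: n_def)
        then show ?thesis unfolding K_def by (intro exI[of _ n]) simp
      next
        case False
        then show ?thesis using kill_iff unfolding K_def by force
      qed
    qed blast
    have nth: "hd (drop n \<rho>) = \<rho> ! n" if "n < length \<rho>" for \<rho> :: bitstring using that by (rule hd_drop_conv_nth)
    have P_iff: "P e n s \<Longrightarrow> F e n s = of_bool (Z n)" for s
    proof -
      assume P: "P e n s"
      then have "n < s" by (simp add: P_def)
      then have "hd (drop n (Z \<restriction> s)) = Z n" by (simp add: nth)
      with P Z_alive[of s] show ?thesis unfolding P_def F_def list_all_iff by force
    qed
    have "P e n N"
    proof -
      have "hd (drop n \<rho>) = Z n" if "\<rho> \<in> set (alive N e)" for \<rho>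
      proof -
        have \<rho>: "length \<rho> = N" "\<not> K \<rho>" using that by (auto simp: alive_def K_def)
        then have "take (Suc n) \<rho> ! n = (Z \<restriction> Suc n) ! n" using N(2)[of \<rho>] by simp
        then show ?thesis using \<rho>(1) N(1) by (simp add: nth)
      qed
      then show ?thesis unfolding P_def list_all_iff using N(1) by (cases "Z n") auto
    qed
    then have "\<exists>s. P e n s" ..
    moreover from this have "P e n (LEAST s. P e n s)" by (rule LeastI_ex)
    ultimately show "\<phi> (h e) n = Some (of_bool (Z n))" unfolding h(2) using P_iff by simp
  qed
  with h(1) show thesis by (rule that)
qed

end


section \<open>The four transfers of learnability\<close>

section \<open>Transferring learners\<close>

context orthogonal_images
begin

lemma sets_all_initial:
  "{X. \<forall>j\<ge>t. Q (X \<restriction> j)} \<in> sets borel" "{X. \<forall>j\<in>{t..k}. Q (X \<restriction> j)} \<in> sets borel"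
proof -
  have "{X. Q (X \<restriction> j)} \<in> sets borel" for j
  proof -
    have "{X. Q (X \<restriction> j)} = (\<Union>\<sigma>\<in>{\<sigma>. length \<sigma> = j \<and> Q \<sigma>}. cylinder \<sigma>)"
      by (auto simp: cylinder_def intro: length_initial[symmetric])
    then show ?thesis by simp
  qed
  then have "(\<Inter>j\<in>A. {X. Q (X \<restriction> j)}) \<in> sets borel" for A
    by (cases "A = {}") (auto intro: sets.countable_INT')
  moreover have "{X. \<forall>j\<ge>t. Q (X \<restriction> j)} = (\<Inter>j\<in>{t..}. {X. Q (X \<restriction> j)})"
    "{X. \<forall>j\<in>{t..k}. Q (X \<restriction> j)} = (\<Inter>j\<in>{t..k}. {X. Q (X \<restriction> j)})" by auto
  ultimately show "{X. \<forall>j\<ge>t. Q (X \<restriction> j)} \<in> sets borel" "{X. \<forall>j\<in>{t..k}. Q (X \<restriction> j)} \<in> sets borel"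
    by simp_all
qed

text \<open>The composite learner feeds approximations to \<open>Z\<close> into \<open>L\<close> and
  translates the resulting index. The initial segments supplied by \<open>G\<close> need not grow
  steadily, but their lengths eventually exceed every bound, and this is enough for the
  limit.\<close>

lemma EX_reals_to_measures:
  assumes "acceptable_numbering V \<phi>" "acceptable_numbering UNIV m" "C \<subseteq> D" "EX_learnable_reals \<phi> C"
  shows "EX_learnable_measures m (f ` C)"
proof -
  obtain h where h: "effective h" "\<And>e Z. real_index \<phi> e Z \<Longrightarrow> measure_index m (h e) (f Z)"
    using real_index_to_measure_index[OF assms(1,2) f_computable] by blast
  obtain G where G: "effective G"
    "\<And>X Z k. Z \<in> D \<Longrightarrow> random_wrt (f Z) X \<Longrightarrow> \<forall>\<^sub>F n in sequentially. \<exists>j\<ge>k. G (X \<restriction> n) = Z \<restriction> j"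
    by (rule limit_recovery) blast
  obtain L where L: "effective L" "\<And>Z. Z \<in> C \<Longrightarrow> \<exists>e. (\<lambda>n. L (Z \<restriction> n)) \<longlonglongrightarrow> e \<and> real_index \<phi> e Z"
    using assms(4) unfolding EX_learnable_reals_def computable_learner_iff by blast
  have "\<exists>e. (\<lambda>n. h (L (G (X \<restriction> n)))) \<longlonglongrightarrow> e \<and> (\<exists>\<mu>'\<in>f ` C. measure_index m e \<mu>' \<and> random_wrt \<mu>' X)"
    if Z: "Z \<in> C" and X: "random_wrt (f Z) X" for Z X
  proof -
    obtain e where e: "(\<lambda>n. L (Z \<restriction> n)) \<longlonglongrightarrow> e" "real_index \<phi> e Z" using L(2)[OF Z] by blast
    obtain k where k: "\<And>n. k \<le> n \<Longrightarrow> L (Z \<restriction> n) = e"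
      using e(1) unfolding tendsto_discrete eventually_sequentially by blast
    have "\<forall>\<^sub>F n in sequentially. \<exists>j\<ge>k. G (X \<restriction> n) = Z \<restriction> j" using G(2) X Z assms(3) by blast
    then have "\<forall>\<^sub>F n in sequentially. h (L (G (X \<restriction> n))) = h e"
      by eventually_elim (use k in auto)
    then have "(\<lambda>n. h (L (G (X \<restriction> n)))) \<longlonglongrightarrow> h e" unfolding tendsto_discrete .
    with h(2)[OF e(2)] Z X show ?thesis by blast
  qed
  moreover have "effective (\<lambda>\<sigma>. h (L (G \<sigma>)))" by (intro effective_comp[OF h(1)] effective_comp[OF L(1)] G(1))
  ultimately show ?thesis unfolding EX_learnable_measures_def computable_learner_iff
    by (intro exI[of _ "\<lambda>\<sigma>. h (L (G \<sigma>))"]) blast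
qed

lemma BC_reals_to_measures:
  assumes "acceptable_numbering V \<phi>" "acceptable_numbering UNIV m" "C \<subseteq> D" "BC_learnable_reals \<phi> C"
  shows "BC_learnable_measures m (f ` C)"
proof -
  obtain h where h: "effective h" "\<And>e Z. real_index \<phi> e Z \<Longrightarrow> measure_index m (h e) (f Z)"
    using real_index_to_measure_index[OF assms(1,2) f_computable] by blast
  obtain G where G: "effective G"
    "\<And>X Z k. Z \<in> D \<Longrightarrow> random_wrt (f Z) X \<Longrightarrow> \<forall>\<^sub>F n in sequentially. \<exists>j\<ge>k. G (X \<restriction> n) = Z \<restriction> j"
    by (rule limit_recovery) blast
  obtain L where L: "effective L" "\<And>Z. Z \<in> C \<Longrightarrow> \<forall>\<^sub>F n in sequentially. real_index \<phi> (L (Z \<restriction> n)) Z"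
    using assms(4) unfolding BC_learnable_reals_def computable_learner_iff by blast
  have "\<exists>n0. \<exists>\<mu>'\<in>f ` C. random_wrt \<mu>' X \<and> (\<forall>n>n0. measure_index m (h (L (G (X \<restriction> n)))) \<mu>')"
    if Z: "Z \<in> C" and X: "random_wrt (f Z) X" for Z X
  proof -
    obtain k where k: "\<And>n. k \<le> n \<Longrightarrow> real_index \<phi> (L (Z \<restriction> n)) Z"
      using L(2)[OF Z] unfolding eventually_sequentially by blast
    have "\<forall>\<^sub>F n in sequentially. \<exists>j\<ge>k. G (X \<restriction> n) = Z \<restriction> j" using G(2) X Z assms(3) by blast
    then have "\<forall>\<^sub>F n in sequentially. measure_index m (h (L (G (X \<restriction> n)))) (f Z)"
      by eventually_elim (use k h(2) in auto)
    then obtain n0 where "\<forall>n>n0. measure_index m (h (L (G (X \<restriction> n)))) (f Z)"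
      unfolding eventually_sequentially by (meson less_imp_le)
    with Z X show ?thesis by blast
  qed
  moreover have "effective (\<lambda>\<sigma>. h (L (G \<sigma>)))" by (intro effective_comp[OF h(1)] effective_comp[OF L(1)] G(1))
  ultimately show ?thesis unfolding BC_learnable_measures_def computable_learner_iff
    by (intro exI[of _ "\<lambda>\<sigma>. h (L (G \<sigma>))"]) blast
qed

text \<open>
  A hypothesis \<open>(e, t)\<close> asserts that with probability at least \<open>2\<^sup>-\<^sup>t\<close> the learner outputs \<open>e\<close> from
  stage \<open>t\<close> on. False hypotheses are refuted in finite time, and true ones provide an index, since
  a set of positive measure has a random member. So it suffices to follow the least hypothesis not
  refuted so far.
\<close>

lemma EX_measures_to_reals:
  assumes \<phi>: "acceptable_numbering {0, 1} \<phi>" and m: "acceptable_numbering UNIV m"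
    and "C \<subseteq> D" "EX_learnable_measures m (f ` C)"
  shows "EX_learnable_reals \<phi> C"
proof -
  obtain h where h: "effective h" "\<And>e Z. Z \<in> D \<Longrightarrow> measure_index m e (f Z) \<Longrightarrow> real_index \<phi> (h e) Z"
    using measure_index_to_real_index[OF \<phi> m] by blast
  obtain M v where M: "effective M" and v: "effective (\<lambda>q. v (fst q) (fst (snd q)) (snd (snd q)))"
    and approx: "\<And>p Z n \<sigma>. M p \<le> n \<Longrightarrow> length \<sigma> \<le> p \<Longrightarrow>
       \<bar>dyadic_val (v p (Z \<restriction> n) \<sigma>) - measure (f Z) (cylinder \<sigma>)\<bar> \<le> (1/2) ^ p"
    and v_prefix: "\<And>p \<rho> \<tau> \<sigma>. M p \<le> length \<rho> \<Longrightarrow> prefix \<rho> \<tau> \<Longrightarrow> v p \<tau> \<sigma> = v p \<rho> \<sigma>"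
    by (rule computable_measure_map_evaluation[OF f_computable]) blast
  obtain L where L: "effective L" and learn: "\<And>Z X. Z \<in> C \<Longrightarrow> random_wrt (f Z) X \<Longrightarrow>
      \<exists>e. (\<lambda>n. L (X \<restriction> n)) \<longlonglongrightarrow> e \<and> (\<exists>Y\<in>C. measure_index m e (f Y) \<and> random_wrt (f Y) X)"
    using assms(4) unfolding EX_learnable_measures_def computable_learner_iff by blast
  define obey where "obey e t k = filter (\<lambda>\<sigma>. list_all (\<lambda>j. L (take j \<sigma>) = e) [t..<Suc k]) (strings k)" for e t k
  \<comment> \<open>The weights of the strings are known up to 2^-2k, hence their sum up to 2^-k;
    adding this error makes a refutation sound. The sets obeying up to length \<open>k\<close>
    shrink to the set obeying forever, so every false hypothesis is refuted by some
    \<open>k\<close>.\<close>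
  define refuted where "refuted \<rho> e t \<longleftrightarrow> list_ex (\<lambda>k. M (2 * k) \<le> length \<rho> \<and>
      dless (dadd (dyadic_sum (map (v (2 * k) \<rho>) (obey e t k))) (1, k)) (1, t)) [0..<length \<rho>]" for \<rho> e t
  define hyps where "hyps \<rho> = filter (\<lambda>i. \<not> refuted \<rho> (fst (prod_decode i)) (snd (prod_decode i))) [0..<length \<rho>]" for \<rho>
  define L' where "L' \<rho> = h (fst (prod_decode (hd (hyps \<rho>))))" for \<rho>
  have eff_obey: "effective (\<lambda>q. obey (fst q) (fst (snd q)) (snd (snd q)))"
    unfolding obey_def by (intro eff L[THEN effective_comp])
  have eff_refuted: "effective (\<lambda>q. refuted (fst q) (fst (snd q)) (snd (snd q)))"
    unfolding refuted_def by (intro eff M[THEN effective_comp] effective_comp3[OF v] effective_comp3[OF eff_obey])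
  have "effective L'"
    unfolding L'_def hyps_def by (intro eff h(1)[THEN effective_comp] effective_comp3[OF eff_refuted])
  moreover have "\<exists>e. (\<lambda>n. L' (Z \<restriction> n)) \<longlonglongrightarrow> e \<and> real_index \<phi> e Z" if Z: "Z \<in> C" for Z
  proof -
    interpret prob_space "f Z" by (rule prob_space_f)
    define U where "U e t k = {X. \<forall>j\<in>{t..k}. L (X \<restriction> j) = e}" for e t k
    define S where "S e t = {X. \<forall>j\<ge>t. L (X \<restriction> j) = e}" for e t
    have U[simp]: "U e t k \<in> sets borel" and S[simp]: "S e t \<in> sets borel" for e t k
      unfolding U_def S_def by (rule sets_all_initial)+
    have S_INT: "S e t = (\<Inter>k. U e t k)" for e t unfolding S_def U_def by force
    have U_obey: "U e t k = (\<Union>\<sigma>\<in>set (obey e t k). cylinder \<sigma>)" for e t k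
    proof (intro set_eqI iffI)
      fix X assume "X \<in> U e t k"
      then have "X \<restriction> k \<in> set (obey e t k)" by (auto simp: U_def obey_def list_all_iff min_def)
      then show "X \<in> (\<Union>\<sigma>\<in>set (obey e t k). cylinder \<sigma>)" by (rule UN_I) simp
    next
      fix X assume "X \<in> (\<Union>\<sigma>\<in>set (obey e t k). cylinder \<sigma>)"
      then obtain \<sigma> where "\<sigma> \<in> set (obey e t k)" "X \<in> cylinder \<sigma>" by blast
      then have "X \<restriction> k \<in> set (obey e t k)" by (auto simp: obey_def cylinder_def)
      then show "X \<in> U e t k" by (auto simp: U_def obey_def list_all_iff min_def)
    qed
    have vsum: "\<bar>dyadic_val (dyadic_sum (map (v (2 * k) (Z \<restriction> n)) (obey e t k))) - prob (U e t k)\<bar> \<le> (1/2) ^ k"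
      if "M (2 * k) \<le> n" for n k e t
    proof -
      have "dyadic_val (dyadic_sum (map (v (2 * k) (Z \<restriction> n)) (obey e t k))) =
          (\<Sum>\<sigma>\<in>set (obey e t k). dyadic_val (v (2 * k) (Z \<restriction> n) \<sigma>))"
        unfolding dyadic_val_dyadic_sum map_map o_def
        by (rule sum_list_distinct_conv_sum_set) (simp add: obey_def distinct_strings)
      then show ?thesis unfolding U_obey
        by (simp only:, intro sum_measure_approx f_measures approx that) (auto simp: obey_def)
    qed
    have refuted_iff: "refuted (Z \<restriction> n) e t \<longleftrightarrow> (\<exists>k<n. M (2 * k) \<le> n \<and>
        dyadic_val (dyadic_sum (map (v (2 * k) (Z \<restriction> n)) (obey e t k))) + (1/2) ^ k < (1/2) ^ t)" for n e t
      unfolding refuted_def list_ex_iff by (auto simp: dyadic_val_inverse_power simp del: dyadic_val_dyadic_sum)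
    have refuted_mono: "refuted (Z \<restriction> n') e t" if "refuted (Z \<restriction> n) e t" "n \<le> n'" for n n' e t
    proof -
      obtain k where k: "k < n" "M (2 * k) \<le> n"
        "dyadic_val (dyadic_sum (map (v (2 * k) (Z \<restriction> n)) (obey e t k))) + (1/2) ^ k < (1/2) ^ t"
        using \<open>refuted (Z \<restriction> n) e t\<close> unfolding refuted_iff by blast
      have "v (2 * k) (Z \<restriction> n') = v (2 * k) (Z \<restriction> n)"
        using k(2) prefix_initial[OF \<open>n \<le> n'\<close>] by (intro ext v_prefix) simp_all
      with k \<open>n \<le> n'\<close> show ?thesis unfolding refuted_iff
        by - (rule exI[of _ k], simp del: dyadic_val_dyadic_sum)
    qed
    have never: "\<not> refuted (Z \<restriction> n) e t" if "(1/2) ^ t \<le> prob (S e t)" for n e t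
    proof
      assume "refuted (Z \<restriction> n) e t"
      then obtain k where k: "M (2 * k) \<le> n"
        "dyadic_val (dyadic_sum (map (v (2 * k) (Z \<restriction> n)) (obey e t k))) + (1/2) ^ k < (1/2) ^ t"
        unfolding refuted_iff by blast
      have "prob (S e t) \<le> prob (U e t k)"
        by (rule finite_measure_mono) (auto simp: sets_f S_INT simp del: S)
      with vsum[OF k(1), of e t] k(2) that show False by linarith
    qed
    have refutable: "\<exists>n. refuted (Z \<restriction> n) e t" if "prob (S e t) < (1/2) ^ t" for e t
    proof -
      have "(\<lambda>k. prob (U e t k)) \<longlonglongrightarrow> prob (\<Inter>k. U e t k)"
      proof (rule finite_Lim_measure_decseq)
        show "decseq (U e t)" by (auto simp: decseq_def U_def)
      qed (auto simp: sets_f)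
      moreover have "(\<lambda>k. (1/2::real) ^ k) \<longlonglongrightarrow> 0" by (rule LIMSEQ_power_zero) simp
      from tendsto_mult_left[OF this, of 2] have "(\<lambda>k. 2 * (1/2::real) ^ k) \<longlonglongrightarrow> 0" by simp
      ultimately have "(\<lambda>k. prob (U e t k) + 2 * (1/2) ^ k) \<longlonglongrightarrow> prob (S e t) + 0"
        unfolding S_INT by (rule tendsto_add)
      then have "\<forall>\<^sub>F k in sequentially. prob (U e t k) + 2 * (1/2) ^ k < (1/2) ^ t"
        by (rule order_tendstoD) (use that in simp)
      then obtain k where k: "prob (U e t k) + 2 * (1/2) ^ k < (1/2) ^ t"
        using eventually_happens'[OF sequentially_bot] by blast
      have "M (2 * k) \<le> Suc k + M (2 * k)" by simp
      from vsum[OF this, of e t] k show ?thesis unfolding refuted_iff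
        by - (rule exI[of _ "Suc k + M (2 * k)"], rule exI[of _ k], simp del: dyadic_val_dyadic_sum)
    qed
    have conv: "\<exists>e t. X \<in> S e t" if "random_wrt (f Z) X" for X
    proof -
      obtain e where "(\<lambda>n. L (X \<restriction> n)) \<longlonglongrightarrow> e" using learn[OF Z \<open>random_wrt (f Z) X\<close>] by blast
      then show ?thesis unfolding S_def tendsto_discrete eventually_sequentially by blast
    qed
    \<comment> \<open>The learner converges on every random real, so the countably many sets
      \<open>S e t\<close> cover a set of measure 1 and cannot all be null.\<close>
    have "\<exists>e t. prob (S e t) > 0"
    proof (rule ccontr)
      assume "\<not> ?thesis"
      then have 0: "prob (S e t) = 0" for e t using measure_nonneg[of "f Z" "S e t"] by (metis less_eq_real_def)
      have "prob (\<Union>i. S (fst (prod_decode i)) (snd (prod_decode i))) \<le>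
          (\<Sum>i. prob (S (fst (prod_decode i)) (snd (prod_decode i))))"
        by (rule finite_measure_subadditive_countably) (auto simp: 0 sets_f)
      then have "prob (\<Union>i. S (fst (prod_decode i)) (snd (prod_decode i))) \<le> 0" by (simp add: 0)
      moreover have "prob (\<Union>i. S (fst (prod_decode i)) (snd (prod_decode i))) = 1"
      proof (rule measure_f_covering)
        fix X assume "random_wrt (f Z) X"
        then obtain e t where "X \<in> S e t" using conv by blast
        then show "X \<in> (\<Union>i. S (fst (prod_decode i)) (snd (prod_decode i)))"
          by (intro UN_I[of "prod_encode (e, t)"]) auto
      qed auto
      ultimately show False by simp
    qed
    then obtain e t where pos: "prob (S e t) > 0" by blast
    have "(\<lambda>k. (1/2::real) ^ k) \<longlonglongrightarrow> 0" by (rule LIMSEQ_power_zero) simp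
    then have "\<forall>\<^sub>F k in sequentially. (1/2::real) ^ k < prob (S e t)" using pos by (rule order_tendstoD)
    from eventually_happens'[OF sequentially_bot eventually_conj[OF this eventually_ge_at_top[of t]]]
    obtain t' where t': "(1/2::real) ^ t' < prob (S e t)" "t \<le> t'" by blast
    \<comment> \<open>Raising \<open>t\<close> both postpones the stage and lowers the probability
      claimed by the hypothesis, so that one parameter can serve for both.\<close>
    have "prob (S e t) \<le> prob (S e t')"
    proof (rule finite_measure_mono)
      show "S e t \<subseteq> S e t'" unfolding S_def using t'(2) by auto
    qed (simp add: sets_f)
    then have "\<not> refuted (Z \<restriction> n) e t'" for n using t'(1) by (intro never) simp
    then have ex: "\<exists>i. \<forall>n. \<not> refuted (Z \<restriction> n) (fst (prod_decode i)) (snd (prod_decode i))"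
      by (intro exI[of _ "prod_encode (e, t')"]) simp
    define i where "i = (LEAST i. \<forall>n. \<not> refuted (Z \<restriction> n) (fst (prod_decode i)) (snd (prod_decode i)))"
    have "\<forall>n. \<not> refuted (Z \<restriction> n) (fst (prod_decode i)) (snd (prod_decode i))"
      unfolding i_def by (rule LeastI_ex[OF ex])
    then have i: "\<not> refuted (Z \<restriction> n) (fst (prod_decode i)) (snd (prod_decode i))" for n by (rule spec)
    have least: "\<exists>n. refuted (Z \<restriction> n) (fst (prod_decode j)) (snd (prod_decode j))" if "j < i" for j
      using not_less_Least[OF that[unfolded i_def]] by blast
    have "\<forall>\<^sub>F n in sequentially. refuted (Z \<restriction> n) (fst (prod_decode j)) (snd (prod_decode j))" if j: "j < i" for j
    proof -
      obtain n0 where "refuted (Z \<restriction> n0) (fst (prod_decode j)) (snd (prod_decode j))"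
        using least[OF j] by blast
      then show ?thesis using refuted_mono unfolding eventually_sequentially by blast
    qed
    then have "\<forall>\<^sub>F n in sequentially. \<forall>j\<in>{..<i}. refuted (Z \<restriction> n) (fst (prod_decode j)) (snd (prod_decode j))"
      by (intro eventually_ball_finite) auto
    from this eventually_gt_at_top[of i]
    have "\<forall>\<^sub>F n in sequentially. L' (Z \<restriction> n) = h (fst (prod_decode i))"
    proof eventually_elim
      case (elim n)
      then have "hd (hyps (Z \<restriction> n)) = i"
        unfolding hyps_def using i by (intro hd_filter_upt) auto
      then show ?case by (simp add: L'_def)
    qed
    then have "(\<lambda>n. L' (Z \<restriction> n)) \<longlonglongrightarrow> h (fst (prod_decode i))" unfolding tendsto_discrete .
    \<comment> \<open>The set of a hypothesis that is never refuted has positive probability. On a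
      random member of it the learner converges to an index of some \<open>f Y\<close> with respect
      to which this member is random too, and orthogonality forces \<open>Y = Z\<close>.\<close>
    moreover have "real_index \<phi> (h (fst (prod_decode i))) Z"
    proof -
      let ?e = "fst (prod_decode i)" and ?t = "snd (prod_decode i)"
      have "\<not> prob (S ?e ?t) < (1/2) ^ ?t" using refutable i by blast
      moreover have "(0::real) < (1/2) ^ ?t" by simp
      ultimately have "prob (S ?e ?t) > 0" by linarith
      then obtain X where X: "X \<in> S ?e ?t" "random_wrt (f Z) X" using ex_random[of "S ?e ?t" Z] by auto
      obtain e Y where e: "(\<lambda>n. L (X \<restriction> n)) \<longlonglongrightarrow> e" "Y \<in> C" "measure_index m e (f Y)" "random_wrt (f Y) X"
        using learn[OF Z X(2)] by blast
      have "Y = Z" using random_unique e(2,4) X(2) Z assms(3) by blast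
      moreover have "(\<lambda>n. L (X \<restriction> n)) \<longlonglongrightarrow> ?e"
        using X(1) unfolding tendsto_discrete eventually_sequentially S_def by blast
      then have "e = ?e" using e(1) LIMSEQ_unique by blast
      ultimately show ?thesis using h(2) e(3) Z assms(3) by blast
    qed
    ultimately show ?thesis by blast
  qed
  ultimately show ?thesis unfolding EX_learnable_reals_def computable_learner_iff by blast
qed


text \<open>
  The hypotheses of the learner at the strings of one length are put to a vote, weighted by
  approximations to the measures of the strings. In the limit most of the weight is on strings at
  which the learner is right.
\<close>

lemma BC_measures_to_reals:
  assumes \<phi>: "acceptable_numbering {0, 1} \<phi>" and m: "acceptable_numbering UNIV m"
    and "C \<subseteq> D" "BC_learnable_measures m (f ` C)"
  shows "BC_learnable_reals \<phi> C"
proof -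
  obtain h where h: "effective h" "\<And>e Z. Z \<in> D \<Longrightarrow> measure_index m e (f Z) \<Longrightarrow> real_index \<phi> (h e) Z"
    using measure_index_to_real_index[OF \<phi> m] by blast
  obtain M v where M: "effective M" and v: "effective (\<lambda>q. v (fst q) (fst (snd q)) (snd (snd q)))"
    and approx: "\<And>p Z n \<sigma>. M p \<le> n \<Longrightarrow> length \<sigma> \<le> p \<Longrightarrow>
       \<bar>dyadic_val (v p (Z \<restriction> n) \<sigma>) - measure (f Z) (cylinder \<sigma>)\<bar> \<le> (1/2) ^ p"
    by (rule computable_measure_map_evaluation[OF f_computable]) blast
  obtain L where L: "effective L" and learn: "\<And>Z X. Z \<in> C \<Longrightarrow> random_wrt (f Z) X \<Longrightarrow>
      \<exists>n0. \<exists>Y\<in>C. random_wrt (f Y) X \<and> (\<forall>n>n0. measure_index m (L (X \<restriction> n)) (f Y))"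
    using assms(4) unfolding BC_learnable_measures_def computable_learner_iff by blast
  obtain st :: "nat \<Rightarrow> nat \<Rightarrow> nat \<Rightarrow> nat option" where
    st: "effective (\<lambda>q. st (fst q) (fst (snd q)) (snd (snd q)))"
    "\<And>s t e x y. st s e x = Some y \<Longrightarrow> s \<le> t \<Longrightarrow> st t e x = Some y"
    "\<And>e x y. \<phi> e x = Some y \<longleftrightarrow> (\<exists>s. st s e x = Some y)"
    by (rule acceptable_numbering_stages[OF \<phi>]) blast
  define vote where "vote T n s b = dyadic_sum (map snd (filter (\<lambda>p. st s (h (fst p)) n = Some b) T))"
    for T :: "(nat \<times> dyadic) list" and n s b
  \<comment> \<open>\<open>(1, 1)\<close> denotes 1/2. The votes are counted stage by stage, since a
    wrong hypothesis may never answer.\<close>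
  define wins where "wins T n s b \<longleftrightarrow> dless (1, 1) (vote T n s b)" for T n s b
  define P where "P t n s \<longleftrightarrow> wins (dec t) n s 0 \<or> wins (dec t) n s 1" for t n s
  define F where "F t n s = (if wins (dec t) n s 0 then 0 else 1 :: nat)" for t n s
  have eff_wins: "effective (\<lambda>q. wins (fst q) (fst (snd q)) (fst (snd (snd q))) (snd (snd (snd q))))"
    unfolding wins_def vote_def by (intro eff effective_comp3[OF st(1)] h(1)[THEN effective_comp])
  have "effective (\<lambda>q. P (fst q) (fst (snd q)) (snd (snd q)))" "effective (\<lambda>q. F (fst q) (fst (snd q)) (snd (snd q)))"
    unfolding P_def F_def by (intro eff effective_comp4[OF eff_wins])+
  moreover have "F t n s \<in> {0, 1}" for t n s by (simp add: F_def)
  ultimately obtain g where g: "effective g"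
    "\<And>t n. \<phi> (g t) n = (if \<exists>s. P t n s then Some (F t n (LEAST s. P t n s)) else None)"
    using acceptable_numbering_translate[OF \<phi>, of P F] by blast
  \<comment> \<open>The vote is taken at the greatest length \<open>k\<close> for which the bits of
    \<open>\<rho>\<close> suffice to weigh strings with precision \<open>2 * k\<close>. This length
    tends to infinity with that of \<open>\<rho>\<close>.\<close>
  define level where "level \<rho> = largest (\<lambda>k. M (2 * k) \<le> length \<rho>) (length \<rho>)" for \<rho> :: bitstring
  define table where "table \<rho> = map (\<lambda>\<sigma>. (L \<sigma>, v (2 * level \<rho>) \<rho> \<sigma>)) (strings (level \<rho>))" for \<rho>
  \<comment> \<open>The table is stored in the index, and the vote is carried out by the function so
    indexed. The index may keep changing with \<open>\<rho>\<close>, as behaviourally correct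
    learning allows.\<close>
  define L' where "L' \<rho> = g (enc (table \<rho>))" for \<rho>
  have eff_level: "effective level"
    unfolding level_def by (intro eff M[THEN effective_comp])
  have "effective L'"
    unfolding L'_def table_def
    by (intro eff g(1)[THEN effective_comp] L[THEN effective_comp] effective_comp3[OF v] eff_level[THEN effective_comp])
  moreover have "\<forall>\<^sub>F n in sequentially. real_index \<phi> (L' (Z \<restriction> n)) Z" if Z: "Z \<in> C" for Z
  proof -
    interpret prob_space "f Z" by (rule prob_space_f)
    define right where "right \<sigma> \<longleftrightarrow> measure_index m (L \<sigma>) (f Z)" for \<sigma>
    define S where "S t = {X. \<forall>j\<ge>t. right (X \<restriction> j)}" for t
    have S: "S t \<in> sets borel" for t unfolding S_def by (rule sets_all_initial)
    have "prob (\<Union>t. S t) = 1"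
    proof (rule measure_f_covering)
      show "(\<Union>t. S t) \<in> sets borel" by (intro sets.countable_UN) (auto intro: S)
      fix X assume X: "random_wrt (f Z) X"
      obtain n0 Y where Y: "Y \<in> C" "random_wrt (f Y) X" "\<forall>n>n0. measure_index m (L (X \<restriction> n)) (f Y)"
        using learn[OF Z X] by blast
      then have "Y = Z" using random_unique X Z assms(3) by blast
      then have "X \<in> S (Suc n0)" using Y(3) unfolding S_def right_def by simp
      then show "X \<in> (\<Union>t. S t)" by blast
    qed
    moreover have "(\<lambda>t. prob (S t)) \<longlonglongrightarrow> prob (\<Union>t. S t)"
    proof (rule finite_Lim_measure_incseq)
      show "range S \<subseteq> events" using S by (auto simp: sets_f)
      show "incseq S" unfolding incseq_def S_def by auto
    qed
    ultimately have "(\<lambda>t. prob (S t)) \<longlonglongrightarrow> 1" by simp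
    \<comment> \<open>With a total error of at most 1/8 in the weights, a correct share above 3/4
      gives the right value a weight above 5/8 and leaves a wrong value less than 1/4 + 1/8. The
      threshold 1/2 separates them, and the 3 in \<open>K\<close> below secures the error
      1/8.\<close>
    then have "\<forall>\<^sub>F t in sequentially. 3/4 < prob (S t)" by (rule order_tendstoD) simp
    then obtain t where t: "3/4 < prob (S t)" using eventually_happens'[OF sequentially_bot] by blast
    define K where "K = max t 3"
    have "real_index \<phi> (L' (Z \<restriction> n)) Z" if n: "K \<le> n" "M (2 * K) \<le> n" for n
    proof -
      define k where "k = level (Z \<restriction> n)"
      have k: "K \<le> k" "M (2 * k) \<le> n"
        using largest[of "\<lambda>k. M (2 * k) \<le> n" K n] n by (simp_all add: k_def level_def)
      define w where "w \<sigma> = dyadic_val (v (2 * k) (Z \<restriction> n) \<sigma>)" for \<sigma>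
      have T: "table (Z \<restriction> n) = map (\<lambda>\<sigma>. (L \<sigma>, v (2 * k) (Z \<restriction> n) \<sigma>)) (strings k)"
        by (simp add: table_def k_def)
      have "(1/2::real) ^ k \<le> (1/2) ^ 3" using k(1) by (intro power_decreasing) (auto simp: K_def)
      then have "(1/2::real) ^ k \<le> 1/8" by (simp add: power3_eq_cube)
      then have err: "\<bar>sum w A - prob (\<Union>\<sigma>\<in>A. cylinder \<sigma>)\<bar> \<le> 1/8" if "A \<subseteq> {\<sigma>. length \<sigma> = k}" for A
        using sum_measure_approx[OF f_measures, of A k w Z] approx[OF k(2)] that
        unfolding w_def by (smt (verit, best) mem_Collect_eq mult_2 le_add1 subset_iff)
      define A where "A = {\<sigma>. length \<sigma> = k \<and> right \<sigma>}"
      have "S t \<subseteq> (\<Union>\<sigma>\<in>A. cylinder \<sigma>)"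
      proof
        fix X assume "X \<in> S t"
        then have "X \<restriction> k \<in> A" using k(1) by (simp add: S_def A_def K_def)
        then show "X \<in> (\<Union>\<sigma>\<in>A. cylinder \<sigma>)" by (rule UN_I) simp
      qed
      then have "prob (S t) \<le> prob (\<Union>\<sigma>\<in>A. cylinder \<sigma>)"
        by (rule finite_measure_mono) (simp add: sets_f)
      with t have big: "3/4 < prob (\<Union>\<sigma>\<in>A. cylinder \<sigma>)" by linarith
      have votes: "dyadic_val (vote (table (Z \<restriction> n)) i s b) = sum w {\<sigma>. length \<sigma> = k \<and> st s (h (L \<sigma>)) i = Some b}"
        for i s b
      proof -
        have "vote (table (Z \<restriction> n)) i s b =
            dyadic_sum (map (v (2 * k) (Z \<restriction> n)) (filter (\<lambda>\<sigma>. st s (h (L \<sigma>)) i = Some b) (strings k)))"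
          unfolding vote_def T by (simp add: filter_map o_def)
        then have "dyadic_val (vote (table (Z \<restriction> n)) i s b) =
            sum_list (map w (filter (\<lambda>\<sigma>. st s (h (L \<sigma>)) i = Some b) (strings k)))"
          by (simp add: w_def[abs_def] o_def)
        also have "\<dots> = sum w (set (filter (\<lambda>\<sigma>. st s (h (L \<sigma>)) i = Some b) (strings k)))"
          by (rule sum_list_distinct_conv_sum_set) (simp add: distinct_strings)
        finally show ?thesis by simp
      qed
      have good: "\<phi> (h (L \<sigma>)) i = Some (of_bool (Z i))" if "\<sigma> \<in> A" for \<sigma> i
        using h(2)[of Z "L \<sigma>"] that Z assms(3) by (auto simp: A_def right_def real_index_def)
      have unique: "b = of_bool (Z i)" if "wins (table (Z \<restriction> n)) i s b" for i s b
      proof (rule ccontr)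
        assume b: "b \<noteq> of_bool (Z i)"
        let ?B = "{\<sigma>. length \<sigma> = k \<and> st s (h (L \<sigma>)) i = Some b}"
        have "A \<inter> ?B = {}"
        proof (rule ccontr)
          assume "A \<inter> ?B \<noteq> {}"
          then obtain \<sigma> where "\<sigma> \<in> A" "st s (h (L \<sigma>)) i = Some b" by blast
          then show False using good[of \<sigma> i] st(3)[of "h (L \<sigma>)" i b] b by auto
        qed
        then have "(\<Union>\<sigma>\<in>A. cylinder \<sigma>) \<inter> (\<Union>\<sigma>\<in>?B. cylinder \<sigma>) = {}"
          using disjoint_cylinders by (fastforce simp: A_def)
        then have "prob (\<Union>\<sigma>\<in>A. cylinder \<sigma>) + prob (\<Union>\<sigma>\<in>?B. cylinder \<sigma>) =
            prob ((\<Union>\<sigma>\<in>A. cylinder \<sigma>) \<union> (\<Union>\<sigma>\<in>?B. cylinder \<sigma>))"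
          by (intro finite_measure_Union[symmetric]) (simp_all add: sets_f)
        also have "\<dots> \<le> 1" by (rule prob_le_1)
        finally have "prob (\<Union>\<sigma>\<in>?B. cylinder \<sigma>) < 1/4" using big by linarith
        moreover have "1/2 < sum w ?B" using that votes by (simp add: wins_def dyadic_val_def)
        ultimately show False using err[of ?B] by auto
      qed
      have ex: "\<exists>s. wins (table (Z \<restriction> n)) i s (of_bool (Z i))" for i
      proof -
        \<comment> \<open>The strings at which the learner is right are finitely many, so at some
          stage all of them have answered.\<close>
        have "\<forall>\<sigma>\<in>A. \<exists>s. st s (h (L \<sigma>)) i = Some (of_bool (Z i))" using good st(3) by blast
        then obtain s where s: "\<And>\<sigma>. \<sigma> \<in> A \<Longrightarrow> st (s \<sigma>) (h (L \<sigma>)) i = Some (of_bool (Z i))" by metis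
        have "finite A" using finite_strings[of k] by (simp add: A_def)
        then have le: "s \<sigma> \<le> Max (s ` A)" if "\<sigma> \<in> A" for \<sigma> using that by simp
        let ?s = "Max (s ` A)"
        let ?B = "{\<sigma>. length \<sigma> = k \<and> st ?s (h (L \<sigma>)) i = Some (of_bool (Z i))}"
        have "A \<subseteq> ?B" using st(2)[OF s le] by (auto simp: A_def)
        then have "prob (\<Union>\<sigma>\<in>A. cylinder \<sigma>) \<le> prob (\<Union>\<sigma>\<in>?B. cylinder \<sigma>)"
          by (intro finite_measure_mono UN_mono order_refl) (simp_all add: sets_f)
        moreover have "\<bar>sum w ?B - prob (\<Union>\<sigma>\<in>?B. cylinder \<sigma>)\<bar> \<le> 1/8" by (rule err) auto
        ultimately have "1/2 < sum w ?B" using big by linarith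
        then show ?thesis unfolding wins_def dless_iff votes by (intro exI[of _ ?s]) (simp add: dyadic_val_def)
      qed
      show ?thesis
        unfolding real_index_def
      proof
        fix i
        let ?t = "enc (table (Z \<restriction> n))"
        have P: "P ?t i s \<longleftrightarrow> wins (table (Z \<restriction> n)) i s (of_bool (Z i))" for s
          using unique[of i s 0] unique[of i s 1] by (cases "Z i") (auto simp: P_def)
        have "\<exists>s. P ?t i s" using ex P by blast
        moreover from this have "P ?t i (LEAST s. P ?t i s)" by (rule LeastI_ex)
        then have "F ?t i (LEAST s. P ?t i s) = of_bool (Z i)"
          using unique[of i _ 0] P by (cases "Z i") (fastforce simp: F_def)+
        ultimately show "\<phi> (L' (Z \<restriction> n)) i = Some (of_bool (Z i))" by (simp add: L'_def g(2))
      qed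
    qed
    then show ?thesis unfolding eventually_sequentially
      by (intro exI[of _ "max K (M (2 * K))"]) simp
  qed
  ultimately show ?thesis unfolding BC_learnable_reals_def computable_learner_iff by blast
qed

end

theorem theorem1p6:
  fixes f :: "cantor \<Rightarrow> cantor measure"
    and D Dstar :: "cantor set"
    and \<phi> m :: "nat \<Rightarrow> nat \<Rightarrow> nat option"
  assumes "acceptable_numbering {0, 1} \<phi>"
    and "acceptable_numbering UNIV m"
    and "f \<in> UNIV \<rightarrow> \<M>"
    and "computable_measure_map f"
    and "effectively_closed D"
    and "\<And>X Y. X \<in> D \<Longrightarrow> Y \<in> D \<Longrightarrow> X \<noteq> Y \<Longrightarrow> effectively_orthogonal (f X) (f Y)"
    and "Dstar \<subseteq> D"
    and "\<And>Z. Z \<in> Dstar \<Longrightarrow> computable_real Z"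
  shows "(EX_learnable_reals \<phi> Dstar \<longleftrightarrow> EX_learnable_measures m (f ` Dstar)) \<and>
         (BC_learnable_reals \<phi> Dstar \<longleftrightarrow> BC_learnable_measures m (f ` Dstar))"
proof -
  obtain d where "uniform_deficiency d" using ex_uniform_deficiency[OF assms(2)] by blast
  then interpret orthogonal_images f D d
    using assms(3-6) by unfold_locales auto
  show ?thesis
    using EX_reals_to_measures[OF assms(1,2,7)] EX_measures_to_reals[OF assms(1,2,7)]
      BC_reals_to_measures[OF assms(1,2,7)] BC_measures_to_reals[OF assms(1,2,7)] by blast
qed

end
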